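(* There exist absolute constants $C_1,C_2,M>0$ and $\delta\in(0,1)$ (independent of $n,m,x_0$) such that, for all positive integers $n,m$ with $m\ge Mn$ and every fixed $x_0\in\mathbb{C}^n$, with probability at least $1-C_1\exp(-C_2m)$ over the random matrix $A$, the sequence $(z_t)_{t\ge 0}$ defined by taking $z_0$ to be a main eigenvector (an eigenvector for the largest eigenvalue) of $$\frac1m\sum_{i=1}^m |a_i^*x_0|^2\,a_ia_i^*\,1_{|a_i^*x_0|^2\le \frac9m\sum_{j=1}^m|a_j^*x_0|^2}$$ and $$z_t=A^\dagger\big(b\odot\mathrm{phase}(Az_{t-1})\big)\qquad (t\ge 1)$$ satisfies $$\forall t\in\mathbb{N},\ t\ge 1,\qquad \inf_{\phi\in\mathbb{R}}\|e^{i\phi}x_0-z_t\|\le \delta^t\|x_0\|.$$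
   Context: The sensing vectors $a_1,\dots,a_m\in\mathbb{C}^n$ are random; all coordinates $(a_i)_j$ are independent with law $\mathcal N(0,\tfrac12)+i\,\mathcal N(0,\tfrac12)$ (standard complex Gaussian, independent real and imaginary parts). $A\in\mathbb{C}^{m\times n}$ is the matrix whose $i$-th row is $a_i^*$. The vector $x_0\in\mathbb{C}^n$ is fixed (independent of $A$), and $b=|Ax_0|\in\mathbb{R}^m$, where the modulus of a vector is taken entrywise. $A^\dagger$ is the Moore–Penrose pseudo-inverse, $\odot$ is the entrywise product, and $\mathrm{phase}$ is applied entrywise with $\mathrm{phase}(z)=z/|z|$ for $z\in\mathbb{C}\setminus\{0\}$ and $\mathrm{phase}(0)=1$. $\|\cdot\|$ is the Euclidean norm. *)

theory Defs
  imports
    "HOL-Probability.Probability"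
    "Jordan_Normal_Form.Schur_Decomposition"
begin

(* Vectors and matrices are those of Jordan_Normal_Form, because the dimensions are
   quantified inside the statement; the finite Cartesian products are kept out of the way. *)
hide_type (open) Finite_Cartesian_Product.vec
hide_const (open) Finite_Cartesian_Product.vec Finite_Cartesian_Product.mat
  Finite_Cartesian_Product.row
no_notation vec_nth (infixl \<open>$\<close> 90)
no_notation inner (infix \<open>\<bullet>\<close> 70)

(* N(0,1/2) + i N(0,1/2), independent parts; normal_density takes the standard deviation. *)
definition std_complex_gaussian :: "complex measure" where
  "std_complex_gaussian =
     (let N = density lborel (normal_density 0 (sqrt (1 / 2)))
      in distr (N \<Otimes>\<^sub>M N) borel (\<lambda>(x, y). Complex x y))"

(* Joint law of the coordinates, on the canonical product space; w (i, j) is the j-th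
   coordinate of the i-th sensing vector. *)
definition sensing_space :: "nat \<Rightarrow> nat \<Rightarrow> (nat \<times> nat \<Rightarrow> complex) measure" where
  "sensing_space m n = PiM ({..<m} \<times> {..<n}) (\<lambda>_. std_complex_gaussian)"

definition sensing_vec :: "nat \<Rightarrow> (nat \<times> nat \<Rightarrow> complex) \<Rightarrow> nat \<Rightarrow> complex vec" where
  "sensing_vec n w i = vec n (\<lambda>j. w (i, j))"

definition sensing_mat :: "nat \<Rightarrow> nat \<Rightarrow> (nat \<times> nat \<Rightarrow> complex) \<Rightarrow> complex mat" where
  "sensing_mat m n w = mat_of_rows n (map (\<lambda>i. conjugate (sensing_vec n w i)) [0..<m])"

definition vnorm :: "complex vec \<Rightarrow> real" where
  "vnorm v = L2_set (\<lambda>i. cmod (v $ i)) {..<dim_vec v}"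

definition phase :: "complex \<Rightarrow> complex" where
  "phase z = (if z = 0 then 1 else z / complex_of_real (cmod z))"

definition entrywise_prod :: "complex vec \<Rightarrow> complex vec \<Rightarrow> complex vec" where
  "entrywise_prod u v = vec (dim_vec u) (\<lambda>i. u $ i * v $ i)"

definition is_moore_penrose :: "complex mat \<Rightarrow> complex mat \<Rightarrow> bool" where
  "is_moore_penrose A X \<longleftrightarrow>
     X \<in> carrier_mat (dim_col A) (dim_row A) \<and>
     A * X * A = A \<and> X * A * X = X \<and>
     mat_adjoint (A * X) = A * X \<and> mat_adjoint (X * A) = X * A"

(* Every matrix has exactly one Moore-Penrose inverse, so the description is proper. *)
definition pinv :: "complex mat \<Rightarrow> complex mat" where
  "pinv A = (THE X. is_moore_penrose A X)"

(* Here x0 \<bullet>c a i is the scalar a_i^* x0. *)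
definition init_mat :: "nat \<Rightarrow> nat \<Rightarrow> (nat \<Rightarrow> complex vec) \<Rightarrow> complex vec \<Rightarrow> complex mat" where
  "init_mat m n a x0 = mat n n (\<lambda>(j, k).
     1 / of_nat m *
     (\<Sum>i<m. if (cmod (x0 \<bullet>c a i))\<^sup>2 \<le> 9 / real m * (\<Sum>l<m. (cmod (x0 \<bullet>c a l))\<^sup>2)
            then complex_of_real ((cmod (x0 \<bullet>c a i))\<^sup>2) * (a i $ j * cnj (a i $ k))
            else 0))"

(* Meant for Hermitian matrices, whose eigenvalues are all real. *)
definition main_eigenvector :: "complex mat \<Rightarrow> complex vec \<Rightarrow> bool" where
  "main_eigenvector S v \<longleftrightarrow>
     (\<exists>k::real. eigenvector S v (complex_of_real k) \<and>
        (\<forall>l::real. eigenvalue S (complex_of_real l) \<longrightarrow> l \<le> k))"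

definition alt_proj_seq :: "complex mat \<Rightarrow> real vec \<Rightarrow> (nat \<Rightarrow> complex vec) \<Rightarrow> bool" where
  "alt_proj_seq A b z \<longleftrightarrow>
     (\<forall>t\<ge>1. z t = pinv A *\<^sub>v
        entrywise_prod (map_vec complex_of_real b) (map_vec phase (A *\<^sub>v z (t - 1))))"

end

theory Submission
  imports Defs
begin

text \<open>
  After normalisation \<open>x0 = r u\<close>, every estimate needed concerns a sum over the rows of a function of
  the pair \<open>(a\<^sub>i\<^sup>* u, a\<^sub>i\<^sup>* w)\<close>. By rotation invariance this pair is distributed as
  \<open>(g, \<langle>u, w\<rangle> g + c h)\<close> with independent standard \<open>g, h\<close>, so Chernoff's bound and a net of the unit
  ball control all these sums uniformly in \<open>w\<close>. On the resulting event, if \<open>d = x - u\<close> is small and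
  \<open>\<langle>u, d\<rangle>\<close> is real, replacing \<open>phase (A u)\<close> by \<open>phase (A x)\<close> costs at most \<open>6/5\<close> times the
  imaginary part of \<open>A d\<close> rotated by the phases of \<open>A u\<close>, which has norm about \<open>sqrt (m / 2) \<parallel>d\<parallel>\<close>,
  plus the contribution of the few rows where \<open>A d\<close> is not small against \<open>A u\<close>; as \<open>A\<close> is nearly \<open>sqrt m\<close> times an isometry and the pseudo-inverse solves a
  least-squares problem, each step contracts by \<open>19/20\<close>. The spectral initialisation is close to
  \<open>u\<close> because the Rayleigh quotient of its expectation separates \<open>u\<close> from the orthogonal directions.
\<close>

section \<open>Rotation invariance of the complex Gaussian law\<close>

text \<open>The iterates are built from the same rows as the estimates, so the bounds applied to
  them must hold for all displacements \<open>h\<close> at once, and so must the bound on the set of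
  bad rows, which depends on \<open>h\<close>. These rows are the main obstacle:
  \<open>phase\<close> is discontinuous at 0, and where \<open>A u\<close> is small a tiny
  \<open>h\<close> may turn the phase completely. Such a row costs at most
  \<open>12 * cmod (A h i)\<close>, and there are at most \<open>m / 10^7\<close> of them as long as
  \<open>h\<close> has norm at most \<open>1 / 10^9\<close>; this is why the initial vector has to
  be that accurate. On the other rows a contraction is possible because a radial perturbation does
  not alter a phase, so that one of two real dimensions is lost. The budget is
  \<open>6/5 * 0.7081 + 12 * 0.0033 < 0.9\<close>, and division by the lower frame bound
  \<open>0.99\<close> leaves less than \<open>19/20\<close>. In the initialisation the cutoff is
  discontinuous and its level random; two deterministic levels enclose it, and they have nearly the
  same effect because a circle has Gaussian measure zero.\<close>

lemma nn_integral_lborel_rotation: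
  fixes F :: "real \<times> real \<Rightarrow> ennreal"
  assumes [measurable]: "F \<in> borel_measurable borel" and cs: "c\<^sup>2 + s\<^sup>2 = 1"
  shows "(\<integral>\<^sup>+x. \<integral>\<^sup>+y. F (c * x - s * y, s * x + c * y) \<partial>lborel \<partial>lborel)
       = (\<integral>\<^sup>+x. \<integral>\<^sup>+y. F (x, y) \<partial>lborel \<partial>lborel)"
proof -
  have bb[simp]: "borel \<Otimes>\<^sub>M borel = (borel :: (real \<times> real) measure)"
    by (rule borel_prod)
  have [measurable]: "F \<in> borel_measurable (borel \<Otimes>\<^sub>M borel)" using assms(1) by simp
  have [measurable]: "(\<lambda>x. F (f x, g x)) \<in> borel_measurable M"
    if [measurable]: "f \<in> borel_measurable M" "g \<in> borel_measurable M" for f g and M :: "'x measure"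
    by measurable
  have swap: "(\<integral>\<^sup>+x. \<integral>\<^sup>+y. H x y \<partial>lborel \<partial>lborel) = (\<integral>\<^sup>+y. \<integral>\<^sup>+x. H x y \<partial>lborel \<partial>lborel)"
    if "(\<lambda>(x, y). H x y) \<in> borel_measurable (borel \<Otimes>\<^sub>M borel)" for H :: "real \<Rightarrow> real \<Rightarrow> ennreal"
    by (rule lborel_pair.Fubini'[symmetric])
      (use that in \<open>simp del: bb add: measurable_cong_sets[OF sets_pair_measure_cong[OF sets_lborel sets_lborel] refl]\<close>)
  show ?thesis
  proof (cases "c = 0")
    case False
    \<comment> \<open>For nonzero \<open>c\<close> the rotation factors into two affine maps of one
      variable each: \<open>c * x - s * y\<close> becomes the new \<open>x\<close>, and the second
      coordinate then reads \<open>(s * x + y) / c\<close>, by \<open>c^2 + s^2 = 1\<close>. The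
      Jacobians \<open>1/c\<close> and \<open>c\<close> cancel.\<close>
    have e: "s * (s * y / c + x / c) + c * y = s * x / c + y / c" for x y :: real
    proof -
      have "c * (s * (s * y / c + x / c) + c * y) = (c\<^sup>2 + s\<^sup>2) * y + s * x"
        using False by (simp add: field_simps power2_eq_square)
      also have "\<dots> = c * (s * x / c + y / c)" using False cs by (simp add: field_simps)
      finally show ?thesis using mult_left_cancel[OF False] by blast
    qed
    have "(\<integral>\<^sup>+x. \<integral>\<^sup>+y. F (c * x - s * y, s * x + c * y) \<partial>lborel \<partial>lborel)
        = (\<integral>\<^sup>+y. \<integral>\<^sup>+x. F (c * x - s * y, s * x + c * y) \<partial>lborel \<partial>lborel)"
      by (rule swap) measurable
    also have "\<dots> = (\<integral>\<^sup>+y. ennreal \<bar>1/c\<bar> * (\<integral>\<^sup>+x. F (x, s * x / c + y / c) \<partial>lborel) \<partial>lborel)"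
    proof (rule nn_integral_cong)
      fix y
      have e1: "c * (s * y / c + 1 / c * x) - s * y = x" for x
        using False by (simp add: field_simps)
      have e2: "s * (s * y / c + 1 / c * x) + c * y = s * x / c + y / c" for x
        using e[of y x] by simp
      have "(\<integral>\<^sup>+x. F (c * x - s * y, s * x + c * y) \<partial>lborel) =
        ennreal \<bar>1/c\<bar> * (\<integral>\<^sup>+x. F (c * (s * y / c + 1 / c * x) - s * y, s * (s * y / c + 1 / c * x) + c * y) \<partial>lborel)"
        by (rule nn_integral_real_affine) (use False in auto)
      then show "(\<integral>\<^sup>+x. F (c * x - s * y, s * x + c * y) \<partial>lborel) = 
         ennreal \<bar>1/c\<bar> * (\<integral>\<^sup>+x. F (x, s * x / c + y / c) \<partial>lborel)"
        unfolding e1 e2 .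
    qed
    also have "\<dots> = ennreal \<bar>1/c\<bar> * (\<integral>\<^sup>+y. (\<integral>\<^sup>+x. F (x, s * x / c + y / c) \<partial>lborel) \<partial>lborel)"
      by (rule nn_integral_cmult) measurable
    also have "\<dots> = ennreal \<bar>1/c\<bar> * (\<integral>\<^sup>+x. (\<integral>\<^sup>+y. F (x, s * x / c + y / c) \<partial>lborel) \<partial>lborel)"
      by (rule arg_cong[where f="\<lambda>t. ennreal \<bar>1/c\<bar> * t", OF swap]) measurable
    also have "\<dots> = (\<integral>\<^sup>+x. ennreal \<bar>1/c\<bar> * (\<integral>\<^sup>+y. F (x, s * x / c + y / c) \<partial>lborel) \<partial>lborel)"
      by (rule nn_integral_cmult[symmetric]) measurable
    also have "\<dots> = (\<integral>\<^sup>+x. \<integral>\<^sup>+y. F (x, y) \<partial>lborel \<partial>lborel)"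
    proof (rule nn_integral_cong)
      fix x
      have "(\<integral>\<^sup>+y. F (x, y) \<partial>lborel) = ennreal \<bar>1/c\<bar> * (\<integral>\<^sup>+y. F (x, s * x / c + 1/c * y) \<partial>lborel)"
        by (rule nn_integral_real_affine) (use False in auto)
      then show "ennreal \<bar>1/c\<bar> * (\<integral>\<^sup>+y. F (x, s * x / c + y / c) \<partial>lborel) = (\<integral>\<^sup>+y. F (x, y) \<partial>lborel)"
        by simp
    qed
    finally show ?thesis .
  next
    case True
    \<comment> \<open>With \<open>c = 0\<close> the map is a quarter turn, that is, sign changes in
      single variables together with an exchange of the two variables.\<close>
    then have s: "\<bar>s\<bar> = 1" "s \<noteq> 0" using cs by (auto simp: power2_eq_1_iff)
    have "(\<integral>\<^sup>+x. \<integral>\<^sup>+y. F (c * x - s * y, s * x + c * y) \<partial>lborel \<partial>lborel) =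
      (\<integral>\<^sup>+x. \<integral>\<^sup>+y. F (0 + (-s) * y, s * x) \<partial>lborel \<partial>lborel)" using True by simp
    also have "\<dots> = (\<integral>\<^sup>+x. \<integral>\<^sup>+y. F (y, 0 + s * x) \<partial>lborel \<partial>lborel)"
    proof (rule nn_integral_cong)
      fix x
      have "(\<integral>\<^sup>+y. F (y, s * x) \<partial>lborel) = ennreal \<bar>-s\<bar> * (\<integral>\<^sup>+y. F (0 + (-s) * y, s * x) \<partial>lborel)"
        by (rule nn_integral_real_affine) (use s in auto)
      then show "(\<integral>\<^sup>+y. F (0 + (-s) * y, s * x) \<partial>lborel) = (\<integral>\<^sup>+y. F (y, 0 + s * x) \<partial>lborel)"
        using s(1) by simp
    qed
    also have "\<dots> = (\<integral>\<^sup>+x. \<integral>\<^sup>+y. F (y, x) \<partial>lborel \<partial>lborel)"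
    proof -
      have "(\<integral>\<^sup>+x. \<integral>\<^sup>+y. F (y, x) \<partial>lborel \<partial>lborel)
        = ennreal \<bar>s\<bar> * (\<integral>\<^sup>+x. \<integral>\<^sup>+y. F (y, 0 + s * x) \<partial>lborel \<partial>lborel)"
        by (rule nn_integral_real_affine[where f="\<lambda>x. \<integral>\<^sup>+y. F (y, x) \<partial>lborel"]) (use s in measurable)
      then show ?thesis using s(1) by simp
    qed
    also have "\<dots> = (\<integral>\<^sup>+x. \<integral>\<^sup>+y. F (x, y) \<partial>lborel \<partial>lborel)"
      by (rule swap) measurable
    finally show ?thesis .
  qed
qed

section \<open>The real Gaussian law of variance 1/2 and the complex law built from it\<close>

definition gauss :: "real measure" where
  "gauss = density lborel (normal_density 0 (sqrt (1 / 2)))"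

lemma prob_space_gauss: "prob_space gauss"
  unfolding gauss_def by (rule prob_space_normal_density) simp

lemma sets_gauss [measurable_cong]: "sets gauss = sets borel"
  by (simp add: gauss_def)

lemma space_gauss [simp]: "space gauss = UNIV"
  by (simp add: gauss_def)

interpretation gauss: prob_space gauss by (rule prob_space_gauss)
interpretation gauss2: pair_prob_space gauss gauss ..

lemma nn_integral_gauss:
  assumes "f \<in> borel_measurable borel"
  shows "(\<integral>\<^sup>+x. f x \<partial>gauss) = (\<integral>\<^sup>+x. ennreal (normal_density 0 (sqrt (1 / 2)) x) * f x \<partial>lborel)"
  unfolding gauss_def using assms by (subst nn_integral_density) auto

text \<open>The joint density of two such variables is \<open>1 / pi * exp (- (x^2 + y^2))\<close>,
  a function of the radius alone, so the rotation invariance of Lebesgue measure carries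
  over.\<close>

lemma nn_integral_gauss_rotation:
  fixes F :: "real \<times> real \<Rightarrow> ennreal"
  assumes [measurable]: "F \<in> borel_measurable borel" and cs: "c\<^sup>2 + s\<^sup>2 = 1"
  shows "(\<integral>\<^sup>+x. \<integral>\<^sup>+y. F (c * x - s * y, s * x + c * y) \<partial>gauss \<partial>gauss)
       = (\<integral>\<^sup>+x. \<integral>\<^sup>+y. F (x, y) \<partial>gauss \<partial>gauss)"
proof -
  let ?d = "normal_density 0 (sqrt (1 / 2))"
  have bb[simp]: "borel \<Otimes>\<^sub>M borel = (borel :: (real \<times> real) measure)"
    by (rule borel_prod)
  have [measurable]: "F \<in> borel_measurable (borel \<Otimes>\<^sub>M borel)" using assms(1) by simp
  have dd: "?d x * ?d y = 1 / pi * exp (- (x\<^sup>2 + y\<^sup>2))" for x y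
    by (simp add: normal_density_def exp_add[symmetric])
  have nn: "?d x \<ge> 0" for x by simp
  have expand: "(\<integral>\<^sup>+x. \<integral>\<^sup>+y. H x y \<partial>gauss \<partial>gauss) =
      (\<integral>\<^sup>+x. \<integral>\<^sup>+y. ennreal (1 / pi * exp (- (x\<^sup>2 + y\<^sup>2))) * H x y \<partial>lborel \<partial>lborel)"
    if [measurable]: "(\<lambda>(x, y). H x y) \<in> borel_measurable (borel \<Otimes>\<^sub>M borel)" for H
    by (simp add: nn_integral_gauss nn_integral_cmult[symmetric] mult.assoc[symmetric]
        ennreal_mult[symmetric] dd)
  have inv: "(c * x - s * y)\<^sup>2 + (s * x + c * y)\<^sup>2 = x\<^sup>2 + y\<^sup>2" for x y
  proof -
    have "(c * x - s * y)\<^sup>2 + (s * x + c * y)\<^sup>2 = (c\<^sup>2 + s\<^sup>2) * (x\<^sup>2 + y\<^sup>2)"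
      by (simp add: power2_eq_square algebra_simps)
    then show ?thesis using cs by simp
  qed
  let ?F = "\<lambda>p. ennreal (1 / pi * exp (- ((fst p)\<^sup>2 + (snd p)\<^sup>2))) * F p"
  have "(\<integral>\<^sup>+x. \<integral>\<^sup>+y. F (c * x - s * y, s * x + c * y) \<partial>gauss \<partial>gauss) =
    (\<integral>\<^sup>+x. \<integral>\<^sup>+y. ?F (c * x - s * y, s * x + c * y) \<partial>lborel \<partial>lborel)"
    by (subst expand) (measurable, simp add: inv)
  also have "\<dots> = (\<integral>\<^sup>+x. \<integral>\<^sup>+y. ?F (x, y) \<partial>lborel \<partial>lborel)"
  proof (rule nn_integral_lborel_rotation[OF _ cs])
    have "?F \<in> borel_measurable (borel \<Otimes>\<^sub>M borel)" by measurable
    then show "?F \<in> borel_measurable borel" by simp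
  qed
  also have "\<dots> = (\<integral>\<^sup>+x. \<integral>\<^sup>+y. F (x, y) \<partial>gauss \<partial>gauss)"
    by (subst expand) simp_all
  finally show ?thesis .
qed

lemma nn_integral_gauss_uminus:
  assumes "f \<in> borel_measurable borel"
  shows "(\<integral>\<^sup>+x. f (- x) \<partial>gauss) = (\<integral>\<^sup>+x. f x \<partial>gauss)"
proof -
  have [measurable]: "f \<in> borel_measurable borel" by fact
  have "(\<integral>\<^sup>+x. f x \<partial>gauss) = (\<integral>\<^sup>+x. ennreal (normal_density 0 (sqrt (1 / 2)) x) * f x \<partial>lborel)"
    by (rule nn_integral_gauss) fact
  also have "\<dots> = ennreal \<bar>-1\<bar> * (\<integral>\<^sup>+x. ennreal (normal_density 0 (sqrt (1 / 2)) (0 + (-1) * x)) * f (0 + (-1) * x) \<partial>lborel)"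
    by (rule nn_integral_real_affine) auto
  also have "\<dots> = (\<integral>\<^sup>+x. ennreal (normal_density 0 (sqrt (1 / 2)) x) * f (- x) \<partial>lborel)"
    by (simp add: normal_density_def)
  also have "\<dots> = (\<integral>\<^sup>+x. f (- x) \<partial>gauss)" by (subst nn_integral_gauss) auto
  finally show ?thesis by simp
qed

abbreviation cgauss :: "complex measure" where
  "cgauss \<equiv> std_complex_gaussian"

lemma std_complex_gaussian_eq:
  "cgauss = distr (gauss \<Otimes>\<^sub>M gauss) borel (\<lambda>(x, y). Complex x y)"
  by (simp add: std_complex_gaussian_def gauss_def Let_def)

lemma measurable_Complex_pair [measurable]:
  assumes [measurable]: "f \<in> borel_measurable M" "g \<in> borel_measurable M"
  shows "(\<lambda>x. Complex (f x) (g x)) \<in> borel_measurable M"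
  unfolding Complex_eq by measurable

lemma sets_std_complex_gaussian [measurable_cong]: "sets cgauss = sets borel"
  by (simp add: std_complex_gaussian_eq)

lemma space_std_complex_gaussian [simp]: "space cgauss = UNIV"
  by (simp add: std_complex_gaussian_eq)

lemma prob_space_std_complex_gaussian: "prob_space cgauss"
  unfolding std_complex_gaussian_eq by (rule gauss2.prob_space_distr) measurable

interpretation cg: prob_space cgauss by (rule prob_space_std_complex_gaussian)
interpretation cg2: pair_prob_space cgauss cgauss ..

lemma nn_integral_std_complex_gaussian:
  assumes [measurable]: "f \<in> borel_measurable borel"
  shows "(\<integral>\<^sup>+z. f z \<partial>cgauss) = (\<integral>\<^sup>+x. \<integral>\<^sup>+y. f (Complex x y) \<partial>gauss \<partial>gauss)"
proof -
  have "(\<integral>\<^sup>+z. f z \<partial>cgauss) = (\<integral>\<^sup>+p. f (Complex (fst p) (snd p)) \<partial>(gauss \<Otimes>\<^sub>M gauss))"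
    unfolding std_complex_gaussian_eq by (subst nn_integral_distr) (measurable, simp add: case_prod_beta)
  also have "\<dots> = (\<integral>\<^sup>+x. \<integral>\<^sup>+y. f (Complex x y) \<partial>gauss \<partial>gauss)"
    by (subst gauss.nn_integral_fst[where f="\<lambda>p. f (Complex (fst p) (snd p))", symmetric]) simp_all
  finally show ?thesis .
qed

lemma nn_integral_cg_phase:
  assumes [measurable]: "f \<in> borel_measurable borel" and k: "cmod k = 1"
  shows "(\<integral>\<^sup>+z. f (k * z) \<partial>cgauss) = (\<integral>\<^sup>+z. f z \<partial>cgauss)"
proof -
  have cs: "(Re k)\<^sup>2 + (Im k)\<^sup>2 = 1" using k by (simp add: cmod_def)
  have "(\<integral>\<^sup>+z. f (k * z) \<partial>cgauss) =
    (\<integral>\<^sup>+x. \<integral>\<^sup>+y. (\<lambda>p. f (Complex (fst p) (snd p))) (Re k * x - Im k * y, Im k * x + Re k * y) \<partial>gauss \<partial>gauss)"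
    by (subst nn_integral_std_complex_gaussian) (auto simp: complex_mult intro!: nn_integral_cong arg_cong[of _ _ f] complex_eqI)
  also have "\<dots> = (\<integral>\<^sup>+x. \<integral>\<^sup>+y. (\<lambda>p. f (Complex (fst p) (snd p))) (x, y) \<partial>gauss \<partial>gauss)"
    by (rule nn_integral_gauss_rotation[OF _ cs]) (simp flip: borel_prod)
  also have "\<dots> = (\<integral>\<^sup>+z. f z \<partial>cgauss)"
    by (subst nn_integral_std_complex_gaussian) auto
  finally show ?thesis .
qed

text \<open>The sensing vectors act through \<open>a_i^*\<close>, so their coordinates occur
  conjugated; invariance under conjugation removes this from the joint law.\<close>

lemma nn_integral_cg_cnj:
  assumes [measurable]: "f \<in> borel_measurable borel"
  shows "(\<integral>\<^sup>+z. f (cnj z) \<partial>cgauss) = (\<integral>\<^sup>+z. f z \<partial>cgauss)"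
proof -
  have [measurable]: "cnj \<in> borel_measurable borel"
    by (intro borel_measurable_continuous_onI continuous_intros)
  have "(\<integral>\<^sup>+z. f (cnj z) \<partial>cgauss) = (\<integral>\<^sup>+x. \<integral>\<^sup>+y. f (Complex x (- y)) \<partial>gauss \<partial>gauss)"
    by (subst nn_integral_std_complex_gaussian) (auto simp: complex_cnj)
  also have "\<dots> = (\<integral>\<^sup>+x. \<integral>\<^sup>+y. f (Complex x y) \<partial>gauss \<partial>gauss)"
  proof (rule nn_integral_cong)
    fix x show "(\<integral>\<^sup>+y. f (Complex x (- y)) \<partial>gauss) = (\<integral>\<^sup>+y. f (Complex x y) \<partial>gauss)"
      by (rule nn_integral_gauss_uminus[where f="\<lambda>y. f (Complex x y)"]) measurable
  qed
  finally show ?thesis by (subst nn_integral_std_complex_gaussian) auto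
qed

text \<open>With real \<open>c\<close> and \<open>s\<close> the real parts and the imaginary parts
  are turned separately by the same plane rotation. The four real integrals are therefore regrouped
  so that the two real parts stand together and the two imaginary parts stand together.\<close>

lemma nn_integral_cg_Givens:
  assumes [measurable]: "f \<in> borel_measurable (borel \<Otimes>\<^sub>M borel)" and cs: "c\<^sup>2 + s\<^sup>2 = (1::real)"
  shows "(\<integral>\<^sup>+z. \<integral>\<^sup>+z'. f (of_real c * z - of_real s * z', of_real s * z + of_real c * z')
            \<partial>cgauss \<partial>cgauss)
       = (\<integral>\<^sup>+z. \<integral>\<^sup>+z'. f (z, z') \<partial>cgauss \<partial>cgauss)"
proof -
  let ?F = "\<lambda>x y x' y'. f (Complex x y, Complex x' y')"
  have expand: "(\<integral>\<^sup>+z. \<integral>\<^sup>+z'. h (z, z') \<partial>cgauss \<partial>cgauss) =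
     (\<integral>\<^sup>+x. \<integral>\<^sup>+x'. \<integral>\<^sup>+y. \<integral>\<^sup>+y'. h (Complex x y, Complex x' y') \<partial>gauss \<partial>gauss \<partial>gauss \<partial>gauss)"
    if [measurable]: "h \<in> borel_measurable (borel \<Otimes>\<^sub>M borel)" for h :: "complex \<times> complex \<Rightarrow> ennreal"
  proof -
    have "(\<integral>\<^sup>+z. \<integral>\<^sup>+z'. h (z, z') \<partial>cgauss \<partial>cgauss) =
     (\<integral>\<^sup>+x. \<integral>\<^sup>+y. \<integral>\<^sup>+x'. \<integral>\<^sup>+y'. h (Complex x y, Complex x' y') \<partial>gauss \<partial>gauss \<partial>gauss \<partial>gauss)"
      by (simp add: nn_integral_std_complex_gaussian)
    also have "\<dots> = (\<integral>\<^sup>+x. \<integral>\<^sup>+x'. \<integral>\<^sup>+y. \<integral>\<^sup>+y'. h (Complex x y, Complex x' y') \<partial>gauss \<partial>gauss \<partial>gauss \<partial>gauss)"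
      by (intro nn_integral_cong gauss2.Fubini'[symmetric]) measurable
    finally show ?thesis .
  qed
  let ?f = "\<lambda>p. f (of_real c * fst p - of_real s * snd p, of_real s * fst p + of_real c * snd p)"
  have m: "(\<lambda>p. H (fst p) (snd p)) \<in> borel_measurable borel"
    if "(\<lambda>p. H (fst p) (snd p)) \<in> borel_measurable (borel \<Otimes>\<^sub>M borel)" for H :: "real \<Rightarrow> real \<Rightarrow> ennreal"
    using that unfolding borel_prod .
  have "(\<integral>\<^sup>+z. \<integral>\<^sup>+z'. ?f (z, z') \<partial>cgauss \<partial>cgauss) =
     (\<integral>\<^sup>+x. \<integral>\<^sup>+x'. \<integral>\<^sup>+y. \<integral>\<^sup>+y'. ?f (Complex x y, Complex x' y') \<partial>gauss \<partial>gauss \<partial>gauss \<partial>gauss)"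
    by (rule expand) measurable
  also have "\<dots> = (\<integral>\<^sup>+x. \<integral>\<^sup>+x'. \<integral>\<^sup>+y. \<integral>\<^sup>+y'. (\<lambda>q. ?F (c * x - s * x') (fst q) (s * x + c * x') (snd q)) (c * y - s * y', s * y + c * y')
      \<partial>gauss \<partial>gauss \<partial>gauss \<partial>gauss)"
    by (auto intro!: nn_integral_cong arg_cong[of _ _ f] complex_eqI)
  also have "\<dots> = (\<integral>\<^sup>+x. \<integral>\<^sup>+x'. \<integral>\<^sup>+y. \<integral>\<^sup>+y'. (\<lambda>q. ?F (c * x - s * x') (fst q) (s * x + c * x') (snd q)) (y, y')
      \<partial>gauss \<partial>gauss \<partial>gauss \<partial>gauss)"
    by (intro nn_integral_cong nn_integral_gauss_rotation[OF m cs]) measurable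
  also have "\<dots> = (\<integral>\<^sup>+x. \<integral>\<^sup>+x'. (\<lambda>p. \<integral>\<^sup>+y. \<integral>\<^sup>+y'. ?F (fst p) y (snd p) y' \<partial>gauss \<partial>gauss) (c * x - s * x', s * x + c * x') \<partial>gauss \<partial>gauss)"
    by simp
  also have "\<dots> = (\<integral>\<^sup>+x. \<integral>\<^sup>+x'. (\<lambda>p. \<integral>\<^sup>+y. \<integral>\<^sup>+y'. ?F (fst p) y (snd p) y' \<partial>gauss \<partial>gauss) (x, x') \<partial>gauss \<partial>gauss)"
    by (intro nn_integral_gauss_rotation[OF m cs]) measurable
  also have "\<dots> = (\<integral>\<^sup>+z. \<integral>\<^sup>+z'. f (z, z') \<partial>cgauss \<partial>cgauss)"
    by (subst expand) auto
  finally show ?thesis by simp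
qed

section \<open>Joint law of two linear functionals\<close>

text \<open>Vectors are plain functions of which only the first \<open>n\<close> coordinates count,
  so that the dimension can vary freely. For a row \<open>a i\<close> the value
  \<open>dotc n (a i) x\<close> is the scalar \<open>a_i^* x\<close>.\<close>

definition dotc :: "nat \<Rightarrow> (nat \<Rightarrow> complex) \<Rightarrow> (nat \<Rightarrow> complex) \<Rightarrow> complex" where
  "dotc n u v = (\<Sum>j<n. cnj (u j) * v j)"

abbreviation gvec :: "nat \<Rightarrow> (nat \<Rightarrow> complex) measure" where
  "gvec n \<equiv> PiM {..<n} (\<lambda>_. cgauss)"

interpretation cgp: product_prob_space "\<lambda>_. cgauss" for I :: "'i set"
  by standard

lemma measurable_cnj [measurable]:
  assumes "f \<in> borel_measurable M" shows "(\<lambda>x. cnj (f x)) \<in> borel_measurable M"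
proof -
  have "cnj \<in> borel_measurable borel"
    by (intro borel_measurable_continuous_onI continuous_intros)
  from measurable_compose[OF assms this] show ?thesis by simp
qed

lemma measurable_dotc [measurable]:
  "(\<lambda>x. dotc n x v) \<in> borel_measurable (gvec n)"
  unfolding dotc_def by measurable

lemma emeasure_cg_UNIV [simp]: "emeasure cgauss UNIV = 1"
  using cg.emeasure_space_1 by simp

text \<open>Independent Gaussians add up to a Gaussian, and so do their variances. The phase of
  \<open>d\<close> is absorbed in \<open>z\<close>; then the Givens rotation with cosine
  \<open>cmod d / r\<close> and sine \<open>c / r\<close> turns the combination into
  \<open>r * z\<close>, which no longer involves \<open>h\<close>.\<close>

lemma nn_integral_cg_combine:
  assumes [measurable]: "f \<in> borel_measurable borel" and r: "r \<ge> 0" "r\<^sup>2 = (cmod d)\<^sup>2 + c\<^sup>2"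
  shows "(\<integral>\<^sup>+z. \<integral>\<^sup>+h. f (d * z + of_real c * h) \<partial>cgauss \<partial>cgauss)
       = (\<integral>\<^sup>+z. f (of_real r * z) \<partial>cgauss)"
proof (cases "r = 0")
  case True
  then have "d = 0" "c = 0" using r by (auto simp: sum_power2_eq_zero_iff)
  then show ?thesis using True by (simp add: cg.emeasure_space_1)
next
  case False
  define k where "k = (if d = 0 then 1 else sgn d)"
  have k: "cmod k = 1" "d = of_real (cmod d) * k"
    by (auto simp: k_def norm_sgn sgn_div_norm scaleR_conv_of_real norm_mult norm_inverse)
  have "(\<integral>\<^sup>+z. \<integral>\<^sup>+h. f (d * z + of_real c * h) \<partial>cgauss \<partial>cgauss) =
    (\<integral>\<^sup>+z. (\<lambda>z. \<integral>\<^sup>+h. f (of_real (cmod d) * z + of_real c * h) \<partial>cgauss) (k * z) \<partial>cgauss)"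
    by (subst k(2)) (simp add: mult.assoc)
  also have "\<dots> = (\<integral>\<^sup>+z. \<integral>\<^sup>+h. (\<lambda>p. f (of_real (cmod d) * fst p + of_real c * snd p)) (z, h) \<partial>cgauss \<partial>cgauss)"
    by (subst nn_integral_cg_phase[OF _ k(1)]) simp_all
  also have "\<dots> = (\<integral>\<^sup>+z. \<integral>\<^sup>+h. (\<lambda>p. f (of_real (cmod d) * fst p + of_real c * snd p)) 
     (of_real (cmod d / r) * z - of_real (c / r) * h, of_real (c / r) * z + of_real (cmod d / r) * h) \<partial>cgauss \<partial>cgauss)"
  proof (rule nn_integral_cg_Givens[symmetric])
    show "(cmod d / r)\<^sup>2 + (c / r)\<^sup>2 = 1" 
    proof -
      have "(cmod d / r)\<^sup>2 + (c / r)\<^sup>2 = r\<^sup>2 / r\<^sup>2"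
        unfolding power_divide r(2) add_divide_distrib ..
      then show ?thesis using False by simp
    qed
  qed measurable
  also have "\<dots> = (\<integral>\<^sup>+z. \<integral>\<^sup>+h. f (of_real r * z) \<partial>cgauss \<partial>cgauss)"
  proof -
    have "of_real (cmod d) * (of_real (cmod d / r) * z - of_real (c / r) * h) + of_real c * (of_real (c / r) * z + of_real (cmod d / r) * h)
       = of_real r * z" for z h :: complex
    proof -
      have "of_real (cmod d) * (of_real (cmod d / r) * z - of_real (c / r) * h) + of_real c * (of_real (c / r) * z + of_real (cmod d / r) * h)
        = of_real (((cmod d)\<^sup>2 + c\<^sup>2) / r) * z"
        using False by (simp add: field_simps power2_eq_square)
      also have "((cmod d)\<^sup>2 + c\<^sup>2) / r = r" unfolding r(2)[symmetric] using False by (simp add: power2_eq_square)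
      finally show ?thesis .
    qed
    then show ?thesis by simp
  qed
  finally show ?thesis by (simp add: cg.emeasure_space_1)
qed

text \<open>Induction on the dimension: a Givens rotation of \<open>g\<close> and the new coordinate
  \<open>y\<close> concentrates the first functional on \<open>g\<close> again, and what remains of
  \<open>y\<close> in the second one merges with \<open>h\<close>. The coefficient \<open>b\<close>
  is characterised by \<open>a * b = <u, w>\<close> and not by a quotient, because initial segments
  of a unit vector may vanish, and then \<open>a = 0\<close>.\<close>

lemma joint_law_ex:
  "\<exists>a b c. a \<ge> 0 \<and> c \<ge> 0 \<and> a\<^sup>2 = (\<Sum>j<n. (cmod (u j))\<^sup>2) \<and> of_real a * b = dotc n u w \<and>
     (cmod b)\<^sup>2 + c\<^sup>2 = (\<Sum>j<n. (cmod (w j))\<^sup>2) \<and>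
     (\<forall>f :: complex \<times> complex \<Rightarrow> ennreal. f \<in> borel_measurable (borel \<Otimes>\<^sub>M borel) \<longrightarrow>
        (\<integral>\<^sup>+x. f (dotc n x u, dotc n x w) \<partial>gvec n) =
        (\<integral>\<^sup>+g. \<integral>\<^sup>+h. f (of_real a * g, b * g + of_real c * h) \<partial>cgauss \<partial>cgauss))"
proof (induction n)
  case 0
  show ?case
    by (rule exI[of _ 0], rule exI[of _ 0], rule exI[of _ 0])
       (simp add: dotc_def cg.emeasure_space_1 prob_space.emeasure_space_1[OF prob_space_PiM] nn_integral_const prob_space_std_complex_gaussian)
next
  case (Suc n)
  let ?G = cgauss
  obtain a b c where a: "a \<ge> 0" "a\<^sup>2 = (\<Sum>j<n. (cmod (u j))\<^sup>2)" and ab: "of_real a * b = dotc n u w"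
    and c: "c \<ge> 0" and bc: "(cmod b)\<^sup>2 + c\<^sup>2 = (\<Sum>j<n. (cmod (w j))\<^sup>2)" and law:
    "\<And>f :: complex \<times> complex \<Rightarrow> ennreal. f \<in> borel_measurable (borel \<Otimes>\<^sub>M borel) \<Longrightarrow>
        (\<integral>\<^sup>+x. f (dotc n x u, dotc n x w) \<partial>gvec n) =
        (\<integral>\<^sup>+g. \<integral>\<^sup>+h. f (of_real a * g, b * g + of_real c * h) \<partial>?G \<partial>?G)"
    using Suc by blast
  \<comment> \<open>The phase of \<open>u n\<close> is moved into the new Gaussian variable, which
    then enters the first functional with the real factor \<open>s\<close> and the second with the
    factor \<open>v\<close>.\<close>
  define k where "k = (if u n = 0 then 1 else sgn (u n))"
  define s where "s = cmod (u n)"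
  define v where "v = cnj k * w n"
  have k: "cmod k = 1" "u n = of_real s * k"
    by (auto simp: k_def s_def norm_sgn sgn_div_norm scaleR_conv_of_real norm_mult norm_inverse)
  have kk: "cnj k * k = 1" using k(1) by (simp add: complex_norm_square mult.commute flip: complex_norm_square)
  have wv: "w n = v * k" using kk by (simp add: v_def mult.assoc mult.left_commute)
  have nv: "cmod v = cmod (w n)" using k(1) by (simp add: v_def norm_mult)
  define a' where "a' = sqrt (a\<^sup>2 + s\<^sup>2)"
  \<comment> \<open>Cosine and sine of the rotation that carries \<open>(a, s)\<close> to
    \<open>(a', 0)\<close>; if both entries vanish, the identity is taken.\<close>
  define p where "p = (if a' = 0 then 1 else a / a')"
  define q where "q = (if a' = 0 then 0 else s / a')"
  have a'2: "a'\<^sup>2 = a\<^sup>2 + s\<^sup>2" by (simp add: a'_def)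
  have a'0: "a = 0 \<and> s = 0" if "a' = 0" using that a'2 by (simp add: sum_power2_eq_zero_iff)
  have pq: "p\<^sup>2 + q\<^sup>2 = 1"
    by (auto simp: p_def q_def power_divide a'2[symmetric] simp flip: add_divide_distrib)
  have ap: "a = a' * p" "s = a' * q" using a'0 by (auto simp: p_def q_def)
  have apq: "a * p + s * q = a'"
  proof -
    have "a * p + s * q = a' * (p\<^sup>2 + q\<^sup>2)" unfolding ap by (simp add: power2_eq_square algebra_simps)
    then show ?thesis using pq by simp
  qed
  \<comment> \<open>\<open>b'\<close> and \<open>d\<close> are the coordinates of
    \<open>(b, v)\<close> in the rotated frame, and \<open>c'\<close> is the scale of the
    independent sum \<open>d * y + c * h\<close>.\<close>
  define b' where "b' = b * of_real p + v * of_real q"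
  define d where "d = v * of_real p - b * of_real q"
  define c' where "c' = sqrt ((cmod d)\<^sup>2 + c\<^sup>2)"
  have bd: "(cmod b')\<^sup>2 + (cmod d)\<^sup>2 = (cmod b)\<^sup>2 + (cmod v)\<^sup>2"
  proof -
    have "(cmod b')\<^sup>2 + (cmod d)\<^sup>2 = (p\<^sup>2 + q\<^sup>2) * ((cmod b)\<^sup>2 + (cmod v)\<^sup>2)"
      unfolding b'_def d_def cmod_power2 by (simp add: power2_eq_square algebra_simps)
    then show ?thesis using pq by simp
  qed
  show ?case
  proof (rule exI[of _ a'], rule exI[of _ b'], rule exI[of _ c'], intro conjI allI impI)
    show "a' \<ge> 0" "c' \<ge> 0" by (simp_all add: a'_def c'_def)
    show "a'\<^sup>2 = (\<Sum>j<Suc n. (cmod (u j))\<^sup>2)" by (simp add: a'2 a s_def)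
    have "of_real a' * b' = of_real a * b + of_real s * v"
      using ap by (simp add: b'_def algebra_simps)
    also have "of_real s * v = cnj (u n) * w n"
      using k by (simp add: v_def)
    finally show "of_real a' * b' = dotc (Suc n) u w" by (simp add: ab dotc_def)
    show "(cmod b')\<^sup>2 + c'\<^sup>2 = (\<Sum>j<Suc n. (cmod (w j))\<^sup>2)"
      using bd bc nv by (simp add: c'_def)
    fix f :: "complex \<times> complex \<Rightarrow> ennreal"
    assume fm [measurable]: "f \<in> borel_measurable (borel \<Otimes>\<^sub>M borel)"
    have "(\<integral>\<^sup>+x. f (dotc (Suc n) x u, dotc (Suc n) x w) \<partial>gvec (Suc n)) =
      (\<integral>\<^sup>+y. \<integral>\<^sup>+x. f (dotc (Suc n) (x(n := y)) u, dotc (Suc n) (x(n := y)) w) \<partial>gvec n \<partial>?G)"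
      unfolding lessThan_Suc
      by (rule cgp.product_nn_integral_insert_rev) (auto simp flip: lessThan_Suc)
    also have "\<dots> = (\<integral>\<^sup>+y. \<integral>\<^sup>+x. f (dotc n x u + cnj y * u n, dotc n x w + cnj y * w n) \<partial>gvec n \<partial>?G)"
      by (intro nn_integral_cong) (simp add: dotc_def)
    also have "\<dots> = (\<integral>\<^sup>+y. \<integral>\<^sup>+x. f (dotc n x u + y * u n, dotc n x w + y * w n) \<partial>gvec n \<partial>?G)"
      by (rule nn_integral_cg_cnj[where f="\<lambda>y. \<integral>\<^sup>+x. f (dotc n x u + y * u n, dotc n x w + y * w n) \<partial>gvec n"])
         measurable
    also have "\<dots> = (\<integral>\<^sup>+y. (\<lambda>y. \<integral>\<^sup>+x. f (dotc n x u + of_real s * y, dotc n x w + v * y) \<partial>gvec n) (k * y) \<partial>?G)"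
      by (simp add: k(2) wv ac_simps)
    also have "\<dots> = (\<integral>\<^sup>+y. \<integral>\<^sup>+x. f (dotc n x u + of_real s * y, dotc n x w + v * y) \<partial>gvec n \<partial>?G)"
      by (rule nn_integral_cg_phase[OF _ k(1), where f="\<lambda>y. \<integral>\<^sup>+x. f (dotc n x u + of_real s * y, dotc n x w + v * y) \<partial>gvec n"])
         measurable
    also have "\<dots> = (\<integral>\<^sup>+y. \<integral>\<^sup>+g. \<integral>\<^sup>+h. f (of_real a * g + of_real s * y, b * g + of_real c * h + v * y) \<partial>?G \<partial>?G \<partial>?G)"
      by (intro nn_integral_cong)
         (rule law[where f="\<lambda>(p, q). f (p + of_real s * _, q + v * _)", simplified], measurable)
    also have "\<dots> = (\<integral>\<^sup>+g. \<integral>\<^sup>+y. (\<lambda>(g, y). \<integral>\<^sup>+h. f (of_real a * g + of_real s * y, b * g + of_real c * h + v * y) \<partial>?G) (g, y) \<partial>?G \<partial>?G)"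
      by (subst cg2.Fubini') auto
    also have "\<dots> = (\<integral>\<^sup>+g. \<integral>\<^sup>+y. (\<lambda>(g, y). \<integral>\<^sup>+h. f (of_real a * g + of_real s * y, b * g + of_real c * h + v * y) \<partial>?G)
        (of_real p * g - of_real q * y, of_real q * g + of_real p * y) \<partial>?G \<partial>?G)"
      by (rule nn_integral_cg_Givens[OF _ pq, symmetric]) measurable
    also have "\<dots> = (\<integral>\<^sup>+g. \<integral>\<^sup>+y. \<integral>\<^sup>+h. f (of_real a' * g, b' * g + (d * y + of_real c * h)) \<partial>?G \<partial>?G \<partial>?G)"
    proof -
      have "of_real a * (of_real p * g - of_real q * y) + of_real s * (of_real q * g + of_real p * y) = of_real a' * g" for g y :: complex
      proof -
        have "a * q = s * p" using ap by simp
        then have "complex_of_real a * of_real q = of_real s * of_real p"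
          by (simp flip: of_real_mult)
        then have "of_real a * (of_real p * g - of_real q * y) + of_real s * (of_real q * g + of_real p * y) = of_real (a * p + s * q) * g"
          by (simp add: algebra_simps)
        then show ?thesis by (simp add: apq)
      qed
      moreover have "b * (of_real p * g - of_real q * y) + of_real c * h + v * (of_real q * g + of_real p * y)
         = b' * g + (d * y + of_real c * h)" for g y h
        by (simp add: b'_def d_def algebra_simps)
      ultimately show ?thesis by (simp only: prod.case)
    qed
    also have "\<dots> = (\<integral>\<^sup>+g. \<integral>\<^sup>+h. f (of_real a' * g, b' * g + of_real c' * h) \<partial>?G \<partial>?G)"
    proof (rule nn_integral_cong)
      fix g
      show "(\<integral>\<^sup>+y. \<integral>\<^sup>+h. f (of_real a' * g, b' * g + (d * y + of_real c * h)) \<partial>?G \<partial>?G)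
        = (\<integral>\<^sup>+h. f (of_real a' * g, b' * g + of_real c' * h) \<partial>?G)"
        by (rule nn_integral_cg_combine[where f="\<lambda>z. f (of_real a' * g, b' * g + z)"])
           (auto simp: c'_def)
    qed
    finally show "(\<integral>\<^sup>+x. f (dotc (Suc n) x u, dotc (Suc n) x w) \<partial>gvec (Suc n)) =
       (\<integral>\<^sup>+g. \<integral>\<^sup>+h. f (of_real a' * g, b' * g + of_real c' * h) \<partial>?G \<partial>?G)" .
  qed
qed

section \<open>Concentration of sums over the rows\<close>

lemma prob_space_gvec: "prob_space (gvec n)"
  by (rule prob_space_PiM) (rule prob_space_std_complex_gaussian)

lemma prob_space_sensing_space: "prob_space (sensing_space m n)"
  unfolding sensing_space_def by (rule prob_space_PiM) (rule prob_space_std_complex_gaussian)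

text \<open>The factor \<open>exp (t * x^2)\<close> only changes the variance of the density from
  \<open>1/2\<close> to \<open>1 / (2 * (1 - t))\<close>; the integral is the quotient of the two
  normalising constants.\<close>

lemma nn_integral_gauss_exp_square:
  assumes t: "t < 1"
  shows "(\<integral>\<^sup>+x. ennreal (exp (t * x\<^sup>2)) \<partial>gauss) = ennreal (1 / sqrt (1 - t))"
proof -
  let ?s = "sqrt (1 / (2 * (1 - t)))"
  have s: "?s > 0" "?s\<^sup>2 = 1 / (2 * (1 - t))" using t by auto
  have eq: "normal_density 0 (sqrt (1 / 2)) x * exp (t * x\<^sup>2) = 1 / sqrt (1 - t) * normal_density 0 ?s x" for x
  proof -
    have "normal_density 0 (sqrt (1 / 2)) x * exp (t * x\<^sup>2) = 1 / sqrt pi * exp (- x\<^sup>2 + t * x\<^sup>2)"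
      by (simp add: normal_density_def exp_add[symmetric])
    moreover have "normal_density 0 ?s x = sqrt (1 - t) / sqrt pi * exp (- x\<^sup>2 + t * x\<^sup>2)"
    proof -
      have "- (x\<^sup>2 / (2 * ?s\<^sup>2)) = - x\<^sup>2 + t * x\<^sup>2" using t unfolding s(2) by (simp add: field_simps)
      moreover have "1 / sqrt (2 * pi * ?s\<^sup>2) = sqrt (1 - t) / sqrt pi"
      proof -
        have "1 / (2 * pi * ?s\<^sup>2) = (1 - t) / pi" using t unfolding s(2) by (simp add: field_simps)
        then show ?thesis by (metis real_sqrt_divide real_sqrt_one)
      qed
      ultimately show ?thesis unfolding normal_density_def by simp
    qed
    ultimately show ?thesis using t by simp
  qed
  have one: "(\<integral>\<^sup>+x. ennreal (normal_density 0 ?s x) \<partial>lborel) = 1"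
  proof -
    have "emeasure (density lborel (normal_density 0 ?s)) UNIV = 1"
      using prob_space.emeasure_space_1[OF prob_space_normal_density[OF s(1), of 0]] by simp
    then show ?thesis by (subst (asm) emeasure_density) auto
  qed
  have "(\<integral>\<^sup>+x. ennreal (exp (t * x\<^sup>2)) \<partial>gauss) = (\<integral>\<^sup>+x. ennreal (1 / sqrt (1 - t)) * ennreal (normal_density 0 ?s x) \<partial>lborel)"
    using t by (subst nn_integral_gauss) (auto simp: ennreal_mult[symmetric] eq)
  also have "\<dots> = ennreal (1 / sqrt (1 - t)) * (\<integral>\<^sup>+x. ennreal (normal_density 0 ?s x) \<partial>lborel)"
    by (rule nn_integral_cmult) simp
  also have "\<dots> = ennreal (1 / sqrt (1 - t))" by (simp only: one mult_1_right)
  finally show ?thesis .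
qed

lemma nn_integral_cg_exp_norm_square:
  assumes t: "t < 1"
  shows "(\<integral>\<^sup>+z. ennreal (exp (t * (cmod z)\<^sup>2)) \<partial>cgauss) = ennreal (1 / (1 - t))"
proof -
  have "(\<integral>\<^sup>+z. ennreal (exp (t * (cmod z)\<^sup>2)) \<partial>cgauss) =
    (\<integral>\<^sup>+x. \<integral>\<^sup>+y. ennreal (exp (t * x\<^sup>2)) * ennreal (exp (t * y\<^sup>2)) \<partial>gauss \<partial>gauss)"
    by (subst nn_integral_std_complex_gaussian)
       (auto simp: cmod_power2 ennreal_mult[symmetric] exp_add[symmetric] distrib_left)
  also have "\<dots> = ennreal (1 / sqrt (1 - t)) * ennreal (1 / sqrt (1 - t))"
    by (simp add: nn_integral_cmult nn_integral_multc nn_integral_gauss_exp_square[OF t])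
  also have "\<dots> = ennreal (1 / (1 - t))"
    using t by (simp add: ennreal_mult[symmetric])
  finally show ?thesis .
qed

section \<open>Independence of the rows and Chernoff's bound\<close>

lemma measurable_row [measurable]:
  assumes "i < m"
  shows "(\<lambda>\<omega>. \<lambda>j\<in>{..<n}. \<omega> (i, j)) \<in> measurable (sensing_space m n) (gvec n)"
  unfolding sensing_space_def
  by (rule measurable_restrict, rule measurable_component_singleton) (use assms in auto)

text \<open>Rows are split off one at a time by Fubini's theorem; the block of coordinates of the
  last row is a relabelled copy of \<open>gvec n\<close>.\<close>

lemma nn_integral_rows:
  assumes h [measurable]: "h \<in> borel_measurable (gvec n)"
  shows "(\<integral>\<^sup>+\<omega>. (\<Prod>i<m. h (\<lambda>j\<in>{..<n}. \<omega> (i, j))) \<partial>sensing_space m n) = (\<integral>\<^sup>+x. h x \<partial>gvec n) ^ m"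
proof (induction m)
  case 0
  interpret prob_space "sensing_space 0 n" by (rule prob_space_sensing_space)
  show ?case by (simp add: emeasure_space_1)
next
  case (Suc m)
  let ?I = "{..<m} \<times> {..<n}" and ?J = "{m} \<times> {..<n}" and ?G = "\<lambda>_ :: nat \<times> nat. cgauss"
  let ?row = "\<lambda>i \<omega>. \<lambda>j\<in>{..<n}. \<omega> (i, j :: nat) :: complex"
  have un: "{..<Suc m} \<times> {..<n} = ?I \<union> ?J" by (auto simp: less_Suc_eq)
  have rm: "?row m \<in> measurable (PiM ?J ?G) (gvec n)"
    by (rule measurable_restrict, rule measurable_component_singleton) auto
  have hm: "(\<lambda>\<omega>. h (?row m \<omega>)) \<in> borel_measurable (PiM ?J ?G)"
    using measurable_compose[OF rm h] .
  have one: "(\<integral>\<^sup>+\<omega>. h (?row m \<omega>) \<partial>PiM ?J ?G) = (\<integral>\<^sup>+x. h x \<partial>gvec n)"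
  proof -
    have "distr (PiM ?J ?G) (gvec n) (?row m) = gvec n"
      using distr_PiM_reindex[of ?J ?G "\<lambda>j. (m, j)" "{..<n}"] prob_space_std_complex_gaussian
      by (auto simp: inj_on_def)
    then have "(\<integral>\<^sup>+x. h x \<partial>gvec n) = (\<integral>\<^sup>+x. h x \<partial>distr (PiM ?J ?G) (gvec n) (?row m))" by simp
    also have "\<dots> = (\<integral>\<^sup>+\<omega>. h (?row m \<omega>) \<partial>PiM ?J ?G)"
      by (rule nn_integral_distr[OF rm]) simp
    finally show ?thesis ..
  qed
  have pm: "(\<lambda>\<omega>. \<Prod>i<m. h (?row i \<omega>)) \<in> borel_measurable (sensing_space m n)"
    by (rule borel_measurable_prod_ennreal) (rule measurable_compose[OF measurable_row h], simp)
  have "(\<integral>\<^sup>+\<omega>. (\<Prod>i<Suc m. h (?row i \<omega>)) \<partial>sensing_space (Suc m) n) =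
    (\<integral>\<^sup>+x. \<integral>\<^sup>+y. (\<Prod>i<Suc m. h (?row i (merge ?I ?J (x, y)))) \<partial>PiM ?J ?G \<partial>PiM ?I ?G)"
    unfolding sensing_space_def un
  proof (rule cgp.product_nn_integral_fold)
    show "(\<lambda>\<omega>. \<Prod>i<Suc m. h (?row i \<omega>)) \<in> borel_measurable (PiM (?I \<union> ?J) ?G)"
      unfolding un[symmetric] sensing_space_def[symmetric]
      by (rule borel_measurable_prod_ennreal) (rule measurable_compose[OF measurable_row h], simp)
  qed auto
  also have "\<dots> = (\<integral>\<^sup>+x. \<integral>\<^sup>+y. (\<Prod>i<m. h (?row i x)) * h (?row m y) \<partial>PiM ?J ?G \<partial>PiM ?I ?G)"
  proof (intro nn_integral_cong)
    fix x y
    have "?row i (merge ?I ?J (x, y)) = ?row i x" if "i < m" for i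
      using that by (auto simp: merge_def fun_eq_iff)
    moreover have "?row m (merge ?I ?J (x, y)) = ?row m y"
      by (auto simp: merge_def fun_eq_iff)
    ultimately show "(\<Prod>i<Suc m. h (?row i (merge ?I ?J (x, y)))) = (\<Prod>i<m. h (?row i x)) * h (?row m y)"
      by simp
  qed
  also have "\<dots> = (\<integral>\<^sup>+x. (\<Prod>i<m. h (?row i x)) * (\<integral>\<^sup>+x. h x \<partial>gvec n) \<partial>PiM ?I ?G)"
    by (intro nn_integral_cong) (subst nn_integral_cmult[OF hm], simp add: one)
  also have "\<dots> = (\<integral>\<^sup>+x. (\<Prod>i<m. h (?row i x)) \<partial>PiM ?I ?G) * (\<integral>\<^sup>+x. h x \<partial>gvec n)"
    by (rule nn_integral_multc) (use pm in \<open>simp only: sensing_space_def\<close>)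
  also have "\<dots> = (\<integral>\<^sup>+x. h x \<partial>gvec n) ^ Suc m"
    using Suc.IH unfolding sensing_space_def by (simp only: power_Suc mult.commute)
  finally show ?case .
qed

text \<open>Markov's inequality for the exponential of the sum, whose expectation factors over the
  rows. The exponential parameter and the threshold are meant to be built into
  \<open>\<phi>\<close>, so the event compares with 0.\<close>

lemma Chernoff_rows:
  assumes [measurable]: "\<phi> \<in> borel_measurable (gvec n)" and q: "q \<ge> 0"
    "(\<integral>\<^sup>+x. ennreal (exp (\<phi> x)) \<partial>gvec n) \<le> ennreal q"
  shows "measure (sensing_space m n) {\<omega> \<in> space (sensing_space m n). 0 \<le> (\<Sum>i<m. \<phi> (\<lambda>j\<in>{..<n}. \<omega> (i, j)))} \<le> q ^ m"
proof -
  interpret prob_space "sensing_space m n" by (rule prob_space_sensing_space)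
  let ?row = "\<lambda>i \<omega>. \<lambda>j\<in>{..<n}. \<omega> (i, j :: nat) :: complex"
  let ?S = "sensing_space m n"
  let ?u = "\<lambda>\<omega>. \<Prod>i<m. ennreal (exp (\<phi> (?row i \<omega>)))"
  have hm: "(\<lambda>x. ennreal (exp (\<phi> x))) \<in> borel_measurable (gvec n)" by measurable
  have um: "?u \<in> borel_measurable ?S"
    by (rule borel_measurable_prod_ennreal) (rule measurable_compose[OF measurable_row hm], simp)
  have eq: "?u \<omega> = ennreal (exp (\<Sum>i<m. \<phi> (?row i \<omega>)))" for \<omega>
    by (simp add: exp_sum prod_ennreal)
  have "emeasure ?S {\<omega> \<in> space ?S. 0 \<le> (\<Sum>i<m. \<phi> (?row i \<omega>))} = emeasure ?S ({\<omega> \<in> space ?S. 1 \<le> 1 * ?u \<omega>})"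
    unfolding eq by (simp add: ennreal_ge_1)
  also have "\<dots> \<le> 1 * (\<integral>\<^sup>+\<omega>. ?u \<omega> * indicator (space ?S) \<omega> \<partial>?S)"
    by (rule nn_integral_Markov_inequality) (use um in auto)
  also have "\<dots> = (\<integral>\<^sup>+\<omega>. ?u \<omega> \<partial>?S)" 
    by simp
  also have "\<dots> = (\<integral>\<^sup>+x. ennreal (exp (\<phi> x)) \<partial>gvec n) ^ m"
    by (rule nn_integral_rows[OF hm])
  also have "\<dots> \<le> ennreal q ^ m" by (rule power_mono) (use q in auto)
  also have "\<dots> = ennreal (q ^ m)" using q by (simp add: ennreal_power)
  finally show ?thesis using q by (simp add: emeasure_eq_measure)
qed

text \<open>The linear term of the Taylor expansion is kept exactly, because after integration it
  produces the mean; only the remainder is estimated.\<close>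

lemma exp_quadratic_bound: "exp y \<le> 1 + y + y\<^sup>2 * exp \<bar>y\<bar>" for y :: real
proof -
  obtain t where t: "\<bar>t\<bar> \<le> \<bar>y\<bar>" "exp y = (\<Sum>m<2. y ^ m / fact m) + exp t / fact 2 * y ^ 2"
    using Maclaurin_exp_le[of y 2] by blast
  have "exp y = 1 + y + exp t / 2 * y\<^sup>2" using t(2) by (simp add: numeral_2_eq_2)
  also have "exp t / 2 * y\<^sup>2 \<le> exp \<bar>y\<bar> * y\<^sup>2"
  proof (rule mult_right_mono)
    have "exp t \<le> exp \<bar>y\<bar>" using t(1) by simp
    then show "exp t / 2 \<le> exp \<bar>y\<bar>" by (smt (verit) exp_gt_zero field_sum_of_halves)
  qed simp
  finally show ?thesis by (simp add: mult.commute)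
qed

text \<open>For \<open>w\<close> of norm 1 the functional is a standard complex Gaussian and the
  integral equals \<open>1 / (1 - 1/2)\<close>; a shorter \<open>w\<close> only decreases
  it.\<close>

lemma nn_integral_exp_dotc_le:
  assumes "(\<Sum>j<n. (cmod (w j))\<^sup>2) \<le> 1"
  shows "(\<integral>\<^sup>+x. ennreal (exp ((cmod (dotc n x w))\<^sup>2 / 2)) \<partial>gvec n) \<le> 2"
proof -
  obtain a b c where a: "a \<ge> 0" "a\<^sup>2 = (\<Sum>j<n. (cmod (w j))\<^sup>2)" and law:
    "\<And>f :: complex \<times> complex \<Rightarrow> ennreal. f \<in> borel_measurable (borel \<Otimes>\<^sub>M borel) \<Longrightarrow>
        (\<integral>\<^sup>+x. f (dotc n x w, dotc n x w) \<partial>gvec n) =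
        (\<integral>\<^sup>+g. \<integral>\<^sup>+h. f (of_real a * g, b * g + of_real c * h) \<partial>cgauss \<partial>cgauss)"
    using joint_law_ex[of w n w] by blast
  have a1: "a\<^sup>2 \<le> 1" using a assms by simp
  have "(\<integral>\<^sup>+x. ennreal (exp ((cmod (dotc n x w))\<^sup>2 / 2)) \<partial>gvec n) =
     (\<integral>\<^sup>+g. ennreal (exp ((cmod (of_real a * g))\<^sup>2 / 2)) \<partial>cgauss)"
    using law[of "\<lambda>p. ennreal (exp ((cmod (fst p))\<^sup>2 / 2))"] by simp
  also have "\<dots> \<le> (\<integral>\<^sup>+g. ennreal (exp (1 / 2 * (cmod g)\<^sup>2)) \<partial>cgauss)"
    using a1 by (intro nn_integral_mono) (simp add: norm_mult power_mult_distrib mult_left_le_one_le)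
  also have "\<dots> = 2" by (subst nn_integral_cg_exp_norm_square) auto
  finally show ?thesis .
qed

text \<open>Quadratic growth in Gaussian variables makes \<open>X\<close> sub-exponential. One
  majorant \<open>D\<close> dominates \<open>X^2 * exp (t * abs X)\<close> for all admissible
  \<open>t\<close>: the case \<open>t = 0\<close> yields integrability, the case
  \<open>t = s\<close> the remainder of the exponential. Its mean is at most
  \<open>512 * K^2\<close>, whatever the dimension.\<close>

lemma growth_mgf_bound:
  fixes f :: "complex \<times> complex \<Rightarrow> real"
  assumes K: "K > 0" and f [measurable]: "f \<in> borel_measurable (borel \<Otimes>\<^sub>M borel)"
    and growth: "\<And>a b. \<bar>f (a, b)\<bar> \<le> K * (1 + (cmod a)\<^sup>2 + (cmod b)\<^sup>2)"
    and u: "(\<Sum>j<n. (cmod (u j))\<^sup>2) = 1" and w: "(\<Sum>j<n. (cmod (w j))\<^sup>2) \<le> 1"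
  defines "X \<equiv> \<lambda>x. f (dotc n x u, dotc n x w)"
  assumes s: "0 \<le> s" "s \<le> 1 / (8 * K)"
  shows "integrable (gvec n) X" 
    and "(\<integral>\<^sup>+x. ennreal (exp (s * X x)) \<partial>gvec n) \<le> ennreal (1 + s * (\<integral>x. X x \<partial>gvec n) + s\<^sup>2 * (512 * K\<^sup>2))"
proof -
  interpret gv: prob_space "gvec n" by (rule prob_space_gvec)
  let ?e = "\<lambda>v x. exp ((cmod (dotc n x v))\<^sup>2 / 2) :: real"
  define D where "D = (\<lambda>x. 128 * K\<^sup>2 * (?e u x + ?e w x))"
  have [measurable]: "X \<in> borel_measurable (gvec n)" unfolding X_def by measurable
  have [measurable]: "D \<in> borel_measurable (gvec n)" unfolding D_def by measurable
  have D0: "D x \<ge> 0" for x by (simp add: D_def)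
  have XD: "(X x)\<^sup>2 * exp (t * \<bar>X x\<bar>) \<le> D x" if t: "0 \<le> t" "t \<le> 1 / (8 * K)" for t x
  proof -
    define R where "R = 1 + (cmod (dotc n x u))\<^sup>2 + (cmod (dotc n x w))\<^sup>2"
    have R: "R \<ge> 0" by (simp add: R_def)
    have XR: "\<bar>X x\<bar> \<le> K * R" using growth[of "dotc n x u" "dotc n x w"] by (simp add: X_def R_def)
    \<comment> \<open>From \<open>y^2 / 2 \<le> exp y\<close> at \<open>y = R / 8\<close>. The
      factor \<open>exp (t * abs X)\<close> costs a second \<open>R / 8\<close>, and the total
      \<open>R / 4\<close> is what the inequality between the geometric and arithmetic means allows
      for the two exponentials in \<open>D\<close>.\<close>
    have R2: "R\<^sup>2 \<le> 128 * exp (R / 8)"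
    proof -
      have "1 + R/8 + (R/8)\<^sup>2/2 \<le> exp (R/8)" by (rule exp_lower_Taylor_quadratic) (use R in simp)
      then have "(R/8)\<^sup>2/2 \<le> exp (R/8)" using R by simp
      then show ?thesis by (simp add: power_divide)
    qed
    have "(X x)\<^sup>2 \<le> (K * R)\<^sup>2" using XR by (metis abs_le_square_iff abs_of_nonneg K R mult_nonneg_nonneg less_imp_le)
    then have 1: "(X x)\<^sup>2 \<le> K\<^sup>2 * (128 * exp (R / 8))"
      using R2 by (smt (verit) mult_left_mono power_mult_distrib zero_le_power2)
    have "t * \<bar>X x\<bar> \<le> 1 / (8 * K) * (K * R)" by (rule mult_mono) (use t XR K R in auto)
    then have 2: "exp (t * \<bar>X x\<bar>) \<le> exp (R / 8)" using K by simp
    have le: "exp (R / 4) \<le> ?e u x + ?e w x"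
    proof -
      define p where "p = exp ((cmod (dotc n x u))\<^sup>2 / 4)"
      define q where "q = exp ((cmod (dotc n x w))\<^sup>2 / 4)"
      have p2: "p\<^sup>2 = ?e u x" "q\<^sup>2 = ?e w x" by (simp_all add: p_def q_def power2_eq_square exp_add[symmetric])
      have e: "exp (1/4::real) \<le> 2" using exp_bound_half[of "1/4::real"] by simp
      have "exp (R / 4) = exp (1/4) * (p * q)"
        by (simp add: R_def p_def q_def add_divide_distrib exp_add)
      also have "\<dots> \<le> 2 * (p * q)" by (rule mult_right_mono[OF e]) (simp add: p_def q_def)
      also have "\<dots> \<le> p\<^sup>2 + q\<^sup>2" using sum_squares_bound[of p q] by (simp add: mult.assoc)
      finally show ?thesis by (simp add: p2)
    qed
    have "(X x)\<^sup>2 * exp (t * \<bar>X x\<bar>) \<le> K\<^sup>2 * (128 * exp (R / 8)) * exp (R / 8)"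
      by (rule mult_mono[OF 1 2]) auto
    also have "\<dots> = 128 * K\<^sup>2 * exp (R / 4)" by (simp add: exp_add[symmetric])
    also have "\<dots> \<le> 128 * K\<^sup>2 * (?e u x + ?e w x)" by (rule mult_left_mono[OF le]) simp
    finally show ?thesis by (simp add: D_def)
  qed
  have eu: "(\<integral>\<^sup>+x. ennreal (?e u x) \<partial>gvec n) \<le> 2" by (rule nn_integral_exp_dotc_le) (simp add: u)
  have ew: "(\<integral>\<^sup>+x. ennreal (?e w x) \<partial>gvec n) \<le> 2" by (rule nn_integral_exp_dotc_le[OF w])
  have nD: "(\<integral>\<^sup>+x. ennreal (D x) \<partial>gvec n) \<le> ennreal (512 * K\<^sup>2)"
  proof -
    have "(\<integral>\<^sup>+x. ennreal (D x) \<partial>gvec n) = (\<integral>\<^sup>+x. ennreal (128 * K\<^sup>2) * (ennreal (?e u x) + ennreal (?e w x)) \<partial>gvec n)"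
      unfolding D_def
      by (intro nn_integral_cong, subst ennreal_plus[symmetric], simp, simp, subst ennreal_mult[symmetric]) auto
    also have "\<dots> = ennreal (128 * K\<^sup>2) * ((\<integral>\<^sup>+x. ennreal (?e u x) \<partial>gvec n) + (\<integral>\<^sup>+x. ennreal (?e w x) \<partial>gvec n))"
      by (subst nn_integral_cmult) (simp, simp add: nn_integral_add)
    also have "\<dots> \<le> ennreal (128 * K\<^sup>2) * (2 + 2)" by (intro mult_left_mono add_mono eu ew) simp
    also have "\<dots> = ennreal (128 * K\<^sup>2) * ennreal 4" by simp
    also have "\<dots> = ennreal (512 * K\<^sup>2)" by (subst ennreal_mult[symmetric]) auto
    finally show ?thesis .
  qed
  have iD: "integrable (gvec n) D"
    by (rule integrableI_nonneg) (use D0 nD le_less_trans[OF nD ennreal_less_top] in auto)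
  have ID: "(\<integral>x. D x \<partial>gvec n) \<le> 512 * K\<^sup>2"
    using nD D0 by (subst (asm) nn_integral_eq_integral[OF iD]) auto
  show iX: "integrable (gvec n) X"
  proof (rule Bochner_Integration.integrable_bound[of _ "\<lambda>x. 1 + D x"])
    show "AE x in gvec n. norm (X x) \<le> norm (1 + D x)"
    proof (rule AE_I2)
      fix x
      have "\<bar>X x\<bar> \<le> 1 + (X x)\<^sup>2"
        using sum_squares_bound[of 1 "\<bar>X x\<bar>"] unfolding power2_abs one_power2 by linarith
      then show "norm (X x) \<le> norm (1 + D x)" using XD[of 0 x] K D0[of x] by simp
    qed
  qed (use iD in auto)
  have le: "exp (s * X x) \<le> 1 + s * X x + s\<^sup>2 * D x" for x
  proof -
    have "exp (s * X x) \<le> 1 + s * X x + (s * X x)\<^sup>2 * exp \<bar>s * X x\<bar>" by (rule exp_quadratic_bound)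
    also have "(s * X x)\<^sup>2 * exp \<bar>s * X x\<bar> = s\<^sup>2 * ((X x)\<^sup>2 * exp (s * \<bar>X x\<bar>))"
      using s by (simp add: power_mult_distrib abs_mult)
    also have "\<dots> \<le> s\<^sup>2 * D x" by (rule mult_left_mono[OF XD]) (use s in auto)
    finally show ?thesis by simp
  qed
  have int: "integrable (gvec n) (\<lambda>x. 1 + s * X x + s\<^sup>2 * D x)" using iX iD by auto
  have "(\<integral>\<^sup>+x. ennreal (exp (s * X x)) \<partial>gvec n) \<le> (\<integral>\<^sup>+x. ennreal (1 + s * X x + s\<^sup>2 * D x) \<partial>gvec n)"
    by (intro nn_integral_mono ennreal_leI le)
  also have "\<dots> = ennreal (\<integral>x. 1 + s * X x + s\<^sup>2 * D x \<partial>gvec n)"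
    by (rule nn_integral_eq_integral[OF int]) (use le in \<open>auto intro: order_trans[OF exp_ge_zero]\<close>)
  also have "(\<integral>x. 1 + s * X x + s\<^sup>2 * D x \<partial>gvec n) = 1 + s * (\<integral>x. X x \<partial>gvec n) + s\<^sup>2 * (\<integral>x. D x \<partial>gvec n)"
    using iX iD by (simp add: prob_space.prob_space[OF prob_space_gvec])
  also have "ennreal \<dots> \<le> ennreal (1 + s * (\<integral>x. X x \<partial>gvec n) + s\<^sup>2 * (512 * K\<^sup>2))"
    by (intro ennreal_leI add_left_mono mult_left_mono ID) auto
  finally show "(\<integral>\<^sup>+x. ennreal (exp (s * X x)) \<partial>gvec n) \<le> ennreal (1 + s * (\<integral>x. X x \<partial>gvec n) + s\<^sup>2 * (512 * K\<^sup>2))" .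
qed

abbreviation rdot :: "nat \<Rightarrow> (nat \<times> nat \<Rightarrow> complex) \<Rightarrow> nat \<Rightarrow> (nat \<Rightarrow> complex) \<Rightarrow> complex" where
  "rdot n \<omega> i \<equiv> dotc n (\<lambda>j. \<omega> (i, j))"

lemma dotc_restrict [simp]: "dotc n (restrict x {..<n}) v = dotc n x v"
  by (simp add: dotc_def)

text \<open>The rate \<open>c\<close> is chosen from \<open>K\<close> and \<open>\<eta>\<close>
  alone, before the dimensions, the vectors and the function; only so can a union bound over a net
  end with absolute constants.\<close>

lemma concentration:
  assumes K: "K > 0" and eta: "\<eta> > 0"
  obtains c where "c > 0" 
    "\<And>n m u w f \<mu>. \<lbrakk>f \<in> borel_measurable (borel \<Otimes>\<^sub>M borel);
       \<And>a b. \<bar>f (a, b)\<bar> \<le> K * (1 + (cmod a)\<^sup>2 + (cmod b)\<^sup>2);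
       (\<Sum>j<n. (cmod (u j))\<^sup>2) = 1; (\<Sum>j<n. (cmod (w j))\<^sup>2) \<le> 1;
       (\<integral>x. f (dotc n x u, dotc n x w) \<partial>gvec n) \<le> \<mu>\<rbrakk> \<Longrightarrow>
       measure (sensing_space m n) {\<omega> \<in> space (sensing_space m n).
          real m * (\<mu> + \<eta>) \<le> (\<Sum>i<m. f (rdot n \<omega> i u, rdot n \<omega> i w))}
       \<le> exp (- c * real m)"
proof -
  \<comment> \<open>The second entry of the minimum makes the quadratic term
    \<open>s^2 * (512 * K^2)\<close> at most half of \<open>s * \<eta>\<close>; the other half
    remains as the decay rate.\<close>
  define s where "s = min (1 / (8 * K)) (\<eta> / (1024 * K\<^sup>2))"
  have s: "s > 0" "s \<le> 1 / (8 * K)" using K eta by (auto simp: s_def)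
  have s2: "s * (512 * K\<^sup>2) \<le> \<eta> / 2"
  proof -
    have "s * (512 * K\<^sup>2) \<le> \<eta> / (1024 * K\<^sup>2) * (512 * K\<^sup>2)"
      by (rule mult_right_mono) (auto simp: s_def)
    then show ?thesis using K by simp
  qed
  show ?thesis
  proof (rule that)
    show "s * \<eta> / 2 > 0" using s eta by simp
    fix n m :: nat and u w :: "nat \<Rightarrow> complex" and f :: "complex \<times> complex \<Rightarrow> real" and \<mu> :: real
    assume f [measurable]: "f \<in> borel_measurable (borel \<Otimes>\<^sub>M borel)"
      and growth: "\<And>a b. \<bar>f (a, b)\<bar> \<le> K * (1 + (cmod a)\<^sup>2 + (cmod b)\<^sup>2)"
      and u: "(\<Sum>j<n. (cmod (u j))\<^sup>2) = 1" and w: "(\<Sum>j<n. (cmod (w j))\<^sup>2) \<le> 1"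
      and mu: "(\<integral>x. f (dotc n x u, dotc n x w) \<partial>gvec n) \<le> \<mu>"
    let ?X = "\<lambda>x. f (dotc n x u, dotc n x w)"
    let ?\<phi> = "\<lambda>x. s * ?X x - s * (\<mu> + \<eta>)"
    let ?q = "exp (- (s * \<eta> / 2))"
    have mgf: "(\<integral>\<^sup>+x. ennreal (exp (s * ?X x)) \<partial>gvec n) \<le> ennreal (exp (s * \<mu> + s\<^sup>2 * (512 * K\<^sup>2)))"
    proof -
      have "1 + s * (\<integral>x. ?X x \<partial>gvec n) + s\<^sup>2 * (512 * K\<^sup>2) \<le> 1 + (s * \<mu> + s\<^sup>2 * (512 * K\<^sup>2))"
        using mu s by simp
      also have "\<dots> \<le> exp (s * \<mu> + s\<^sup>2 * (512 * K\<^sup>2))" by (rule exp_ge_add_one_self)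
      finally show ?thesis
        using growth_mgf_bound(2)[OF K f growth u w] s
        by (meson ennreal_leI less_imp_le order_trans)
    qed
    have "(\<integral>\<^sup>+x. ennreal (exp (?\<phi> x)) \<partial>gvec n) = (\<integral>\<^sup>+x. ennreal (exp (- s * (\<mu> + \<eta>))) * ennreal (exp (s * ?X x)) \<partial>gvec n)"
      by (intro nn_integral_cong) (simp add: ennreal_mult[symmetric] exp_add[symmetric])
    also have "\<dots> = ennreal (exp (- s * (\<mu> + \<eta>))) * (\<integral>\<^sup>+x. ennreal (exp (s * ?X x)) \<partial>gvec n)"
      by (rule nn_integral_cmult) measurable
    also have "\<dots> \<le> ennreal (exp (- s * (\<mu> + \<eta>))) * ennreal (exp (s * \<mu> + s\<^sup>2 * (512 * K\<^sup>2)))"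
      by (rule mult_left_mono[OF mgf]) simp
    also have "\<dots> = ennreal (exp (s * (s * (512 * K\<^sup>2) - \<eta>)))"
      by (simp add: ennreal_mult[symmetric] exp_add[symmetric] power2_eq_square algebra_simps)
    also have "\<dots> \<le> ennreal ?q"
    proof -
      have "s * (s * (512 * K\<^sup>2) - \<eta>) \<le> s * (\<eta> / 2 - \<eta>)"
        by (rule mult_left_mono) (use s s2 in auto)
      then show ?thesis by (simp add: ennreal_leI)
    qed
    finally have *: "(\<integral>\<^sup>+x. ennreal (exp (?\<phi> x)) \<partial>gvec n) \<le> ennreal ?q" .
    have "measure (sensing_space m n) {\<omega> \<in> space (sensing_space m n). 0 \<le> (\<Sum>i<m. ?\<phi> (\<lambda>j\<in>{..<n}. \<omega> (i, j)))} \<le> ?q ^ m"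
      by (rule Chernoff_rows[OF _ _ *]) auto
    moreover have "?q ^ m = exp (- (s * \<eta> / 2) * real m)"
      by (simp add: exp_of_nat_mult[symmetric] mult.commute)
    moreover have "0 \<le> (\<Sum>i<m. ?\<phi> (\<lambda>j\<in>{..<n}. \<omega> (i, j))) \<longleftrightarrow>
       real m * (\<mu> + \<eta>) \<le> (\<Sum>i<m. f (rdot n \<omega> i u, rdot n \<omega> i w))" for \<omega>
    proof -
      have "(\<Sum>i<m. ?\<phi> (\<lambda>j\<in>{..<n}. \<omega> (i, j))) = s * ((\<Sum>i<m. f (rdot n \<omega> i u, rdot n \<omega> i w)) - real m * (\<mu> + \<eta>))"
        by (simp add: sum_subtractf sum_distrib_left algebra_simps)
      then show ?thesis using s(1) by (simp add: zero_le_mult_iff)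
    qed
    ultimately show "measure (sensing_space m n) {\<omega> \<in> space (sensing_space m n).
          real m * (\<mu> + \<eta>) \<le> (\<Sum>i<m. f (rdot n \<omega> i u, rdot n \<omega> i w))}
       \<le> exp (- (s * \<eta> / 2) * real m)" by simp
  qed
qed

section \<open>Gaussian expectations\<close>

lemma joint_law_unit:
  assumes u: "(\<Sum>j<n. (cmod (u j))\<^sup>2) = 1"
  obtains c where "c \<ge> 0" "(cmod (dotc n u w))\<^sup>2 + c\<^sup>2 = (\<Sum>j<n. (cmod (w j))\<^sup>2)"
    "\<And>f :: complex \<times> complex \<Rightarrow> ennreal. f \<in> borel_measurable (borel \<Otimes>\<^sub>M borel) \<Longrightarrow>
        (\<integral>\<^sup>+x. f (dotc n x u, dotc n x w) \<partial>gvec n) =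
        (\<integral>\<^sup>+g. \<integral>\<^sup>+h. f (g, dotc n u w * g + of_real c * h) \<partial>cgauss \<partial>cgauss)"
proof -
  obtain a b c where a: "a \<ge> 0" "a\<^sup>2 = (\<Sum>j<n. (cmod (u j))\<^sup>2)" and ab: "of_real a * b = dotc n u w"
    and c: "c \<ge> 0" and bc: "(cmod b)\<^sup>2 + c\<^sup>2 = (\<Sum>j<n. (cmod (w j))\<^sup>2)" and law:
    "\<And>f :: complex \<times> complex \<Rightarrow> ennreal. f \<in> borel_measurable (borel \<Otimes>\<^sub>M borel) \<Longrightarrow>
        (\<integral>\<^sup>+x. f (dotc n x u, dotc n x w) \<partial>gvec n) =
        (\<integral>\<^sup>+g. \<integral>\<^sup>+h. f (of_real a * g, b * g + of_real c * h) \<partial>cgauss \<partial>cgauss)"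
    using joint_law_ex[of u n w] by blast
  have "a = 1" using a u by (simp add: power2_eq_1_iff)
  then show ?thesis using that[of c] ab bc c law by simp
qed

lemma nn_integral_dotc_unit:
  assumes u: "(\<Sum>j<n. (cmod (u j))\<^sup>2) = 1" and [measurable]: "f \<in> borel_measurable borel"
  shows "(\<integral>\<^sup>+x. f (dotc n x u) \<partial>gvec n) = (\<integral>\<^sup>+g. f g \<partial>cgauss)"
proof -
  obtain c where law: "\<And>f :: complex \<times> complex \<Rightarrow> ennreal. f \<in> borel_measurable (borel \<Otimes>\<^sub>M borel) \<Longrightarrow>
        (\<integral>\<^sup>+x. f (dotc n x u, dotc n x u) \<partial>gvec n) =
        (\<integral>\<^sup>+g. \<integral>\<^sup>+h. f (g, dotc n u u * g + of_real c * h) \<partial>cgauss \<partial>cgauss)"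
    using joint_law_unit[OF u, of u] by blast
  have "(\<lambda>p :: complex \<times> complex. f (fst p)) \<in> borel_measurable (borel \<Otimes>\<^sub>M borel)" by measurable
  from law[OF this] show ?thesis by simp
qed

lemma nn_integral_gauss_even:
  "(\<integral>\<^sup>+x. ennreal (x ^ (2 * k)) \<partial>gauss) = ennreal (fact (2 * k) / (4 ^ k * fact k))"
proof -
  have "has_bochner_integral lborel (\<lambda>x. normal_density 0 (sqrt (1/2)) x * (x - 0) ^ (2 * k))
     (fact (2 * k) / ((2 / (sqrt (1/2))\<^sup>2) ^ k * fact k))"
    by (rule normal_moment_even) simp
  then have "has_bochner_integral lborel (\<lambda>x. normal_density 0 (sqrt (1/2)) x * x ^ (2 * k))
     (fact (2 * k) / (4 ^ k * fact k))"
    by (simp add: real_sqrt_divide power_divide)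
  then have "(\<integral>\<^sup>+x. ennreal (normal_density 0 (sqrt (1/2)) x * x ^ (2 * k)) \<partial>lborel) = ennreal (fact (2 * k) / (4 ^ k * fact k))"
    by (subst nn_integral_eq_integral) (auto simp: has_bochner_integral_iff)
  then show ?thesis by (subst nn_integral_gauss) (auto simp: ennreal_mult')
qed

lemma nn_integral_gauss_moments:
  "(\<integral>\<^sup>+x. ennreal (x\<^sup>2) \<partial>gauss) = ennreal (1/2)"
  "(\<integral>\<^sup>+x. ennreal (x ^ 4) \<partial>gauss) = ennreal (3/4)"
  "(\<integral>\<^sup>+x. ennreal (x ^ 6) \<partial>gauss) = ennreal (15/8)"
  using nn_integral_gauss_even[of 1] nn_integral_gauss_even[of 2] nn_integral_gauss_even[of 3]
  by (simp_all add: fact_numeral)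

lemma emeasure_gauss_UNIV [simp]: "emeasure gauss UNIV = 1"
  using gauss.emeasure_space_1 by simp

lemma nn_integral_cg_Re_Im_square:
  "(\<integral>\<^sup>+z. ennreal ((Im z)\<^sup>2) \<partial>cgauss) = ennreal (1/2)"
  "(\<integral>\<^sup>+z. ennreal ((Re z)\<^sup>2) \<partial>cgauss) = ennreal (1/2)"
  by (simp_all add: nn_integral_std_complex_gaussian nn_integral_gauss_moments)

lemma nn_integral_cg_moments:
  "(\<integral>\<^sup>+z. ennreal ((cmod z)\<^sup>2) \<partial>cgauss) = ennreal 1"
  "(\<integral>\<^sup>+z. ennreal ((cmod z) ^ 4) \<partial>cgauss) = ennreal 2"
  "(\<integral>\<^sup>+z. ennreal ((cmod z) ^ 6) \<partial>cgauss) = ennreal 6"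
proof -
  note m = nn_integral_gauss_moments
  have "(\<integral>\<^sup>+z. ennreal ((cmod z)\<^sup>2) \<partial>cgauss) =
     (\<integral>\<^sup>+z. ennreal ((Re z)\<^sup>2) + ennreal ((Im z)\<^sup>2) \<partial>cgauss)"
    by (intro nn_integral_cong) (simp add: cmod_power2)
  also have "\<dots> = ennreal (1/2) + ennreal (1/2)"
    by (subst nn_integral_add) (auto simp only: nn_integral_cg_Re_Im_square, measurable)
  also have "\<dots> = ennreal 1" by (subst ennreal_plus[symmetric]) auto
  finally show "(\<integral>\<^sup>+z. ennreal ((cmod z)\<^sup>2) \<partial>cgauss) = ennreal 1" .
  have "(\<integral>\<^sup>+z. ennreal ((cmod z) ^ 4) \<partial>cgauss) =
     (\<integral>\<^sup>+x. \<integral>\<^sup>+y. ennreal (x ^ 4) + ennreal (2 * x\<^sup>2) * ennreal (y\<^sup>2) + ennreal (y ^ 4) \<partial>gauss \<partial>gauss)"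
  proof (subst nn_integral_std_complex_gaussian, measurable, intro nn_integral_cong)
    fix x y :: real
    have "(cmod (Complex x y)) ^ 4 = ((cmod (Complex x y))\<^sup>2)\<^sup>2" by simp
    also have "\<dots> = x ^ 4 + 2 * x\<^sup>2 * y\<^sup>2 + y ^ 4"
    proof -
      have "(a + b)\<^sup>2 = a\<^sup>2 + 2 * a * b + b\<^sup>2" for a b :: real
        by (simp add: power2_eq_square algebra_simps)
      from this[of "x\<^sup>2" "y\<^sup>2"] show ?thesis unfolding cmod_power2 by (simp flip: power_mult)
    qed
    finally show "ennreal ((cmod (Complex x y)) ^ 4) = ennreal (x ^ 4) + ennreal (2 * x\<^sup>2) * ennreal (y\<^sup>2) + ennreal (y ^ 4)"
      by (simp add: ennreal_mult[symmetric] ennreal_plus[symmetric] del: ennreal_plus)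
  qed
  also have "\<dots> = (\<integral>\<^sup>+x. ennreal (x ^ 4) + ennreal (2 * x\<^sup>2) * ennreal (1/2) + ennreal (3/4) \<partial>gauss)"
    by (simp add: nn_integral_add nn_integral_cmult m)
  also have "\<dots> = (\<integral>\<^sup>+x. ennreal (x ^ 4) + ennreal (x\<^sup>2) + ennreal (3/4) \<partial>gauss)"
    by (intro nn_integral_cong) (subst ennreal_mult[symmetric]; simp)
  also have "\<dots> = ennreal (3/4) + ennreal (1/2) + ennreal (3/4)"
    by (simp add: nn_integral_add m)
  also have "\<dots> = ennreal 2" by (subst ennreal_plus[symmetric]; simp)+
  finally show "(\<integral>\<^sup>+z. ennreal ((cmod z) ^ 4) \<partial>cgauss) = ennreal 2" .
  have "(\<integral>\<^sup>+z. ennreal ((cmod z) ^ 6) \<partial>cgauss) =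
     (\<integral>\<^sup>+x. \<integral>\<^sup>+y. ennreal (x ^ 6) + ennreal (3 * x ^ 4) * ennreal (y\<^sup>2) + ennreal (3 * x\<^sup>2) * ennreal (y ^ 4) + ennreal (y ^ 6) \<partial>gauss \<partial>gauss)"
  proof (subst nn_integral_std_complex_gaussian, measurable, intro nn_integral_cong)
    fix x y :: real
    have "(cmod (Complex x y)) ^ 6 = ((cmod (Complex x y))\<^sup>2) ^ 3" by (simp flip: power_mult)
    also have "\<dots> = x ^ 6 + 3 * x ^ 4 * y\<^sup>2 + 3 * x\<^sup>2 * y ^ 4 + y ^ 6"
    proof -
      have "(a + b) ^ 3 = a ^ 3 + 3 * a\<^sup>2 * b + 3 * a * b\<^sup>2 + b ^ 3" for a b :: real
        by (simp add: power2_eq_square power3_eq_cube algebra_simps)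
      from this[of "x\<^sup>2" "y\<^sup>2"] show ?thesis unfolding cmod_power2 by (simp flip: power_mult)
    qed
    finally show "ennreal ((cmod (Complex x y)) ^ 6) = ennreal (x ^ 6) + ennreal (3 * x ^ 4) * ennreal (y\<^sup>2) + ennreal (3 * x\<^sup>2) * ennreal (y ^ 4) + ennreal (y ^ 6)"
      by (simp add: ennreal_mult[symmetric] ennreal_plus[symmetric] del: ennreal_plus)
  qed
  also have "\<dots> = (\<integral>\<^sup>+x. ennreal (x ^ 6) + ennreal (3 * x ^ 4) * ennreal (1/2) + ennreal (3 * x\<^sup>2) * ennreal (3/4) + ennreal (15/8) \<partial>gauss)"
    by (simp add: nn_integral_add nn_integral_cmult m)
  also have "\<dots> = (\<integral>\<^sup>+x. ennreal (x ^ 6) + ennreal (3/2) * ennreal (x ^ 4) + ennreal (9/4) * ennreal (x\<^sup>2) + ennreal (15/8) \<partial>gauss)"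
    by (intro nn_integral_cong) (subst ennreal_mult[symmetric]; simp)+
  also have "\<dots> = ennreal (15/8) + ennreal (3/2) * ennreal (3/4) + ennreal (9/4) * ennreal (1/2) + ennreal (15/8)"
    by (simp add: nn_integral_add nn_integral_cmult m)
  also have "\<dots> = ennreal 6"
    by ((subst ennreal_mult[symmetric], simp, simp)+, (subst ennreal_plus[symmetric], simp, simp)+, simp)
  finally show "(\<integral>\<^sup>+z. ennreal ((cmod z) ^ 6) \<partial>cgauss) = ennreal 6" .
qed

text \<open>Nonnegative extended integrals admit no subtraction, so a cross term that is odd in
  \<open>h\<close> cannot be integrated to zero on its own. Averaging the integrand over
  \<open>h\<close> and \<open>- h\<close>, which have the same law, removes it pointwise.\<close>

lemma nn_integral_cg_symmetrize:
  assumes [measurable]: "f \<in> borel_measurable borel" "F \<in> borel_measurable borel"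
    and eq: "\<And>h. f h + f (- h) = 2 * F h"
  shows "(\<integral>\<^sup>+h. f h \<partial>cgauss) = (\<integral>\<^sup>+h. F h \<partial>cgauss)"
proof -
  have "(\<integral>\<^sup>+h. f (- h) \<partial>cgauss) = (\<integral>\<^sup>+h. f h \<partial>cgauss)"
    using nn_integral_cg_phase[of f "-1"] by simp
  then have "2 * (\<integral>\<^sup>+h. f h \<partial>cgauss) = (\<integral>\<^sup>+h. f h \<partial>cgauss) + (\<integral>\<^sup>+h. f (- h) \<partial>cgauss)"
    by (simp add: mult_2)
  also have "\<dots> = (\<integral>\<^sup>+h. f h + f (- h) \<partial>cgauss)"
    by (rule nn_integral_add[symmetric]) measurable
  also have "\<dots> = 2 * (\<integral>\<^sup>+h. F h \<partial>cgauss)"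
    unfolding eq by (rule nn_integral_cmult) measurable
  finally show ?thesis by (simp add: ennreal_mult_cancel_left)
qed

text \<open>For fixed \<open>g\<close> the cross term of \<open>b * g\<close> and
  \<open>c * h\<close> is odd in \<open>h\<close> and drops out. The weight
  \<open>\<rho> = 1\<close> gives second moments, and the truncated squared modulus gives the form
  of the expected initialisation matrix.\<close>

lemma nn_integral_weighted_square:
  fixes \<rho> :: "complex \<Rightarrow> real"
  assumes u: "(\<Sum>j<n. (cmod (u j))\<^sup>2) = 1" and [measurable]: "\<rho> \<in> borel_measurable borel" and \<rho>: "\<And>z. \<rho> z \<ge> 0"
  shows "(\<integral>\<^sup>+x. ennreal (\<rho> (dotc n x u) * (cmod (dotc n x w))\<^sup>2) \<partial>gvec n) =
     ennreal ((cmod (dotc n u w))\<^sup>2) * (\<integral>\<^sup>+g. ennreal (\<rho> g * (cmod g)\<^sup>2) \<partial>cgauss) +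
     ennreal ((\<Sum>j<n. (cmod (w j))\<^sup>2) - (cmod (dotc n u w))\<^sup>2) * (\<integral>\<^sup>+g. ennreal (\<rho> g) \<partial>cgauss)"
proof -
  let ?G = cgauss
  define b where "b = dotc n u w"
  obtain c where c: "c \<ge> 0" "(cmod b)\<^sup>2 + c\<^sup>2 = (\<Sum>j<n. (cmod (w j))\<^sup>2)" and law:
    "\<And>f :: complex \<times> complex \<Rightarrow> ennreal. f \<in> borel_measurable (borel \<Otimes>\<^sub>M borel) \<Longrightarrow>
        (\<integral>\<^sup>+x. f (dotc n x u, dotc n x w) \<partial>gvec n) = (\<integral>\<^sup>+g. \<integral>\<^sup>+h. f (g, b * g + of_real c * h) \<partial>?G \<partial>?G)"
    using joint_law_unit[OF u, of w] unfolding b_def by blast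
  have "(\<integral>\<^sup>+x. ennreal (\<rho> (dotc n x u) * (cmod (dotc n x w))\<^sup>2) \<partial>gvec n) =
     (\<integral>\<^sup>+g. \<integral>\<^sup>+h. ennreal (\<rho> g * (cmod (b * g + of_real c * h))\<^sup>2) \<partial>?G \<partial>?G)"
    using law[of "\<lambda>p. ennreal (\<rho> (fst p) * (cmod (snd p))\<^sup>2)"] by simp
  also have "\<dots> = (\<integral>\<^sup>+g. \<integral>\<^sup>+h. ennreal ((cmod b)\<^sup>2) * ennreal (\<rho> g * (cmod g)\<^sup>2) + ennreal (c\<^sup>2 * \<rho> g) * ennreal ((cmod h)\<^sup>2) \<partial>?G \<partial>?G)"
  proof (rule nn_integral_cong, goal_cases)
    case (1 g)
    show ?case
    proof (rule nn_integral_cg_symmetrize)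
    fix h
    have "(cmod (b * g + of_real c * h))\<^sup>2 + (cmod (b * g - of_real c * h))\<^sup>2 = 2 * ((cmod (b * g))\<^sup>2 + (cmod (of_real c * h))\<^sup>2)"
      unfolding cmod_power2 by (simp add: power2_eq_square algebra_simps)
    also have "\<dots> = 2 * ((cmod b)\<^sup>2 * (cmod g)\<^sup>2 + c\<^sup>2 * (cmod h)\<^sup>2)"
      by (simp add: norm_mult power_mult_distrib)
    finally have "\<rho> g * (cmod (b * g + of_real c * h))\<^sup>2 + \<rho> g * (cmod (b * g + of_real c * - h))\<^sup>2 =
        2 * ((cmod b)\<^sup>2 * (\<rho> g * (cmod g)\<^sup>2) + c\<^sup>2 * \<rho> g * (cmod h)\<^sup>2)"
      using distrib_left[of "\<rho> g" "(cmod (b * g + of_real c * h))\<^sup>2" "(cmod (b * g - of_real c * h))\<^sup>2"]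
      by (simp add: algebra_simps)
    moreover have "ennreal (\<rho> g * (cmod (b * g + of_real c * h))\<^sup>2) + ennreal (\<rho> g * (cmod (b * g + of_real c * - h))\<^sup>2) 
       = ennreal (\<rho> g * (cmod (b * g + of_real c * h))\<^sup>2 + \<rho> g * (cmod (b * g + of_real c * - h))\<^sup>2)"
      using \<rho> by (intro ennreal_plus[symmetric]) auto
    moreover have "2 * (ennreal ((cmod b)\<^sup>2) * ennreal (\<rho> g * (cmod g)\<^sup>2) + ennreal (c\<^sup>2 * \<rho> g) * ennreal ((cmod h)\<^sup>2)) =
       ennreal (2 * ((cmod b)\<^sup>2 * (\<rho> g * (cmod g)\<^sup>2) + c\<^sup>2 * \<rho> g * (cmod h)\<^sup>2))"
    proof -
      have "ennreal ((cmod b)\<^sup>2) * ennreal (\<rho> g * (cmod g)\<^sup>2) + ennreal (c\<^sup>2 * \<rho> g) * ennreal ((cmod h)\<^sup>2)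
        = ennreal ((cmod b)\<^sup>2 * (\<rho> g * (cmod g)\<^sup>2) + c\<^sup>2 * \<rho> g * (cmod h)\<^sup>2)"
        using \<rho> by (subst ennreal_plus) (auto simp: ennreal_mult[symmetric])
      then show ?thesis using \<rho> by (subst ennreal_mult) auto
    qed
    ultimately show "ennreal (\<rho> g * (cmod (b * g + of_real c * h))\<^sup>2) + ennreal (\<rho> g * (cmod (b * g + of_real c * - h))\<^sup>2) =
      2 * (ennreal ((cmod b)\<^sup>2) * ennreal (\<rho> g * (cmod g)\<^sup>2) + ennreal (c\<^sup>2 * \<rho> g) * ennreal ((cmod h)\<^sup>2))" by simp
    qed measurable
  qed
  also have "\<dots> = (\<integral>\<^sup>+g. ennreal ((cmod b)\<^sup>2) * ennreal (\<rho> g * (cmod g)\<^sup>2) + ennreal (c\<^sup>2) * ennreal (\<rho> g) \<partial>?G)"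
    using \<rho> by (intro nn_integral_cong) (simp add: nn_integral_add nn_integral_cmult nn_integral_cg_moments(1)[simplified] ennreal_mult)
  also have "\<dots> = ennreal ((cmod b)\<^sup>2) * (\<integral>\<^sup>+g. ennreal (\<rho> g * (cmod g)\<^sup>2) \<partial>?G) + ennreal (c\<^sup>2) * (\<integral>\<^sup>+g. ennreal (\<rho> g) \<partial>?G)"
    by (simp add: nn_integral_add nn_integral_cmult)
  also have "c\<^sup>2 = (\<Sum>j<n. (cmod (w j))\<^sup>2) - (cmod b)\<^sup>2" using c by simp
  finally show ?thesis by (simp add: b_def)
qed

lemma measurable_phase [measurable]:
  assumes [measurable]: "f \<in> borel_measurable M" shows "(\<lambda>x. phase (f x)) \<in> borel_measurable M"
  unfolding phase_def by measurable

lemma cmod_phase [simp]: "cmod (phase z) = 1"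
  by (simp add: phase_def norm_divide)

lemma phase_mult_cmod: "phase z * of_real (cmod z) = z"
  by (simp add: phase_def)

lemma cnj_phase_mult: "cnj (phase z) * z = of_real (cmod z)"
proof -
  have "cnj (phase z) * z = (cnj (phase z) * phase z) * of_real (cmod z)"
    by (simp add: mult.assoc phase_mult_cmod)
  also have "cnj (phase z) * phase z = 1"
    using complex_norm_square[of "phase z"] by (simp add: mult.commute)
  finally show ?thesis by simp
qed

text \<open>After rotation by the phase of \<open>g\<close> the part of \<open>w\<close> along
  \<open>u\<close> contributes \<open>Im b * cmod g\<close>, which vanishes for real
  \<open>b\<close>. The independent part keeps only one of its two real components, and this is the
  origin of the factor \<open>1/2\<close>.\<close>

lemma nn_integral_Im_square:
  assumes u: "(\<Sum>j<n. (cmod (u j))\<^sup>2) = 1"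
  shows "(\<integral>\<^sup>+x. ennreal ((Im (cnj (phase (dotc n x u)) * dotc n x w))\<^sup>2) \<partial>gvec n) \<le>
     ennreal ((Im (dotc n u w))\<^sup>2 + (\<Sum>j<n. (cmod (w j))\<^sup>2) / 2)"
proof -
  let ?G = cgauss
  define b where "b = dotc n u w"
  obtain c where c: "c \<ge> 0" "(cmod b)\<^sup>2 + c\<^sup>2 = (\<Sum>j<n. (cmod (w j))\<^sup>2)" and law:
    "\<And>f :: complex \<times> complex \<Rightarrow> ennreal. f \<in> borel_measurable (borel \<Otimes>\<^sub>M borel) \<Longrightarrow>
        (\<integral>\<^sup>+x. f (dotc n x u, dotc n x w) \<partial>gvec n) = (\<integral>\<^sup>+g. \<integral>\<^sup>+h. f (g, b * g + of_real c * h) \<partial>?G \<partial>?G)"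
    using joint_law_unit[OF u, of w] unfolding b_def by blast
  \<comment> \<open>For fixed \<open>g\<close> the factor \<open>cnj (phase g)\<close> is
    unimodular, also at \<open>g = 0\<close>, so it does not change the law of
    \<open>h\<close>.\<close>
  have half: "(\<integral>\<^sup>+h. ennreal ((Im (cnj (phase g) * h))\<^sup>2) \<partial>?G) = ennreal (1/2)" for g
    using nn_integral_cg_phase[of "\<lambda>z. ennreal ((Im z)\<^sup>2)" "cnj (phase g)"]
    by (simp add: nn_integral_cg_Re_Im_square)
  have "(\<integral>\<^sup>+x. ennreal ((Im (cnj (phase (dotc n x u)) * dotc n x w))\<^sup>2) \<partial>gvec n) =
     (\<integral>\<^sup>+g. \<integral>\<^sup>+h. ennreal ((Im (cnj (phase g) * (b * g + of_real c * h)))\<^sup>2) \<partial>?G \<partial>?G)"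
    using law[of "\<lambda>p. ennreal ((Im (cnj (phase (fst p)) * snd p))\<^sup>2)"] by simp
  also have "\<dots> = (\<integral>\<^sup>+g. \<integral>\<^sup>+h. ennreal ((Im b)\<^sup>2) * ennreal ((cmod g)\<^sup>2) + ennreal (c\<^sup>2) * ennreal ((Im (cnj (phase g) * h))\<^sup>2) \<partial>?G \<partial>?G)"
  proof (rule nn_integral_cong, goal_cases)
    case (1 g)
    show ?case
    proof (rule nn_integral_cg_symmetrize)
    fix h
    have im: "Im (cnj (phase g) * (b * g + of_real c * h)) = Im b * cmod g + c * Im (cnj (phase g) * h)" for h
    proof -
      have "cnj (phase g) * (b * g + of_real c * h) = b * (cnj (phase g) * g) + of_real c * (cnj (phase g) * h)"
        by (simp add: algebra_simps)
      also have "\<dots> = b * of_real (cmod g) + of_real c * (cnj (phase g) * h)" by (simp only: cnj_phase_mult)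
      finally show ?thesis by simp
    qed
    define p q where "p = Im b * cmod g" and "q = c * Im (cnj (phase g) * h)"
    have q: "c * Im (cnj (phase g) * - h) = - q" by (simp add: q_def algebra_simps)
    have "ennreal ((p + q)\<^sup>2) + ennreal ((p + - q)\<^sup>2) = ennreal ((p + q)\<^sup>2 + (p + - q)\<^sup>2)"
      by (rule ennreal_plus[symmetric]) auto
    also have "(p + q)\<^sup>2 + (p + - q)\<^sup>2 = 2 * (p\<^sup>2 + q\<^sup>2)" by (simp add: power2_eq_square algebra_simps)
    also have "ennreal \<dots> = 2 * (ennreal (p\<^sup>2) + ennreal (q\<^sup>2))" by (subst ennreal_mult) auto
    also have "ennreal (p\<^sup>2) = ennreal ((Im b)\<^sup>2) * ennreal ((cmod g)\<^sup>2)"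
      by (simp add: p_def power_mult_distrib ennreal_mult)
    also have "ennreal (q\<^sup>2) = ennreal (c\<^sup>2) * ennreal ((Im (cnj (phase g) * h))\<^sup>2)"
      unfolding q_def power_mult_distrib by (rule ennreal_mult) auto
    finally show "ennreal ((Im (cnj (phase g) * (b * g + of_real c * h)))\<^sup>2) + ennreal ((Im (cnj (phase g) * (b * g + of_real c * - h)))\<^sup>2)
      = 2 * (ennreal ((Im b)\<^sup>2) * ennreal ((cmod g)\<^sup>2) + ennreal (c\<^sup>2) * ennreal ((Im (cnj (phase g) * h))\<^sup>2))"
      unfolding im q unfolding p_def q_def .
    qed measurable
  qed
  also have "\<dots> = (\<integral>\<^sup>+g. ennreal ((Im b)\<^sup>2) * ennreal ((cmod g)\<^sup>2) + ennreal (c\<^sup>2) * ennreal (1/2) \<partial>?G)"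
    by (intro nn_integral_cong) (simp add: nn_integral_add nn_integral_cmult half[simplified])
  also have "\<dots> = ennreal ((Im b)\<^sup>2) + ennreal (c\<^sup>2) * ennreal (1/2)"
    by (simp add: nn_integral_add nn_integral_cmult nn_integral_cg_moments(1)[simplified])
  also have "ennreal (c\<^sup>2) * ennreal (1/2) = ennreal (c\<^sup>2 / 2)"
    by (subst ennreal_mult[symmetric]) auto
  also have "ennreal ((Im b)\<^sup>2) + ennreal (c\<^sup>2 / 2) = ennreal ((Im b)\<^sup>2 + c\<^sup>2 / 2)"
    by simp
  also have "\<dots> \<le> ennreal ((Im b)\<^sup>2 + (\<Sum>j<n. (cmod (w j))\<^sup>2) / 2)"
    using c zero_le_power2[of "cmod b"] by (intro ennreal_leI) linarith
  finally show ?thesis by (simp add: b_def)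
qed

section \<open>Nets of the unit ball\<close>

definition nrm :: "nat \<Rightarrow> (nat \<Rightarrow> complex) \<Rightarrow> real" where
  "nrm n v = L2_set (\<lambda>j. cmod (v j)) {..<n}"

lemma nrm_power2: "(nrm n v)\<^sup>2 = (\<Sum>j<n. (cmod (v j))\<^sup>2)"
  by (simp add: nrm_def L2_set_def sum_nonneg)

lemma nrm_nonneg [simp]: "nrm n v \<ge> 0"
  by (simp add: nrm_def L2_set_nonneg)

lemma nrm_le_iff: "c \<ge> 0 \<Longrightarrow> nrm n v \<le> c \<longleftrightarrow> (\<Sum>j<n. (cmod (v j))\<^sup>2) \<le> c\<^sup>2"
  by (metis nrm_power2 abs_le_square_iff abs_of_nonneg nrm_nonneg)

lemma nrm_triangle: "nrm n (\<lambda>j. u j + v j) \<le> nrm n u + nrm n v"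
  unfolding nrm_def
  by (rule order_trans[OF L2_set_mono L2_set_triangle_ineq]) (auto intro: norm_triangle_ineq)

lemma nrm_scale: "nrm n (\<lambda>j. c * v j) = cmod c * nrm n v"
  by (simp add: nrm_def norm_mult L2_set_right_distrib)

text \<open>Rounding is towards zero and not to the nearest integer: the lattice point must not be
  longer than the vector it approximates, so that the net stays inside the unit ball.\<close>

lemma int_trunc:
  fixes x :: real
  obtains k :: int where "\<bar>real_of_int k\<bar> \<le> \<bar>x\<bar>" "\<bar>x - real_of_int k\<bar> \<le> 1"
proof (cases "x \<ge> 0")
  case True
  then have "0 \<le> \<lfloor>x\<rfloor>" by simp
  then have "0 \<le> real_of_int \<lfloor>x\<rfloor>" by simp
  with True show ?thesis by (intro that[of "\<lfloor>x\<rfloor>"]) linarith+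
next
  case False
  then have "\<lceil>x\<rceil> \<le> 0" by simp
  then have "real_of_int \<lceil>x\<rceil> \<le> 0" by simp
  with False show ?thesis by (intro that[of "\<lceil>x\<rceil>"]) linarith+
qed

lemma sum_half_power_int: "(\<Sum>k=- int N..int N. (1/2::real) ^ nat \<bar>k\<bar>) \<le> 3"
proof -
  have "(\<Sum>k=- int N..int N. (1/2::real) ^ nat \<bar>k\<bar>) = 3 - 2 * (1/2) ^ N"
  proof (induction N)
    case (Suc N)
    have "{- int (Suc N)..int (Suc N)} = insert (- int (Suc N)) (insert (int (Suc N)) {- int N..int N})"
      by auto
    then have "(\<Sum>k=- int (Suc N)..int (Suc N). (1/2::real) ^ nat \<bar>k\<bar>) = 2 * (1/2) ^ Suc N + (\<Sum>k=- int N..int N. (1/2::real) ^ nat \<bar>k\<bar>)"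
      by (simp add: nat_add_distrib)
    then show ?case using Suc by simp
  qed simp
  then show ?thesis by (simp add: power_decreasing)
qed

lemma exp_minus_square_le: "exp (- (real_of_int k)\<^sup>2) \<le> (1/2) ^ nat \<bar>k\<bar>"
proof -
  have "\<bar>real_of_int k\<bar> \<le> (real_of_int k)\<^sup>2"
  proof (cases "k = 0")
    case False
    then have "1 \<le> \<bar>real_of_int k\<bar>" by linarith
    then have "1 * \<bar>real_of_int k\<bar> \<le> \<bar>real_of_int k\<bar> * \<bar>real_of_int k\<bar>" by (rule mult_right_mono) simp
    then show ?thesis by (simp add: power2_eq_square)
  qed simp
  then have "exp (- (real_of_int k)\<^sup>2) \<le> exp (- real (nat \<bar>k\<bar>))" by simp
  also have "\<dots> = exp (-1) ^ nat \<bar>k\<bar>" by (simp add: exp_of_nat_mult[symmetric])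
  also have "\<dots> \<le> (1/2) ^ nat \<bar>k\<bar>"
  proof (rule power_mono)
    have "(2::real) \<le> exp 1" using exp_ge_add_one_self[of 1] by simp
    then show "exp (-1) \<le> (1/2::real)" by (simp add: exp_minus field_simps)
  qed simp
  finally show ?thesis .
qed

text \<open>Lattice points in a ball are counted by comparison with a product of Gaussian sums:
  each of them has weight at least 1 under \<open>exp (R - \<Sum>j. \<bar>k\<^sub>j\<bar>\<^sup>2)\<close>.\<close>

lemma card_lattice_ball:
  fixes R :: real and n :: nat
  defines "S \<equiv> {k \<in> {..<n} \<rightarrow>\<^sub>E (UNIV :: (int \<times> int) set). 
    (\<Sum>j<n. (real_of_int (fst (k j)))\<^sup>2 + (real_of_int (snd (k j)))\<^sup>2) \<le> R}"
  shows "finite S" "real (card S) \<le> exp R * 9 ^ n"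
proof -
  \<comment> \<open>The box only makes the sums finite. Its size disappears from the result because
    the one-dimensional sums are at most 3 for every \<open>N\<close>.\<close>
  define N where "N = nat \<lceil>\<bar>R\<bar>\<rceil> + 1"
  define B where "B = {- int N..int N}"
  let ?q = "\<lambda>p :: int \<times> int. (real_of_int (fst p))\<^sup>2 + (real_of_int (snd p))\<^sup>2"
  have small: "l \<in> B" if "(real_of_int l)\<^sup>2 \<le> R" for l
  proof -
    have "\<bar>real_of_int l\<bar> \<le> 1 + (real_of_int l)\<^sup>2"
      using sum_squares_bound[of 1 "\<bar>real_of_int l\<bar>"] unfolding power2_abs one_power2 by linarith
    then have "\<bar>real_of_int l\<bar> \<le> 1 + R" using that by linarith
    then have "\<bar>l\<bar> \<le> int N" unfolding N_def by linarith
    then show ?thesis by (auto simp: B_def)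
  qed
  have sub: "S \<subseteq> PiE {..<n} (\<lambda>_. B \<times> B)"
  proof
    fix k assume k: "k \<in> S"
    have "?q (k j) \<le> R" if "j < n" for j
    proof -
      have "?q (k j) \<le> (\<Sum>j<n. ?q (k j))"
        by (rule member_le_sum) (use that in auto)
      then show ?thesis using k by (simp add: S_def)
    qed
    note q = this
    have "(real_of_int (fst (k j)))\<^sup>2 \<le> R" "(real_of_int (snd (k j)))\<^sup>2 \<le> R" if "j < n" for j
    proof -
      from q[OF that] zero_le_power2[of "real_of_int (fst (k j))"] zero_le_power2[of "real_of_int (snd (k j))"]
      show "(real_of_int (fst (k j)))\<^sup>2 \<le> R" "(real_of_int (snd (k j)))\<^sup>2 \<le> R" by linarith+
    qed
    then have "k j \<in> B \<times> B" if "j < n" for j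
      using that by (simp add: small mem_Times_iff)
    then show "k \<in> PiE {..<n} (\<lambda>_. B \<times> B)" using k by (auto simp: S_def PiE_iff)
  qed
  have finP: "finite (PiE {..<n} (\<lambda>_. B \<times> B))" by (rule finite_PiE) (auto simp: B_def)
  show "finite S" by (rule finite_subset[OF sub finP])
  have "real (card S) = (\<Sum>k\<in>S. 1)" by simp
  also have "\<dots> \<le> (\<Sum>k\<in>S. exp (R - (\<Sum>j<n. ?q (k j))))"
    by (rule sum_mono) (auto simp: S_def)
  also have "\<dots> \<le> (\<Sum>k\<in>PiE {..<n} (\<lambda>_. B \<times> B). exp (R - (\<Sum>j<n. ?q (k j))))"
    by (rule sum_mono2[OF finP sub]) simp
  also have "\<dots> = exp R * (\<Sum>k\<in>PiE {..<n} (\<lambda>_. B \<times> B). \<Prod>j<n. exp (- ?q (k j)))"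
    unfolding sum_distrib_left
  proof (rule sum.cong[OF refl])
    fix k :: "nat \<Rightarrow> int \<times> int"
    have "(\<Prod>j<n. exp (- ?q (k j))) = exp (- (\<Sum>j<n. ?q (k j)))"
      by (subst exp_sum[symmetric]) (simp_all only: sum_negf finite_lessThan)
    then show "exp (R - (\<Sum>j<n. ?q (k j))) = exp R * (\<Prod>j<n. exp (- ?q (k j)))"
      by (simp only: exp_add[symmetric] diff_conv_add_uminus)
  qed
  also have "(\<Sum>k\<in>PiE {..<n} (\<lambda>_. B \<times> B). \<Prod>j<n. exp (- ?q (k j))) = (\<Prod>j<n. \<Sum>p\<in>B \<times> B. exp (- ?q p))"
    by (rule prod_sum_PiE[symmetric]) (auto simp: B_def)
  also have "(\<Sum>p\<in>B \<times> B. exp (- ?q p)) = (\<Sum>k\<in>B. exp (- (real_of_int k)\<^sup>2)) * (\<Sum>k\<in>B. exp (- (real_of_int k)\<^sup>2))"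
    unfolding sum_product sum.cartesian_product by (simp add: exp_add[symmetric] case_prod_beta)
  also have "exp R * (\<Prod>j<n. (\<Sum>k\<in>B. exp (- (real_of_int k)\<^sup>2)) * (\<Sum>k\<in>B. exp (- (real_of_int k)\<^sup>2))) \<le> exp R * 9 ^ n"
  proof -
    have "(\<Sum>k\<in>B. exp (- (real_of_int k)\<^sup>2)) \<le> (\<Sum>k\<in>B. (1/2) ^ nat \<bar>k\<bar>)"
      by (rule sum_mono) (rule exp_minus_square_le)
    also have "\<dots> \<le> 3" unfolding B_def by (rule sum_half_power_int)
    finally have 3: "(\<Sum>k\<in>B. exp (- (real_of_int k)\<^sup>2)) \<le> 3" .
    have "(\<Sum>k\<in>B. exp (- (real_of_int k)\<^sup>2)) * (\<Sum>k\<in>B. exp (- (real_of_int k)\<^sup>2)) \<le> 3 * 3"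
      by (rule mult_mono[OF 3 3]) (auto intro: sum_nonneg)
    then have "((\<Sum>k\<in>B. exp (- (real_of_int k)\<^sup>2)) * (\<Sum>k\<in>B. exp (- (real_of_int k)\<^sup>2))) ^ n \<le> 9 ^ n"
      by (intro power_mono) (auto intro!: mult_nonneg_nonneg sum_nonneg)
    then show ?thesis by simp
  qed
  finally show "real (card S) \<le> exp R * 9 ^ n" .
qed

text \<open>The net consists of the points of a grid of mesh \<open>h\<close> in the unit ball. Its
  cardinality is at most the \<open>n\<close>-th power of a constant, which is what an exponentially
  small probability in \<open>m \<ge> M * n\<close> can absorb.\<close>

lemma unit_ball_net:
  assumes eps: "\<epsilon> > 0"
  obtains W where "finite W" "real (card W) \<le> (9 * exp (2 / \<epsilon>\<^sup>2)) ^ n" "\<And>w. w \<in> W \<Longrightarrow> nrm n w \<le> 1"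
    "\<And>v. nrm n v \<le> 1 \<Longrightarrow> \<exists>w\<in>W. nrm n (\<lambda>j. v j - w j) \<le> \<epsilon>"
proof (cases "n = 0")
  case True
  show ?thesis by (rule that[of "{\<lambda>_. 0}"]) (use True eps in \<open>auto simp: nrm_def\<close>)
next
  case False
  \<comment> \<open>Each of the \<open>2 * n\<close> real coordinates is rounded with an error of at
    most \<open>h\<close>, which makes a total error of at most
    \<open>sqrt (2 * n) * h = \<epsilon>\<close>. In units of \<open>h\<close> the unit ball has
    squared radius \<open>R = 2 * n / \<epsilon>^2\<close>.\<close>
  define h where "h = \<epsilon> / sqrt (2 * n)"
  have h: "h > 0" using eps False by (simp add: h_def)
  have h2: "h\<^sup>2 = \<epsilon>\<^sup>2 / (2 * n)" using False by (simp add: h_def power_divide)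
  define R where "R = 1 / h\<^sup>2"
  let ?q = "\<lambda>p :: int \<times> int. (real_of_int (fst p))\<^sup>2 + (real_of_int (snd p))\<^sup>2"
  define S where "S = {k \<in> {..<n} \<rightarrow>\<^sub>E (UNIV :: (int \<times> int) set). (\<Sum>j<n. ?q (k j)) \<le> R}"
  define pt where "pt = (\<lambda>(k :: nat \<Rightarrow> int \<times> int) j. Complex (h * real_of_int (fst (k j))) (h * real_of_int (snd (k j))))"
  have npt: "(\<Sum>j<n. (cmod (pt k j))\<^sup>2) = h\<^sup>2 * (\<Sum>j<n. ?q (k j))" for k
    by (simp add: pt_def cmod_power2 power_mult_distrib sum_distrib_left distrib_left)
  have S: "finite S" "real (card S) \<le> exp R * 9 ^ n"
    unfolding S_def by (rule card_lattice_ball)+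
  have "exp R = exp (2 / \<epsilon>\<^sup>2) ^ n"
    unfolding R_def h2 by (simp add: exp_of_nat_mult[symmetric] mult.commute)
  with S(2) have "real (card S) \<le> (9 * exp (2 / \<epsilon>\<^sup>2)) ^ n" by (simp add: power_mult_distrib mult.commute)
  moreover have "card (pt ` S) \<le> card S" by (rule card_image_le) fact
  ultimately have "real (card (pt ` S)) \<le> (9 * exp (2 / \<epsilon>\<^sup>2)) ^ n" by linarith
  then show ?thesis
  proof (rule that[rotated])
    show "finite (pt ` S)" using S by simp
    fix w assume "w \<in> pt ` S"
    then obtain k where k: "k \<in> S" "w = pt k" by auto
    have "h\<^sup>2 * (\<Sum>j<n. ?q (k j)) \<le> h\<^sup>2 * R" using k by (intro mult_left_mono) (auto simp: S_def)
    then show "nrm n w \<le> 1" using k npt[of k] h by (simp add: nrm_le_iff R_def)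
  next
    fix v assume v: "nrm n v \<le> 1"
    have "\<forall>j. \<exists>p :: int \<times> int. \<bar>real_of_int (fst p)\<bar> \<le> \<bar>Re (v j) / h\<bar> \<and> \<bar>Re (v j) / h - real_of_int (fst p)\<bar> \<le> 1 \<and> 
       \<bar>real_of_int (snd p)\<bar> \<le> \<bar>Im (v j) / h\<bar> \<and> \<bar>Im (v j) / h - real_of_int (snd p)\<bar> \<le> 1"
    proof
      fix j
      obtain k1 k2 :: int where "\<bar>real_of_int k1\<bar> \<le> \<bar>Re (v j) / h\<bar>" "\<bar>Re (v j) / h - real_of_int k1\<bar> \<le> 1"
        "\<bar>real_of_int k2\<bar> \<le> \<bar>Im (v j) / h\<bar>" "\<bar>Im (v j) / h - real_of_int k2\<bar> \<le> 1"
        using int_trunc[of "Re (v j) / h"] int_trunc[of "Im (v j) / h"] by metis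
      then show "\<exists>p :: int \<times> int. \<bar>real_of_int (fst p)\<bar> \<le> \<bar>Re (v j) / h\<bar> \<and> \<bar>Re (v j) / h - real_of_int (fst p)\<bar> \<le> 1 \<and> 
       \<bar>real_of_int (snd p)\<bar> \<le> \<bar>Im (v j) / h\<bar> \<and> \<bar>Im (v j) / h - real_of_int (snd p)\<bar> \<le> 1"
        by (intro exI[of _ "(k1, k2)"]) simp
    qed
    then obtain p :: "nat \<Rightarrow> int \<times> int" where p:
      "\<bar>real_of_int (fst (p j))\<bar> \<le> \<bar>Re (v j) / h\<bar>" "\<bar>Re (v j) / h - real_of_int (fst (p j))\<bar> \<le> 1"
      "\<bar>real_of_int (snd (p j))\<bar> \<le> \<bar>Im (v j) / h\<bar>" "\<bar>Im (v j) / h - real_of_int (snd (p j))\<bar> \<le> 1" for j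
      by metis
    define k where "k = restrict p {..<n}"
    have "(\<Sum>j<n. ?q (k j)) \<le> (\<Sum>j<n. (cmod (v j))\<^sup>2 / h\<^sup>2)"
    proof (rule sum_mono)
      fix j assume "j \<in> {..<n}"
      then have kj: "k j = p j" by (simp add: k_def)
      have "(real_of_int (fst (p j)))\<^sup>2 \<le> (Re (v j) / h)\<^sup>2" "(real_of_int (snd (p j)))\<^sup>2 \<le> (Im (v j) / h)\<^sup>2"
        using p(1,3)[of j] by (simp_all only: abs_le_square_iff)
      then show "?q (k j) \<le> (cmod (v j))\<^sup>2 / h\<^sup>2"
        by (simp add: kj cmod_power2 power_divide add_divide_distrib)
    qed
    also have "\<dots> = (\<Sum>j<n. (cmod (v j))\<^sup>2) / h\<^sup>2" by (simp add: sum_divide_distrib)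
    also have "\<dots> \<le> R" unfolding R_def using v h by (intro divide_right_mono) (auto simp: nrm_le_iff)
    finally have kS: "k \<in> S" by (auto simp: S_def k_def)
    have "(\<Sum>j<n. (cmod (v j - pt k j))\<^sup>2) \<le> (\<Sum>j<n. 2 * h\<^sup>2)"
    proof (rule sum_mono)
      fix j assume "j \<in> {..<n}"
      then have kj: "k j = p j" by (simp add: k_def)
      have 1: "(x - h * y)\<^sup>2 \<le> h\<^sup>2" if "\<bar>x / h - y\<bar> \<le> 1" for x y
      proof -
        have "x - h * y = h * (x / h - y)" using h by (simp add: field_simps)
        moreover have "(x / h - y)\<^sup>2 \<le> 1" using that by (simp add: abs_square_le_1)
        ultimately show ?thesis by (simp add: power_mult_distrib mult_left_le)
      qed
      show "(cmod (v j - pt k j))\<^sup>2 \<le> 2 * h\<^sup>2"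
        using 1[OF p(2)[of j]] 1[OF p(4)[of j]] by (simp add: cmod_power2 pt_def kj)
    qed
    also have "\<dots> = \<epsilon>\<^sup>2" using False by (simp add: h2)
    finally have "nrm n (\<lambda>j. v j - pt k j) \<le> \<epsilon>" using eps by (simp add: nrm_le_iff)
    then show "\<exists>w\<in>pt ` S. nrm n (\<lambda>j. v j - w j) \<le> \<epsilon>" using kS by blast
  qed
qed

section \<open>Uniform concentration\<close>

definition ball_net :: "nat \<Rightarrow> real \<Rightarrow> (nat \<Rightarrow> complex) set \<Rightarrow> bool" where
  "ball_net n \<epsilon> W \<longleftrightarrow> (\<forall>w\<in>W. nrm n w \<le> 1) \<and> (\<forall>v. nrm n v \<le> 1 \<longrightarrow> (\<exists>w\<in>W. nrm n (\<lambda>j. v j - w j) \<le> \<epsilon>))"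

text \<open>A union bound over \<open>insert u W\<close> and the finite family \<open>J\<close>,
  whose members carry a bound \<open>\<mu>\<close> on the mean that may depend on \<open>w\<close>.
  The vector \<open>u\<close> is adjoined because some sums are needed at \<open>u\<close> itself
  and not at a nearby point. The passage from the net to all vectors is made later, for seminorms,
  by the triangle inequality.\<close>

lemma uniform_concentration:
  assumes K: "K > 0" and eta: "\<eta> > 0" and eps: "\<epsilon> > 0"
  obtains c M where "c > 0" "M > 0"
    "\<And>n m u J. \<lbrakk>real m \<ge> M * real n; nrm n u = 1; finite J;
       \<And>f \<mu> w. (f, \<mu>) \<in> J \<Longrightarrow> f \<in> borel_measurable (borel \<Otimes>\<^sub>M borel);
       \<And>f \<mu> a b. (f, \<mu>) \<in> J \<Longrightarrow> \<bar>f (a, b)\<bar> \<le> K * (1 + (cmod a)\<^sup>2 + (cmod b)\<^sup>2);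
       \<And>f \<mu> w. (f, \<mu>) \<in> J \<Longrightarrow> nrm n w \<le> 1 \<Longrightarrow> (\<integral>x. f (dotc n x u, dotc n x w) \<partial>gvec n) \<le> \<mu> w\<rbrakk> \<Longrightarrow>
       \<exists>W. ball_net n \<epsilon> W \<and>
         (\<exists>E\<in>sets (sensing_space m n). measure (sensing_space m n) E \<ge> 1 - 2 * real (card J) * exp (- c * real m) \<and>
           (\<forall>\<omega>\<in>E. \<forall>w\<in>insert u W. \<forall>(f, \<mu>)\<in>J.
              (\<Sum>i<m. f (rdot n \<omega> i u, rdot n \<omega> i w)) < real m * (\<mu> w + \<eta>)))"
proof (rule concentration[OF K eta])
  fix c assume c: "0 < c" and conc:
    "\<And>n m u w f \<mu>. \<lbrakk>f \<in> borel_measurable (borel \<Otimes>\<^sub>M borel);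
       \<And>a b. \<bar>f (a, b)\<bar> \<le> K * (1 + (cmod a)\<^sup>2 + (cmod b)\<^sup>2);
       (\<Sum>j<n. (cmod (u j))\<^sup>2) = 1; (\<Sum>j<n. (cmod (w j))\<^sup>2) \<le> 1;
       (\<integral>x. f (dotc n x u, dotc n x w) \<partial>gvec n) \<le> \<mu>\<rbrakk> \<Longrightarrow>
       measure (sensing_space m n) {\<omega> \<in> space (sensing_space m n).
          real m * (\<mu> + \<eta>) \<le> (\<Sum>i<m. f (rdot n \<omega> i u, rdot n \<omega> i w))}
       \<le> exp (- c * real m)"
  define D where "D = 9 * exp (2 / \<epsilon>\<^sup>2)"
  have "1 \<le> exp (2 / \<epsilon>\<^sup>2)" by simp
  then have D1: "D > 1" unfolding D_def by linarith
  \<comment> \<open>With this choice \<open>D ^ n\<close> is at most \<open>exp (c / 2 * m)\<close>: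
    half of the exponent pays for the net.\<close>
  define M where "M = 2 * ln D / c"
  show ?thesis
  proof (rule that[of "c / 2" M])
    show "c / 2 > 0" "M > 0" using c D1 by (simp_all add: M_def)
    fix n m u and J :: "((complex \<times> complex \<Rightarrow> real) \<times> ((nat \<Rightarrow> complex) \<Rightarrow> real)) set"
    assume m: "real m \<ge> M * real n" and u: "nrm n u = 1" and J: "finite J"
      and meas: "\<And>f \<mu> w. (f, \<mu>) \<in> J \<Longrightarrow> f \<in> borel_measurable (borel \<Otimes>\<^sub>M borel)"
      and gr: "\<And>f \<mu> a b. (f, \<mu>) \<in> J \<Longrightarrow> \<bar>f (a, b)\<bar> \<le> K * (1 + (cmod a)\<^sup>2 + (cmod b)\<^sup>2)"
      and mean: "\<And>f \<mu> w. (f, \<mu>) \<in> J \<Longrightarrow> nrm n w \<le> 1 \<Longrightarrow> (\<integral>x. f (dotc n x u, dotc n x w) \<partial>gvec n) \<le> \<mu> w"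
    obtain W where W: "finite W" "real (card W) \<le> D ^ n" "\<And>w. w \<in> W \<Longrightarrow> nrm n w \<le> 1"
      "\<And>v. nrm n v \<le> 1 \<Longrightarrow> \<exists>w\<in>W. nrm n (\<lambda>j. v j - w j) \<le> \<epsilon>"
      using unit_ball_net[OF eps, of n] unfolding D_def by blast
    let ?S = "sensing_space m n"
    interpret S: prob_space ?S by (rule prob_space_sensing_space)
    define Bad where "Bad = (\<lambda>(w, f, \<mu>). {\<omega> \<in> space ?S.
          real m * (\<mu> w + \<eta>) \<le> (\<Sum>i<m. f (rdot n \<omega> i u, rdot n \<omega> i w))})"
    define I where "I = insert u W \<times> J"
    have finI: "finite I" using W J by (simp add: I_def)
    have u1: "(\<Sum>j<n. (cmod (u j))\<^sup>2) = 1" using u nrm_power2[of n u] by simp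
    have wle: "nrm n w \<le> 1" if "w \<in> insert u W" for w using that u W by auto
    have dm: "(\<lambda>\<omega>. rdot n \<omega> i v) \<in> borel_measurable ?S" if "i < m" for i v
    proof -
      have "(\<lambda>\<omega>. dotc n (\<lambda>j\<in>{..<n}. \<omega> (i, j)) v) \<in> borel_measurable ?S"
        by (rule measurable_compose[OF measurable_row[OF that] measurable_dotc])
      then show ?thesis by simp
    qed
    have sm: "(\<lambda>\<omega>. \<Sum>i<m. f (rdot n \<omega> i u, rdot n \<omega> i w)) \<in> borel_measurable ?S"
      if "(f, \<mu>) \<in> J" for f \<mu> w
    proof (rule borel_measurable_sum)
      fix i assume "i \<in> {..<m}"
      then have [measurable]: "(\<lambda>\<omega>. rdot n \<omega> i v) \<in> borel_measurable ?S" for v using dm by simp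
      show "(\<lambda>\<omega>. f (rdot n \<omega> i u, rdot n \<omega> i w)) \<in> borel_measurable ?S"
        by (rule measurable_compose[OF _ meas[OF that]]) measurable
    qed
    have Bad_sets: "Bad k \<in> sets ?S" if "k \<in> I" for k
    proof -
      obtain w f \<mu> where k: "k = (w, f, \<mu>)" by (cases k) auto
      have "(f, \<mu>) \<in> J" using that by (simp add: k I_def)
      from sm[OF this, of w] show ?thesis unfolding k Bad_def prod.case by measurable
    qed
    have Bad_le: "measure ?S (Bad k) \<le> exp (- c * real m)" if "k \<in> I" for k
    proof -
      obtain w f \<mu> where k: "k = (w, f, \<mu>)" by (cases k) auto
      have kJ: "(f, \<mu>) \<in> J" and w: "nrm n w \<le> 1" using that wle by (auto simp: k I_def)
      have w2: "(\<Sum>j<n. (cmod (w j))\<^sup>2) \<le> 1" using w by (simp add: nrm_le_iff)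
      show ?thesis unfolding k Bad_def prod.case
        by (rule conc[OF meas[OF kJ] gr[OF kJ] u1 w2 mean[OF kJ w]])
    qed
    let ?E = "space ?S - (\<Union>k\<in>I. Bad k)"
    have Ub: "(\<Union>k\<in>I. Bad k) \<in> sets ?S" using Bad_sets finI by (intro sets.finite_UN) auto
    \<comment> \<open>The factor 2 accounts for the adjoined \<open>u\<close>, since
      \<open>1 \<le> D ^ n\<close>.\<close>
    have cI: "real (card I) \<le> 2 * real (card J) * D ^ n"
    proof -
      have "1 \<le> D ^ n" using D1 by (simp add: one_le_power)
      moreover have "real (card (insert u W)) \<le> real (card W) + 1"
        using card_insert_le_m1 W(1) by (simp add: card_insert_if)
      ultimately have "real (card (insert u W)) \<le> 2 * D ^ n" using W(2) by linarith
      then have "real (card (insert u W)) * real (card J) \<le> 2 * D ^ n * real (card J)"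
        by (rule mult_right_mono) simp
      then show ?thesis by (simp add: I_def card_cartesian_product mult_ac)
    qed
    have "measure ?S (\<Union>k\<in>I. Bad k) \<le> (\<Sum>k\<in>I. measure ?S (Bad k))"
      by (rule S.finite_measure_subadditive_finite[OF finI]) (use Bad_sets in auto)
    also have "\<dots> \<le> (\<Sum>k\<in>I. exp (- c * real m))" by (rule sum_mono) (rule Bad_le)
    also have "\<dots> = real (card I) * exp (- c * real m)" by simp
    also have "\<dots> \<le> 2 * real (card J) * D ^ n * exp (- c * real m)"
      by (rule mult_right_mono[OF cI]) simp
    also have "\<dots> = 2 * real (card J) * (D ^ n * exp (- c * real m))" by simp
    also have "\<dots> \<le> 2 * real (card J) * exp (- (c / 2) * real m)"
    proof (rule mult_left_mono)
      have "D ^ n = exp (real n * ln D)" using D1 by (simp add: exp_of_nat_mult)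
      then have "D ^ n * exp (- c * real m) = exp (real n * ln D - c * real m)"
        by (simp add: exp_add[symmetric])
      also have "\<dots> \<le> exp (- (c / 2) * real m)"
      proof -
        have "c / 2 * (M * real n) \<le> c / 2 * real m" using m c by (intro mult_left_mono) auto
        then have "real n * ln D \<le> c / 2 * real m" using c by (simp add: M_def mult.commute)
        then show ?thesis by simp
      qed
      finally show "D ^ n * exp (- c * real m) \<le> exp (- (c / 2) * real m)" .
    qed simp
    finally have "measure ?S ?E \<ge> 1 - 2 * real (card J) * exp (- (c / 2) * real m)"
      using S.prob_compl[OF Ub] by linarith
    moreover have "?E \<in> sets ?S" using Ub by auto
    moreover have "\<forall>\<omega>\<in>?E. \<forall>w\<in>insert u W. \<forall>(f, \<mu>)\<in>J.
        (\<Sum>i<m. f (rdot n \<omega> i u, rdot n \<omega> i w)) < real m * (\<mu> w + \<eta>)"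
    proof (intro ballI, clarify)
      fix \<omega> w f \<mu> assume \<omega>: "\<omega> \<in> space ?S" "\<omega> \<notin> (\<Union>k\<in>I. Bad k)" and w: "w \<in> insert u W" and J: "(f, \<mu>) \<in> J"
      then have "\<omega> \<notin> Bad (w, f, \<mu>)" by (auto simp: I_def)
      then show "(\<Sum>i<m. f (rdot n \<omega> i u, rdot n \<omega> i w)) < real m * (\<mu> w + \<eta>)"
        using \<omega>(1) by (simp add: Bad_def)
    qed
    ultimately show "\<exists>W. ball_net n \<epsilon> W \<and>
         (\<exists>E\<in>sets ?S. measure ?S E \<ge> 1 - 2 * real (card J) * exp (- (c / 2) * real m) \<and>
           (\<forall>\<omega>\<in>E. \<forall>w\<in>insert u W. \<forall>(f, \<mu>)\<in>J.
              (\<Sum>i<m. f (rdot n \<omega> i u, rdot n \<omega> i w)) < real m * (\<mu> w + \<eta>)))"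
      using W(3,4) by (intro exI[of _ W] conjI bexI[of _ ?E]) (auto simp: ball_net_def)
  qed
qed

text \<open>With the truncation level fixed at \<open>L\<close>, the expected initialisation matrix has eigenvalue
  \<open>trunc4 L\<close> at \<open>u\<close> and \<open>trunc2 L\<close> on its orthogonal complement.\<close>

definition trunc4 :: "real \<Rightarrow> real" where
  "trunc4 L = (\<integral>g. (if (cmod g)\<^sup>2 \<le> L then (cmod g) ^ 4 else 0) \<partial>cgauss)"

definition trunc2 :: "real \<Rightarrow> real" where
  "trunc2 L = (\<integral>g. (if (cmod g)\<^sup>2 \<le> L then (cmod g)\<^sup>2 else 0) \<partial>cgauss)"

section \<open>Moments and truncated moments of a standard complex Gaussian\<close>

lemma integrable_cg_cmod_power:
  "integrable cgauss (\<lambda>g. (cmod g)\<^sup>2)"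
  "integrable cgauss (\<lambda>g. (cmod g) ^ 4)"
  "integrable cgauss (\<lambda>g. (cmod g) ^ 6)"
  by (rule integrableI_nonneg; simp add: nn_integral_cg_moments)+

lemma integral_cg_cmod_power:
  "(\<integral>g. (cmod g)\<^sup>2 \<partial>cgauss) = 1"
  "(\<integral>g. (cmod g) ^ 4 \<partial>cgauss) = 2"
  "(\<integral>g. (cmod g) ^ 6 \<partial>cgauss) = 6"
  using nn_integral_cg_moments by (simp_all add: integral_eq_nn_integral)

lemma integrable_trunc:
  "integrable cgauss (\<lambda>g. if (cmod g)\<^sup>2 \<le> L then (cmod g)\<^sup>2 else 0)"
  "integrable cgauss (\<lambda>g. if (cmod g)\<^sup>2 \<le> L then (cmod g) ^ 4 else 0)"
  by (rule Bochner_Integration.integrable_bound[OF integrable_cg_cmod_power(1)], simp, simp)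
     (rule Bochner_Integration.integrable_bound[OF integrable_cg_cmod_power(2)], simp, simp)

lemma nn_integral_trunc:
  "(\<integral>\<^sup>+g. ennreal (if (cmod g)\<^sup>2 \<le> L then (cmod g)\<^sup>2 else 0) \<partial>cgauss) = ennreal (trunc2 L)"
  "(\<integral>\<^sup>+g. ennreal (if (cmod g)\<^sup>2 \<le> L then (cmod g) ^ 4 else 0) \<partial>cgauss) = ennreal (trunc4 L)"
  unfolding trunc2_def trunc4_def
  by (rule nn_integral_eq_integral[OF integrable_trunc(1)], simp)
     (rule nn_integral_eq_integral[OF integrable_trunc(2)], simp)

lemma trunc_nonneg: "trunc2 L \<ge> 0" "trunc4 L \<ge> 0"
  by (simp_all add: trunc2_def trunc4_def)

lemma trunc4_le: "trunc4 L \<le> 2"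
proof -
  have "trunc4 L \<le> (\<integral>g. (cmod g) ^ 4 \<partial>cgauss)"
    unfolding trunc4_def by (rule integral_mono[OF integrable_trunc(2) integrable_cg_cmod_power(2)]) simp
  then show ?thesis by (simp add: integral_cg_cmod_power)
qed

text \<open>Beyond the cutoff \<open>|g|^4\<close> is at most \<open>|g|^6 / 8\<close>, so the sixth
  moment controls the loss, and \<open>2 - 1 - 6/8 = 1/4\<close>. This gap is what separates
  \<open>u\<close> from its orthogonal complement.\<close>

lemma trunc_gap: 
  assumes L: "L \<ge> 8" shows "trunc4 L - trunc2 L \<ge> 1/4"
proof -
  have "(\<integral>g. (cmod g) ^ 4 - (cmod g)\<^sup>2 - (cmod g) ^ 6 / 8 \<partial>cgauss) \<le>
    (\<integral>g. (if (cmod g)\<^sup>2 \<le> L then (cmod g) ^ 4 else 0) - (if (cmod g)\<^sup>2 \<le> L then (cmod g)\<^sup>2 else 0) \<partial>cgauss)"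
  proof (rule integral_mono)
    fix g :: complex
    have "(cmod g) ^ 4 \<le> (cmod g)\<^sup>2 + (cmod g) ^ 6 / 8" if "L < (cmod g)\<^sup>2"
    proof -
      have "8 * (cmod g) ^ 4 \<le> (cmod g)\<^sup>2 * (cmod g) ^ 4" by (rule mult_right_mono) (use that L in auto)
      also have "\<dots> = (cmod g) ^ 6" by (simp flip: power_add)
      finally show ?thesis using zero_le_power2[of "cmod g"] by linarith
    qed
    then show "(cmod g) ^ 4 - (cmod g)\<^sup>2 - (cmod g) ^ 6 / 8 \<le> 
       (if (cmod g)\<^sup>2 \<le> L then (cmod g) ^ 4 else 0) - (if (cmod g)\<^sup>2 \<le> L then (cmod g)\<^sup>2 else 0)"
      by auto
  qed (use integrable_trunc integrable_cg_cmod_power in auto)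
  also have "\<dots> = trunc4 L - trunc2 L"
    unfolding trunc4_def trunc2_def by (rule Bochner_Integration.integral_diff) (use integrable_trunc in auto)
  finally show ?thesis using integrable_cg_cmod_power by (simp add: integral_cg_cmod_power)
qed

lemma emeasure_gauss_finite:
  assumes "finite A" shows "emeasure gauss A = 0"
proof -
  have "A \<in> null_sets lborel" by (rule finite_imp_null_set_lborel[OF assms])
  then have "A \<in> null_sets gauss" unfolding gauss_def
    using AE_not_in[of A lborel] by (subst null_sets_density_iff) (auto elim: eventually_mono)
  then show ?thesis by auto
qed

text \<open>A vertical line meets the circle in at most two points, so every slice is a null
  set.\<close>

lemma emeasure_cg_circle: "emeasure cgauss {z. (cmod z)\<^sup>2 = r} = 0"
proof -
  have [measurable]: "{z. (cmod z)\<^sup>2 = r} \<in> sets borel" by measurable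
  have "emeasure cgauss {z. (cmod z)\<^sup>2 = r} = (\<integral>\<^sup>+z. indicator {z. (cmod z)\<^sup>2 = r} z \<partial>cgauss)"
    by simp
  also have "\<dots> = (\<integral>\<^sup>+x. \<integral>\<^sup>+y. indicator {z. (cmod z)\<^sup>2 = r} (Complex x y) \<partial>gauss \<partial>gauss)"
    by (rule nn_integral_std_complex_gaussian) measurable
  also have "\<dots> = (\<integral>\<^sup>+x. 0 \<partial>gauss)"
  proof (rule nn_integral_cong)
    fix x
    have sub: "{y. x\<^sup>2 + y\<^sup>2 = r} \<subseteq> {sqrt (r - x\<^sup>2), - sqrt (r - x\<^sup>2)}"
    proof
      fix y assume "y \<in> {y. x\<^sup>2 + y\<^sup>2 = r}"
      then have "r - x\<^sup>2 = y\<^sup>2" by auto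
      then have "sqrt (r - x\<^sup>2) = \<bar>y\<bar>" by simp
      then show "y \<in> {sqrt (r - x\<^sup>2), - sqrt (r - x\<^sup>2)}" by (auto simp: abs_if split: if_splits)
    qed
    have "(\<integral>\<^sup>+y. indicator {z. (cmod z)\<^sup>2 = r} (Complex x y) \<partial>gauss) = (\<integral>\<^sup>+y. indicator {y. x\<^sup>2 + y\<^sup>2 = r} y \<partial>gauss)"
      by (intro nn_integral_cong) (auto simp: indicator_def cmod_power2)
    also have "\<dots> = emeasure gauss {y. x\<^sup>2 + y\<^sup>2 = r}"
      by (rule nn_integral_indicator) measurable
    also have "\<dots> = 0" by (rule emeasure_gauss_finite[OF finite_subset[OF sub]]) simp
    finally show "(\<integral>\<^sup>+y. indicator {z. (cmod z)\<^sup>2 = r} (Complex x y) \<partial>gauss) = 0" .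
  qed
  finally show ?thesis by simp
qed

text \<open>The difference is the integral of \<open>|g|^4\<close> over a thin annulus around
  \<open>|g|^2 = 9\<close>. The annuli \<open>A k\<close> decrease to a subset of the circle, so
  their measures tend to 0, while the integrand stays bounded on them. The argument gives no rate,
  hence the unspecified \<open>e0\<close>.\<close>

lemma trunc4_continuous_at_9:
  assumes k: "\<kappa> > 0"
  obtains e0 where "e0 > 0" "\<And>e. 0 < e \<Longrightarrow> e \<le> e0 \<Longrightarrow> trunc4 (9 * (1 + e)) - trunc4 (9 * (1 - e)) \<le> \<kappa>"
proof -
  let ?G = cgauss
  define A where "A = (\<lambda>k::nat. {z. 9 - 9 / (Suc k) < (cmod z)\<^sup>2 \<and> (cmod z)\<^sup>2 \<le> 9 + 9 / Suc k})"
  have Am [measurable]: "A k \<in> sets ?G" for k unfolding A_def by measurable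
  have "(\<lambda>k. measure ?G (A k)) \<longlonglongrightarrow> measure ?G (\<Inter>k. A k)"
  proof (rule cg.finite_Lim_measure_decseq)
    show "range A \<subseteq> sets ?G" using Am by auto
    have "9 / real (Suc (Suc k)) \<le> 9 / real (Suc k)" for k by (rule divide_left_mono) auto
    then show "decseq A" unfolding decseq_Suc_iff A_def by (smt (verit) Collect_mono)
  qed
  moreover have "(\<Inter>k. A k) \<subseteq> {z. (cmod z)\<^sup>2 = 9}"
  proof
    fix z assume z: "z \<in> (\<Inter>k. A k)"
    have lim: "(\<lambda>k. 9 / real (Suc k)) \<longlonglongrightarrow> 0"
      using tendsto_mult_right_zero[OF LIMSEQ_inverse_real_of_nat, of 9] by (simp add: divide_inverse)
    have "(cmod z)\<^sup>2 \<le> 9 + 0"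
      by (rule LIMSEQ_le_const[OF tendsto_add[OF tendsto_const lim]]) (use z in \<open>auto simp: A_def\<close>)
    moreover have "9 - 0 \<le> (cmod z)\<^sup>2"
      by (rule LIMSEQ_le_const2[OF tendsto_diff[OF tendsto_const lim]]) (use z in \<open>auto simp: A_def intro: less_imp_le\<close>)
    ultimately show "z \<in> {z. (cmod z)\<^sup>2 = 9}" by simp
  qed
  then have "measure ?G (\<Inter>k. A k) \<le> measure ?G {z. (cmod z)\<^sup>2 = 9}"
    by (rule cg.finite_measure_mono) measurable
  then have "measure ?G (\<Inter>k. A k) = 0"
    using emeasure_cg_circle[of 9]
    unfolding measure_def[of ?G "{z. (cmod z)\<^sup>2 = 9}"] by (simp add: measure_le_0_iff)
  ultimately have "(\<lambda>k. measure ?G (A k)) \<longlonglongrightarrow> 0" by simp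
  then have "eventually (\<lambda>k. measure ?G (A k) < \<kappa> / 400) sequentially"
    by (rule order_tendstoD(2)) (use k in simp)
  then obtain k where kk: "measure ?G (A k) < \<kappa> / 400" by (auto simp: eventually_sequentially)
  show ?thesis
  proof (rule that[of "1 / Suc k"])
    fix e :: real assume e: "0 < e" "e \<le> 1 / Suc k"
    have e1: "e \<le> 1" using e(2) by (rule order_trans) simp
    have "trunc4 (9 * (1 + e)) - trunc4 (9 * (1 - e)) =
      (\<integral>g. (if (cmod g)\<^sup>2 \<le> 9 * (1 + e) then (cmod g) ^ 4 else 0) - (if (cmod g)\<^sup>2 \<le> 9 * (1 - e) then (cmod g) ^ 4 else 0) \<partial>?G)"
      unfolding trunc4_def by (rule Bochner_Integration.integral_diff[symmetric]) (use integrable_trunc in auto)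
    also have "\<dots> \<le> (\<integral>g. 400 * indicator (A k) g \<partial>?G)"
    proof (rule integral_mono)
      fix g :: complex
      \<comment> \<open>Since \<open>e \<le> 1\<close>, the squared modulus is at most 18, rounded
        up to 20, and \<open>400 = 20^2\<close>.\<close>
      have "(cmod g) ^ 4 \<le> 400" if "(cmod g)\<^sup>2 \<le> 9 * (1 + e)"
      proof -
        have "9 * (1 + e) \<le> 20" using e1 by simp
        with that have "(cmod g)\<^sup>2 \<le> 20" by (rule order_trans)
        then have "((cmod g)\<^sup>2)\<^sup>2 \<le> 20\<^sup>2" by (rule power_mono) simp
        then show ?thesis by simp
      qed
      moreover have "9 * e \<le> 9 / Suc k" using e(2) by simp
      ultimately show "(if (cmod g)\<^sup>2 \<le> 9 * (1 + e) then (cmod g) ^ 4 else 0) - (if (cmod g)\<^sup>2 \<le> 9 * (1 - e) then (cmod g) ^ 4 else 0)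
         \<le> 400 * indicator (A k) g"
        using e(1) by (auto simp: indicator_def A_def)
      have "emeasure ?G (A k) < \<infinity>" by (simp add: cg.emeasure_eq_measure)
      then have "integrable ?G (indicat_real (A k))" by (intro integrable_real_indicator) auto
      then show "integrable ?G (\<lambda>g. 400 * indicat_real (A k) g)" by simp
    qed (use integrable_trunc in auto)
    also have "\<dots> = 400 * measure ?G (A k)" by simp
    also have "\<dots> \<le> \<kappa>" using kk by simp
    finally show "trunc4 (9 * (1 + e)) - trunc4 (9 * (1 - e)) \<le> \<kappa>" .
  qed simp
qed

text \<open>The numerical constants bound the corresponding expectations: \<open>1/200000\<close> bounds \<open>4 exp (-20)\<close>, hence
  the mean excess of \<open>\<bar>g\<bar>\<^sup>2\<close> over 40, and \<open>3/10^8\<close> bounds the probability that \<open>\<bar>g\<bar> < 1/10^4\<close>. The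
  factors \<open>1 + e\<close> and \<open>1 - e\<close> sandwich the random truncation level of the initialisation matrix.\<close>

definition good_sums :: "nat \<Rightarrow> nat \<Rightarrow> (nat \<Rightarrow> complex) \<Rightarrow> real \<Rightarrow> (nat \<Rightarrow> nat \<Rightarrow> complex) \<Rightarrow> (nat \<Rightarrow> complex) \<Rightarrow> bool" where
  "good_sums n m u e a w \<longleftrightarrow>
     (\<Sum>i<m. (cmod (dotc n (a i) w))\<^sup>2) < real m * ((nrm n w)\<^sup>2 + e) \<and>
     real m * ((nrm n w)\<^sup>2 - e) < (\<Sum>i<m. (cmod (dotc n (a i) w))\<^sup>2) \<and>
     (\<Sum>i<m. (Im (cnj (phase (dotc n (a i) u)) * dotc n (a i) w))\<^sup>2)
       < real m * ((Im (dotc n u w))\<^sup>2 + (nrm n w)\<^sup>2 / 2 + e) \<and>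
     (\<Sum>i<m. max 0 ((cmod (dotc n (a i) w))\<^sup>2 - 40)) < real m * (1 / 200000 + e) \<and>
     (\<Sum>i<m. if cmod (dotc n (a i) u) < 1 / 10000 then 1 else 0) < real m * (3 / 10 ^ 8 + e) \<and>
     (\<Sum>i<m. if (cmod (dotc n (a i) u))\<^sup>2 \<le> 9 * (1 + e) then (cmod (dotc n (a i) u))\<^sup>2 * (cmod (dotc n (a i) w))\<^sup>2 else 0)
       < real m * ((cmod (dotc n u w))\<^sup>2 * trunc4 (9 * (1 + e)) + ((nrm n w)\<^sup>2 - (cmod (dotc n u w))\<^sup>2) * trunc2 (9 * (1 + e)) + e) \<and>
     real m * (trunc4 (9 * (1 - e)) - e) < (\<Sum>i<m. if (cmod (dotc n (a i) u))\<^sup>2 \<le> 9 * (1 - e) then (cmod (dotc n (a i) u)) ^ 4 else 0)"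

definition good_rows :: "nat \<Rightarrow> nat \<Rightarrow> (nat \<Rightarrow> complex) \<Rightarrow> (nat \<Rightarrow> complex) set \<Rightarrow> real \<Rightarrow> (nat \<Rightarrow> nat \<Rightarrow> complex) \<Rightarrow> bool" where
  "good_rows n m u W e a \<longleftrightarrow> (\<forall>w\<in>insert u W. good_sums n m u e a w)"

section \<open>Probability of the event on which all row sums are controlled\<close>

lemma integral_le_of_nn_integral:
  fixes f :: "'a \<Rightarrow> real"
  assumes "f \<in> borel_measurable M" "\<And>x. f x \<ge> 0" "(\<integral>\<^sup>+x. ennreal (f x) \<partial>M) \<le> ennreal c" "c \<ge> 0"
  shows "(\<integral>x. f x \<partial>M) \<le> c"
  using assms by (subst integral_eq_nn_integral) (auto intro: enn2real_leI)

lemma integral_eq_of_nn_integral: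
  fixes f :: "'a \<Rightarrow> real"
  assumes "f \<in> borel_measurable M" "\<And>x. f x \<ge> 0" "(\<integral>\<^sup>+x. ennreal (f x) \<partial>M) = ennreal c" "c \<ge> 0"
  shows "(\<integral>x. f x \<partial>M) = c"
  using assms by (subst integral_eq_nn_integral) auto

lemma cmod_dotc_le_nrm: "cmod (dotc n u w) \<le> nrm n u * nrm n w"
proof -
  have "cmod (dotc n u w) \<le> (\<Sum>j<n. cmod (u j) * cmod (w j))"
    unfolding dotc_def by (rule order_trans[OF norm_sum]) (simp add: norm_mult)
  also have "\<dots> \<le> nrm n u * nrm n w"
    unfolding nrm_def using L2_set_mult_ineq[of "\<lambda>j. cmod (u j)" "\<lambda>j. cmod (w j)" "{..<n}"] by simp
  finally show ?thesis .
qed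

lemma expectation_cmod_square:
  assumes u: "nrm n u = 1"
  shows "(\<integral>x. (cmod (dotc n x w))\<^sup>2 \<partial>gvec n) = (nrm n w)\<^sup>2"
proof (rule integral_eq_of_nn_integral)
  have u1: "(\<Sum>j<n. (cmod (u j))\<^sup>2) = 1" using u nrm_power2[of n u] by simp
  have le: "(cmod (dotc n u w))\<^sup>2 \<le> (nrm n w)\<^sup>2"
    using cmod_dotc_le_nrm[of n u w] u by (simp add: power_mono)
  have "(\<integral>\<^sup>+x. ennreal ((cmod (dotc n x w))\<^sup>2) \<partial>gvec n) = 
    ennreal ((cmod (dotc n u w))\<^sup>2) + ennreal ((nrm n w)\<^sup>2 - (cmod (dotc n u w))\<^sup>2)"
    using nn_integral_weighted_square[OF u1, of "\<lambda>_. 1" w] nn_integral_cg_moments(1)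
    by (simp add: nrm_power2)
  also have "\<dots> = ennreal ((nrm n w)\<^sup>2)" using le by (subst ennreal_plus[symmetric]) auto
  finally show "(\<integral>\<^sup>+x. ennreal ((cmod (dotc n x w))\<^sup>2) \<partial>gvec n) = ennreal ((nrm n w)\<^sup>2)" .
qed auto

text \<open>Lower bounds are treated as upper bounds for the negated functions \<open>f2\<close> and
  \<open>f7\<close>. The growth constant 20 covers the truncated products, because their level is
  below \<open>9 * (1 + 1/10)\<close>. At most seven functions and the factor 2 of the union bound
  give 14.\<close>

lemma good_rows_probability:
  assumes e: "0 < e" "e < 1 / 10"
  obtains c M where "c > 0" "M > 0"
    "\<And>n m u. \<lbrakk>real m \<ge> M * real n; nrm n u = 1\<rbrakk> \<Longrightarrow>
       \<exists>W. ball_net n e W \<and>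
         (\<exists>E\<in>sets (sensing_space m n). measure (sensing_space m n) E \<ge> 1 - 14 * exp (- c * real m) \<and>
           (\<forall>\<omega>\<in>E. good_rows n m u W e (\<lambda>i j. \<omega> (i, j))))"
proof (rule uniform_concentration[of 20 e e])
  fix c M :: real assume c: "0 < c" "0 < M" and unif: 
    "\<And>n m u J. \<lbrakk>real m \<ge> M * real n; nrm n u = 1; finite J;
       \<And>f \<mu> w. (f, \<mu>) \<in> J \<Longrightarrow> f \<in> borel_measurable (borel \<Otimes>\<^sub>M borel);
       \<And>f \<mu> a b. (f, \<mu>) \<in> J \<Longrightarrow> \<bar>f (a, b)\<bar> \<le> 20 * (1 + (cmod a)\<^sup>2 + (cmod b)\<^sup>2);
       \<And>f \<mu> w. (f, \<mu>) \<in> J \<Longrightarrow> nrm n w \<le> 1 \<Longrightarrow> (\<integral>x. f (dotc n x u, dotc n x w) \<partial>gvec n) \<le> \<mu> w\<rbrakk> \<Longrightarrow>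
       \<exists>W. ball_net n e W \<and>
         (\<exists>E\<in>sets (sensing_space m n). measure (sensing_space m n) E \<ge> 1 - 2 * real (card J) * exp (- c * real m) \<and>
           (\<forall>\<omega>\<in>E. \<forall>w\<in>insert u W. \<forall>(f, \<mu>)\<in>J.
              (\<Sum>i<m. f (rdot n \<omega> i u, rdot n \<omega> i w)) < real m * (\<mu> w + e)))"
  show thesis
  proof (rule that[OF c])
    fix n m u assume m: "real m \<ge> M * real n" and u: "nrm n u = 1"
    define f1 :: "complex \<times> complex \<Rightarrow> real" where "f1 = (\<lambda>p. (cmod (snd p))\<^sup>2)"
    define f2 :: "complex \<times> complex \<Rightarrow> real" where "f2 = (\<lambda>p. - (cmod (snd p))\<^sup>2)"
    define f3 :: "complex \<times> complex \<Rightarrow> real" where "f3 = (\<lambda>p. (Im (cnj (phase (fst p)) * snd p))\<^sup>2)"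
    define f4 :: "complex \<times> complex \<Rightarrow> real" where "f4 = (\<lambda>p. max 0 ((cmod (snd p))\<^sup>2 - 40))"
    define f5 :: "complex \<times> complex \<Rightarrow> real" where "f5 = (\<lambda>p. if cmod (fst p) < 1 / 10000 then 1 else 0)"
    define f6 :: "complex \<times> complex \<Rightarrow> real" where "f6 = (\<lambda>p. if (cmod (fst p))\<^sup>2 \<le> 9 * (1 + e) then (cmod (fst p))\<^sup>2 * (cmod (snd p))\<^sup>2 else 0)"
    define f7 :: "complex \<times> complex \<Rightarrow> real" where "f7 = (\<lambda>p. - (if (cmod (fst p))\<^sup>2 \<le> 9 * (1 - e) then (cmod (fst p)) ^ 4 else 0))"
    note fdefs = f1_def f2_def f3_def f4_def f5_def f6_def f7_def
    define J where "J = set [(f1, \<lambda>w. (nrm n w)\<^sup>2), (f2, \<lambda>w. - (nrm n w)\<^sup>2), (f3, \<lambda>w. (Im (dotc n u w))\<^sup>2 + (nrm n w)\<^sup>2 / 2),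
      (f4, \<lambda>w. 1 / 200000), (f5, \<lambda>w. 3 / 10 ^ 8),
      (f6, \<lambda>w. (cmod (dotc n u w))\<^sup>2 * trunc4 (9 * (1 + e)) + ((nrm n w)\<^sup>2 - (cmod (dotc n u w))\<^sup>2) * trunc2 (9 * (1 + e))),
      (f7, \<lambda>w. - trunc4 (9 * (1 - e)))]"
    have finJ: "finite J" by (simp add: J_def)
    have u1: "(\<Sum>j<n. (cmod (u j))\<^sup>2) = 1" using u nrm_power2[of n u] by simp
    have cardJ: "card J \<le> 7" unfolding J_def by (rule order_trans[OF card_length]) simp
    have meas: "f \<in> borel_measurable (borel \<Otimes>\<^sub>M borel)" if "(f, \<mu>) \<in> J" for f \<mu>
    proof -
      have "f1 \<in> borel_measurable (borel \<Otimes>\<^sub>M borel)" "f2 \<in> borel_measurable (borel \<Otimes>\<^sub>M borel)"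
        "f3 \<in> borel_measurable (borel \<Otimes>\<^sub>M borel)" "f4 \<in> borel_measurable (borel \<Otimes>\<^sub>M borel)"
        "f5 \<in> borel_measurable (borel \<Otimes>\<^sub>M borel)" "f6 \<in> borel_measurable (borel \<Otimes>\<^sub>M borel)"
        "f7 \<in> borel_measurable (borel \<Otimes>\<^sub>M borel)"
        unfolding fdefs by measurable
      then show ?thesis using that by (auto simp: J_def)
    qed
    have growth: "\<bar>f (a, b)\<bar> \<le> 20 * (1 + (cmod a)\<^sup>2 + (cmod b)\<^sup>2)" if "(f, \<mu>) \<in> J" for f \<mu> a b
    proof -
      have pos: "0 \<le> (cmod a)\<^sup>2" "0 \<le> (cmod b)\<^sup>2" by simp_all
      have 3: "(Im (cnj (phase a) * b))\<^sup>2 \<le> (cmod b)\<^sup>2"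
      proof -
        have "\<bar>Im (cnj (phase a) * b)\<bar> \<le> cmod b"
          using abs_Im_le_cmod[of "cnj (phase a) * b"] by (simp only: norm_mult complex_mod_cnj cmod_phase mult_1)
        then have "\<bar>Im (cnj (phase a) * b)\<bar>\<^sup>2 \<le> (cmod b)\<^sup>2" by (rule power_mono) simp
        then show ?thesis by (simp only: power2_abs)
      qed
      have 6: "(cmod a)\<^sup>2 * (cmod b)\<^sup>2 \<le> 20 * (cmod b)\<^sup>2" if "(cmod a)\<^sup>2 \<le> 9 * (1 + e)"
        by (rule mult_right_mono) (use that e in auto)
      have 7: "(cmod a) ^ 4 \<le> 20 * (cmod a)\<^sup>2" if "(cmod a)\<^sup>2 \<le> 9 * (1 - e)"
      proof -
        have "(cmod a)\<^sup>2 * (cmod a)\<^sup>2 \<le> 20 * (cmod a)\<^sup>2"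
          by (rule mult_right_mono) (use that e in auto)
        then show ?thesis by (simp flip: power_add)
      qed
      have nn: "0 \<le> (Im (cnj (phase a) * b))\<^sup>2" "0 \<le> (cmod a)\<^sup>2 * (cmod b)\<^sup>2" "0 \<le> (cmod a) ^ 4" by simp_all
      have "\<bar>f1 (a, b)\<bar> \<le> 20 + 20 * (cmod a)\<^sup>2 + 20 * (cmod b)\<^sup>2"
        using pos unfolding fdefs fst_conv snd_conv by linarith
      moreover have "\<bar>f2 (a, b)\<bar> \<le> 20 + 20 * (cmod a)\<^sup>2 + 20 * (cmod b)\<^sup>2"
        using pos unfolding fdefs fst_conv snd_conv by linarith
      moreover have "\<bar>f3 (a, b)\<bar> \<le> 20 + 20 * (cmod a)\<^sup>2 + 20 * (cmod b)\<^sup>2"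
        using pos 3 nn(1) unfolding fdefs fst_conv snd_conv by linarith
      moreover have "\<bar>f4 (a, b)\<bar> \<le> 20 + 20 * (cmod a)\<^sup>2 + 20 * (cmod b)\<^sup>2"
        using pos unfolding fdefs fst_conv snd_conv by linarith
      moreover have "\<bar>f5 (a, b)\<bar> \<le> 20 + 20 * (cmod a)\<^sup>2 + 20 * (cmod b)\<^sup>2"
      proof -
        have "\<bar>f5 (a, b)\<bar> \<le> 1" by (simp add: f5_def)
        then show ?thesis using pos by linarith
      qed
      moreover have "\<bar>f6 (a, b)\<bar> \<le> 20 + 20 * (cmod a)\<^sup>2 + 20 * (cmod b)\<^sup>2"
      proof -
        have "\<bar>f6 (a, b)\<bar> \<le> 20 * (cmod b)\<^sup>2" using 6 by (simp add: f6_def abs_mult)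
        then show ?thesis using pos by linarith
      qed
      moreover have "\<bar>f7 (a, b)\<bar> \<le> 20 + 20 * (cmod a)\<^sup>2 + 20 * (cmod b)\<^sup>2"
      proof -
        have "\<bar>f7 (a, b)\<bar> \<le> 20 * (cmod a)\<^sup>2" using 7 by (simp add: f7_def)
        then show ?thesis using pos by linarith
      qed
      ultimately have "\<bar>f (a, b)\<bar> \<le> 20 + 20 * (cmod a)\<^sup>2 + 20 * (cmod b)\<^sup>2"
        using that by (auto simp: J_def)
      then show ?thesis by (simp add: distrib_left)
    qed
    have mean: "(\<integral>x. f (dotc n x u, dotc n x w) \<partial>gvec n) \<le> \<mu> w" if "(f, \<mu>) \<in> J" "nrm n w \<le> 1" for f \<mu> w
    proof -
      have w2: "(\<Sum>j<n. (cmod (w j))\<^sup>2) \<le> 1" using that(2) by (simp add: nrm_le_iff)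
      have 1: "(\<integral>x. f1 (dotc n x u, dotc n x w) \<partial>gvec n) \<le> (nrm n w)\<^sup>2"
        "(\<integral>x. f2 (dotc n x u, dotc n x w) \<partial>gvec n) \<le> - (nrm n w)\<^sup>2"
        unfolding fdefs using expectation_cmod_square[OF u, of w] by simp_all
      have 3: "(\<integral>x. f3 (dotc n x u, dotc n x w) \<partial>gvec n) \<le> (Im (dotc n u w))\<^sup>2 + (nrm n w)\<^sup>2 / 2"
        unfolding fdefs fst_conv snd_conv
        by (rule integral_le_of_nn_integral) (use nn_integral_Im_square[OF u1, of w] in \<open>auto simp: nrm_power2 sum_nonneg\<close>)
      have 4: "(\<integral>x. f4 (dotc n x u, dotc n x w) \<partial>gvec n) \<le> 1 / 200000"
        unfolding fdefs fst_conv snd_conv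
      proof (rule integral_le_of_nn_integral)
        \<comment> \<open>Here \<open>x \<le> exp x\<close> is used at
          \<open>x = (y - 40) / 2\<close>, which reduces the excess to the exponential moment of
          order \<open>1/2\<close>; that moment is at most 2, whence
          \<open>4 * exp (-20)\<close>.\<close>
        have "max 0 (y - 40) \<le> 2 * exp (- 20) * exp (y / 2)" for y :: real
        proof -
          have "(y - 40) / 2 \<le> exp ((y - 40) / 2)" using exp_ge_add_one_self[of "(y - 40) / 2"] by linarith
          also have "\<dots> = exp (-20) * exp (y / 2)" by (simp add: exp_add[symmetric])
          finally show ?thesis by simp
        qed
        then have "(\<integral>\<^sup>+x. ennreal (max 0 ((cmod (dotc n x w))\<^sup>2 - 40)) \<partial>gvec n)
           \<le> (\<integral>\<^sup>+x. ennreal (2 * exp (-20)) * ennreal (exp ((cmod (dotc n x w))\<^sup>2 / 2)) \<partial>gvec n)"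
          by (intro nn_integral_mono) (subst ennreal_mult[symmetric], auto intro!: ennreal_leI)
        also have "\<dots> = ennreal (2 * exp (-20)) * (\<integral>\<^sup>+x. ennreal (exp ((cmod (dotc n x w))\<^sup>2 / 2)) \<partial>gvec n)"
          by (rule nn_integral_cmult) measurable
        also have "\<dots> \<le> ennreal (2 * exp (-20)) * 2"
          by (rule mult_left_mono[OF nn_integral_exp_dotc_le[OF w2]]) simp
        also have "\<dots> = ennreal (2 * exp (-20)) * ennreal 2" by simp
        also have "\<dots> = ennreal (4 * exp (-20))" by (subst ennreal_mult[symmetric]) auto
        also have "\<dots> \<le> ennreal (1 / 200000)"
        proof (rule ennreal_leI)
          have "(2::real) \<le> exp 1" using exp_ge_add_one_self[of 1] by simp
          then have "exp (-1) \<le> (1/2::real)" by (simp add: exp_minus field_simps)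
          then have "exp (-1) ^ 20 \<le> (1/2::real) ^ 20" by (rule power_mono) simp
          moreover have "exp (-1) ^ 20 = exp (-20::real)" by (simp add: exp_of_nat_mult[symmetric])
          ultimately show "4 * exp (-20) \<le> (1 / 200000 :: real)" by (simp add: power_divide)
        qed
        finally show "(\<integral>\<^sup>+x. ennreal (max 0 ((cmod (dotc n x w))\<^sup>2 - 40)) \<partial>gvec n) \<le> ennreal (1 / 200000)" .
      qed auto
      have 5: "(\<integral>x. f5 (dotc n x u, dotc n x w) \<partial>gvec n) \<le> 3 / 10 ^ 8"
        unfolding fdefs fst_conv snd_conv
      proof (rule integral_le_of_nn_integral)
        \<comment> \<open>The indicator is majorised by a Gaussian bump of width
          \<open>1/10000\<close>, whose integral is known explicitly. The result
          \<open>exp 1 / (1 + 10^8)\<close> is of the right order in the radius.\<close>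
        have le: "(if cmod z < 1 / 10000 then 1 else 0) \<le> exp 1 * exp ((- (10 ^ 8)) * (cmod z)\<^sup>2)" for z
        proof (cases "cmod z < 1 / 10000")
          case True
          then have "(cmod z)\<^sup>2 \<le> (1 / 10000)\<^sup>2" by (intro power_mono) auto
          then have "0 \<le> 1 + (- (10 ^ 8)) * (cmod z)\<^sup>2" by (simp add: power_divide)
          then show ?thesis using True by (simp add: exp_add[symmetric])
        qed simp
        have "(\<integral>\<^sup>+x. ennreal (if cmod (dotc n x u) < 1 / 10000 then 1 else 0) \<partial>gvec n) =
          (\<integral>\<^sup>+z. ennreal (if cmod z < 1 / 10000 then 1 else 0) \<partial>cgauss)"
          by (rule nn_integral_dotc_unit[OF u1]) measurable
        also have "\<dots> \<le> (\<integral>\<^sup>+z. ennreal (exp 1) * ennreal (exp ((- (10 ^ 8)) * (cmod z)\<^sup>2)) \<partial>cgauss)"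
          by (intro nn_integral_mono) (subst ennreal_mult[symmetric], simp, simp, rule ennreal_leI, rule le)
        also have "\<dots> = ennreal (exp 1) * (\<integral>\<^sup>+z. ennreal (exp ((- (10 ^ 8)) * (cmod z)\<^sup>2)) \<partial>cgauss)"
          by (rule nn_integral_cmult) measurable
        also have "\<dots> = ennreal (exp 1) * ennreal (1 / (1 - (- (10 ^ 8))))"
          by (subst nn_integral_cg_exp_norm_square) auto
        also have "\<dots> = ennreal (exp 1 * (1 / (1 - (- (10 ^ 8)))))" by (rule ennreal_mult[symmetric]) auto
        also have "\<dots> \<le> ennreal (3 / 10 ^ 8)"
        proof (rule ennreal_leI)
          have "exp 1 * (1 / (1 - (- (10 ^ 8)))) \<le> 3 * (1 / (1 - (- (10 ^ 8))) :: real)"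
            by (rule mult_right_mono[OF exp_le]) simp
          also have "\<dots> \<le> 3 / 10 ^ 8" by simp
          finally show "exp 1 * (1 / (1 - (- (10 ^ 8)))) \<le> (3 / 10 ^ 8 :: real)" .
        qed
        finally show "(\<integral>\<^sup>+x. ennreal (if cmod (dotc n x u) < 1 / 10000 then 1 else 0) \<partial>gvec n) \<le> ennreal (3 / 10 ^ 8)" .
      qed auto
      have le: "(cmod (dotc n u w))\<^sup>2 \<le> (nrm n w)\<^sup>2"
        using cmod_dotc_le_nrm[of n u w] u by (simp add: power_mono)
      let ?\<rho> = "\<lambda>g. if (cmod g)\<^sup>2 \<le> 9 * (1 + e) then (cmod g)\<^sup>2 else 0"
      have 6: "(\<integral>x. f6 (dotc n x u, dotc n x w) \<partial>gvec n) \<le> 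
         (cmod (dotc n u w))\<^sup>2 * trunc4 (9 * (1 + e)) + ((nrm n w)\<^sup>2 - (cmod (dotc n u w))\<^sup>2) * trunc2 (9 * (1 + e))"
        unfolding fdefs fst_conv snd_conv
      proof (rule integral_le_of_nn_integral)
        have "(\<integral>\<^sup>+x. ennreal (if (cmod (dotc n x u))\<^sup>2 \<le> 9 * (1 + e) then (cmod (dotc n x u))\<^sup>2 * (cmod (dotc n x w))\<^sup>2 else 0) \<partial>gvec n)
          = (\<integral>\<^sup>+x. ennreal (?\<rho> (dotc n x u) * (cmod (dotc n x w))\<^sup>2) \<partial>gvec n)"
          by (intro nn_integral_cong) simp
        also have "\<dots> = ennreal ((cmod (dotc n u w))\<^sup>2) * (\<integral>\<^sup>+g. ennreal (?\<rho> g * (cmod g)\<^sup>2) \<partial>cgauss) +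
           ennreal ((nrm n w)\<^sup>2 - (cmod (dotc n u w))\<^sup>2) * (\<integral>\<^sup>+g. ennreal (?\<rho> g) \<partial>cgauss)"
          unfolding nrm_power2
        proof (rule nn_integral_weighted_square[OF u1])
          have "(\<lambda>g :: complex. (cmod g)\<^sup>2) \<in> borel_measurable borel" by measurable
          then show "?\<rho> \<in> borel_measurable borel"
            by (intro measurable_If borel_measurable_pred_less borel_measurable_le) auto
        qed simp
        also have "(\<integral>\<^sup>+g. ennreal (?\<rho> g * (cmod g)\<^sup>2) \<partial>cgauss) = 
            (\<integral>\<^sup>+g. ennreal (if (cmod g)\<^sup>2 \<le> 9 * (1 + e) then (cmod g) ^ 4 else 0) \<partial>cgauss)"
          by (intro nn_integral_cong) (simp flip: power_add)
        also have "\<dots> = ennreal (trunc4 (9 * (1 + e)))" by (rule nn_integral_trunc)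
        also have "(\<integral>\<^sup>+g. ennreal (?\<rho> g) \<partial>cgauss) = ennreal (trunc2 (9 * (1 + e)))" by (rule nn_integral_trunc)
        also have "ennreal ((cmod (dotc n u w))\<^sup>2) * ennreal (trunc4 (9 * (1 + e))) + 
            ennreal ((nrm n w)\<^sup>2 - (cmod (dotc n u w))\<^sup>2) * ennreal (trunc2 (9 * (1 + e))) =
          ennreal ((cmod (dotc n u w))\<^sup>2 * trunc4 (9 * (1 + e)) + ((nrm n w)\<^sup>2 - (cmod (dotc n u w))\<^sup>2) * trunc2 (9 * (1 + e)))"
          using le trunc_nonneg by (subst ennreal_plus) (auto simp: ennreal_mult)
        finally show "(\<integral>\<^sup>+x. ennreal (if (cmod (dotc n x u))\<^sup>2 \<le> 9 * (1 + e) then (cmod (dotc n x u))\<^sup>2 * (cmod (dotc n x w))\<^sup>2 else 0) \<partial>gvec n) \<le>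
          ennreal ((cmod (dotc n u w))\<^sup>2 * trunc4 (9 * (1 + e)) + ((nrm n w)\<^sup>2 - (cmod (dotc n u w))\<^sup>2) * trunc2 (9 * (1 + e)))"
          by simp
      qed (use le trunc_nonneg in auto)
      have 7: "(\<integral>x. f7 (dotc n x u, dotc n x w) \<partial>gvec n) \<le> - trunc4 (9 * (1 - e))"
      proof -
        have "(\<integral>x. (if (cmod (dotc n x u))\<^sup>2 \<le> 9 * (1 - e) then (cmod (dotc n x u)) ^ 4 else 0) \<partial>gvec n) = trunc4 (9 * (1 - e))"
        proof (rule integral_eq_of_nn_integral)
          have "(\<integral>\<^sup>+x. ennreal (if (cmod (dotc n x u))\<^sup>2 \<le> 9 * (1 - e) then (cmod (dotc n x u)) ^ 4 else 0) \<partial>gvec n) =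
             (\<integral>\<^sup>+g. ennreal (if (cmod g)\<^sup>2 \<le> 9 * (1 - e) then (cmod g) ^ 4 else 0) \<partial>cgauss)"
            by (rule nn_integral_dotc_unit[OF u1]) measurable
          also have "\<dots> = ennreal (trunc4 (9 * (1 - e)))" by (rule nn_integral_trunc)
          finally show "(\<integral>\<^sup>+x. ennreal (if (cmod (dotc n x u))\<^sup>2 \<le> 9 * (1 - e) then (cmod (dotc n x u)) ^ 4 else 0) \<partial>gvec n) =
            ennreal (trunc4 (9 * (1 - e)))" .
        qed (use trunc_nonneg in auto)
        then show ?thesis unfolding fdefs fst_conv snd_conv by simp
      qed
      from that(1) 1 3 4 5 6 7 show ?thesis by (auto simp: J_def)
    qed
    have "\<exists>W. ball_net n e W \<and>
         (\<exists>E\<in>sets (sensing_space m n). measure (sensing_space m n) E \<ge> 1 - 2 * real (card J) * exp (- c * real m) \<and>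
           (\<forall>\<omega>\<in>E. \<forall>w\<in>insert u W. \<forall>(f, \<mu>)\<in>J.
              (\<Sum>i<m. f (rdot n \<omega> i u, rdot n \<omega> i w)) < real m * (\<mu> w + e)))"
      by (rule unif[OF m u finJ]) (erule meas, erule growth, erule (1) mean)
    then obtain W E where
      W: "ball_net n e W"
      and E: "E \<in> sets (sensing_space m n)" "measure (sensing_space m n) E \<ge> 1 - 2 * real (card J) * exp (- c * real m)"
      and good0: "\<forall>\<omega>\<in>E. \<forall>w\<in>insert u W. \<forall>(f, \<mu>)\<in>J.
              (\<Sum>i<m. f (rdot n \<omega> i u, rdot n \<omega> i w)) < real m * (\<mu> w + e)"
      by (elim exE conjE bexE)
    have good: "(\<Sum>i<m. f (rdot n \<omega> i u, rdot n \<omega> i w)) < real m * (\<mu> w + e)"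
      if "\<omega> \<in> E" "w \<in> insert u W" "(f, \<mu>) \<in> J" for \<omega> w f \<mu>
      using bspec[OF bspec[OF bspec[OF good0 that(1)] that(2)] that(3)] by simp
    have "2 * real (card J) * exp (- c * real m) \<le> 14 * exp (- c * real m)"
      using cardJ by (intro mult_right_mono) auto
    then have E2: "measure (sensing_space m n) E \<ge> 1 - 14 * exp (- c * real m)" using E(2) by linarith
    have "good_rows n m u W e (\<lambda>i j. \<omega> (i, j))" if \<omega>: "\<omega> \<in> E" for \<omega>
      unfolding good_rows_def
    proof (rule ballI)
      fix w assume w: "w \<in> insert u W"
      note g = good[OF \<omega> w]
      have g1: "(\<Sum>i<m. f1 (rdot n \<omega> i u, rdot n \<omega> i w)) < real m * ((nrm n w)\<^sup>2 + e)"
        by (rule g) (simp add: J_def)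
      have g2: "(\<Sum>i<m. f2 (rdot n \<omega> i u, rdot n \<omega> i w)) < real m * (- (nrm n w)\<^sup>2 + e)"
        by (rule g) (simp add: J_def)
      have g3: "(\<Sum>i<m. f3 (rdot n \<omega> i u, rdot n \<omega> i w)) < real m * ((Im (dotc n u w))\<^sup>2 + (nrm n w)\<^sup>2 / 2 + e)"
        by (rule g) (simp add: J_def)
      have g4: "(\<Sum>i<m. f4 (rdot n \<omega> i u, rdot n \<omega> i w)) < real m * (1 / 200000 + e)"
        by (rule g) (simp add: J_def)
      have g5: "(\<Sum>i<m. f5 (rdot n \<omega> i u, rdot n \<omega> i w)) < real m * (3 / 10 ^ 8 + e)"
        by (rule g) (simp add: J_def)
      have g6: "(\<Sum>i<m. f6 (rdot n \<omega> i u, rdot n \<omega> i w)) < 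
         real m * ((cmod (dotc n u w))\<^sup>2 * trunc4 (9 * (1 + e)) + ((nrm n w)\<^sup>2 - (cmod (dotc n u w))\<^sup>2) * trunc2 (9 * (1 + e)) + e)"
        by (rule g) (simp add: J_def)
      have g7: "(\<Sum>i<m. f7 (rdot n \<omega> i u, rdot n \<omega> i w)) < real m * (- trunc4 (9 * (1 - e)) + e)"
        by (rule g) (simp add: J_def)
      have g2': "real m * ((nrm n w)\<^sup>2 - e) < (\<Sum>i<m. (cmod (rdot n \<omega> i w))\<^sup>2)"
        using g2 by (simp add: f2_def sum_negf algebra_simps)
      have g7': "real m * (trunc4 (9 * (1 - e)) - e) < (\<Sum>i<m. if (cmod (rdot n \<omega> i u))\<^sup>2 \<le> 9 * (1 - e) then (cmod (rdot n \<omega> i u)) ^ 4 else 0)"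
        using g7 unfolding f7_def sum_negf fst_conv by (simp only: algebra_simps)
      show "good_sums n m u e (\<lambda>i j. \<omega> (i, j)) w"
        unfolding good_sums_def
        using g1 g2' g3 g4 g5 g6 g7' unfolding f1_def f3_def f4_def f5_def f6_def fst_conv snd_conv by blast
    qed
    then show "\<exists>W. ball_net n e W \<and>
         (\<exists>E\<in>sets (sensing_space m n). measure (sensing_space m n) E \<ge> 1 - 14 * exp (- c * real m) \<and>
           (\<forall>\<omega>\<in>E. good_rows n m u W e (\<lambda>i j. \<omega> (i, j))))"
      using W E(1) E2 by (intro exI[of _ W] conjI bexI[of _ E]) auto
  qed
qed (use e in auto)

section \<open>Deterministic consequences\<close>

lemma dotc_add: "dotc n a (\<lambda>j. x j + y j) = dotc n a x + dotc n a y"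
  by (simp add: dotc_def distrib_left sum.distrib)

lemma dotc_diff: "dotc n a (\<lambda>j. x j - y j) = dotc n a x - dotc n a y"
  by (simp add: dotc_def right_diff_distrib sum_subtractf)

lemma dotc_scale: "dotc n a (\<lambda>j. c * x j) = c * dotc n a x"
  by (simp add: dotc_def sum_distrib_left mult_ac)

lemma dotc_self: "dotc n v v = of_real ((nrm n v)\<^sup>2)"
  by (simp add: dotc_def nrm_power2 complex_norm_square mult.commute del: of_real_power)

lemma nrm_zero_dotc: "nrm n v = 0 \<Longrightarrow> dotc n a v = 0"
  using cmod_dotc_le_nrm[of n a v] by simp

lemma nrm_diff_lower: "nrm n x - nrm n (\<lambda>j. x j - y j) \<le> nrm n y"
  using nrm_triangle[of n "\<lambda>j. x j - y j" y] by simp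

lemma nrm_normalize:
  assumes "nrm n x \<noteq> 0"
  obtains y where "nrm n y = 1" "x = (\<lambda>j. of_real (nrm n x) * y j)"
proof (rule that)
  show "nrm n (\<lambda>j. of_real (1 / nrm n x) * x j) = 1"
    using assms nrm_scale[of n "of_real (1 / nrm n x)" x] by (simp only: norm_of_real) simp
  show "x = (\<lambda>j. of_real (nrm n x) * (of_real (1 / nrm n x) * x j))"
    using assms by (simp add: mult.assoc[symmetric] flip: of_real_mult)
qed

lemma phase_mult_unit: "cmod p = 1 \<Longrightarrow> z \<noteq> 0 \<Longrightarrow> phase (p * z) = p * phase z"
  by (auto simp: phase_def norm_mult)

text \<open>With \<open>z0\<close> rotated to the positive axis, a perturbation along
  \<open>z0\<close> leaves the phase unchanged, so only the imaginary part counts. For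
  \<open>w = x + i y\<close> of modulus \<open>R\<close> the squared chord is
  \<open>2 * (R - x) / R\<close>, at most \<open>y^2 / x^2\<close> because
  \<open>(R - x) * (R + x) = y^2\<close>; finally \<open>x\<close> is at least \<open>5/6\<close> of
  the modulus of \<open>z0\<close>.\<close>

lemma phase_perturbation:
  assumes le: "6 * cmod z \<le> cmod z0"
  shows "cmod z0 * cmod (phase (z0 + z) - phase z0) \<le> 6 / 5 * \<bar>Im (cnj (phase z0) * z)\<bar>"
proof (cases "z0 = 0")
  case False
  define r where "r = cmod z0"
  define p where "p = phase z0"
  define \<zeta> where "\<zeta> = cnj p * z"
  have r: "r > 0" using False by (simp add: r_def)
  have p: "cmod p = 1" "z0 = p * of_real r" using phase_mult_cmod[of z0] by (simp_all add: p_def r_def)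
  have pp: "p * cnj p = 1" using p(1) complex_norm_square[of p] by simp
  have z: "z = p * \<zeta>" using pp by (simp add: \<zeta>_def mult.assoc[symmetric])
  define w where "w = of_real r + \<zeta>"
  define x y where "x = Re w" and "y = Im w"
  have y: "y = Im \<zeta>" by (simp add: y_def w_def)
  have "\<bar>Re \<zeta>\<bar> \<le> cmod z" using abs_Re_le_cmod[of \<zeta>] p(1) z by (simp add: norm_mult)
  then have x: "5 / 6 * r \<le> x" using le by (simp add: x_def w_def r_def)
  then have x0: "x > 0" using r by linarith
  then have w0: "w \<noteq> 0" by (auto simp: x_def)
  have "phase (z0 + z) = p * phase w"
    using phase_mult_unit[OF p(1) w0] by (simp add: p(2) z w_def distrib_left[symmetric])
  then have "phase (z0 + z) - phase z0 = p * (phase w - 1)"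
    by (simp add: p_def[symmetric] right_diff_distrib)
  then have eq: "cmod (phase (z0 + z) - phase z0) = cmod (phase w - 1)"
    using p(1) by (simp add: norm_mult)
  define R where "R = cmod w"
  have R2: "R\<^sup>2 = x\<^sup>2 + y\<^sup>2" by (simp add: R_def x_def y_def cmod_power2)
  have xR: "x \<le> R" using complex_Re_le_cmod[of w] by (simp add: x_def R_def)
  have R0: "R > 0" using x0 xR by linarith
  have "(cmod (phase w - 1))\<^sup>2 = (x / R - 1)\<^sup>2 + (y / R)\<^sup>2"
    using w0 by (simp add: cmod_power2 phase_def R_def x_def y_def)
  also have "\<dots> = 2 * (R - x) / R"
  proof -
    have "(x / R - 1)\<^sup>2 + (y / R)\<^sup>2 = (x\<^sup>2 + y\<^sup>2 - 2 * x * R + R\<^sup>2) / R\<^sup>2"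
      using R0 by (simp add: power2_eq_square field_simps)
    also have "\<dots> = 2 * (R - x) / R" unfolding R2[symmetric] using R0 by (simp add: power2_eq_square field_simps)
    finally show ?thesis .
  qed
  also have "\<dots> \<le> (y / x)\<^sup>2"
  proof -
    have "(R - x) * (R + x) = y\<^sup>2" using R2 by (simp add: power2_eq_square algebra_simps)
    moreover have "(R - x) * (2 * x) \<le> (R - x) * (R + x)" by (rule mult_left_mono) (use xR in auto)
    ultimately have a: "2 * (R - x) * x \<le> y\<^sup>2" by (simp add: mult_ac)
    have "2 * (R - x) / R \<le> 2 * (R - x) / x"
      by (rule divide_left_mono) (use xR x0 R0 in auto)
    also have "\<dots> = 2 * (R - x) * x / x\<^sup>2" using x0 by (simp add: power2_eq_square)
    also have "\<dots> \<le> y\<^sup>2 / x\<^sup>2" by (rule divide_right_mono[OF a]) simp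
    finally show ?thesis by (simp add: power_divide)
  qed
  finally have "(cmod (phase w - 1))\<^sup>2 \<le> \<bar>y / x\<bar>\<^sup>2" by (simp only: power2_abs)
  then have "cmod (phase w - 1) \<le> \<bar>y / x\<bar>" by (rule power2_le_imp_le) simp
  also have "\<dots> = \<bar>y\<bar> / x" using x0 by simp
  also have "\<dots> \<le> \<bar>y\<bar> / (5 / 6 * r)"
    by (rule divide_left_mono) (use x x0 r in auto)
  finally have "cmod (phase w - 1) * r \<le> 6 / 5 * \<bar>y\<bar>" using r by (simp add: field_simps)
  then show ?thesis unfolding eq y \<zeta>_def p_def r_def by (simp add: mult.commute)
qed simp

text \<open>One realisation of the rows on the good event; no randomness is left. The bounds on
  \<open>e\<close> and on the gap are so small because the spectral estimate has to give an initial
  error of at most \<open>1 / 10^9\<close>; the other estimates would tolerate a much larger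
  \<open>e\<close>.\<close>

locale good_frame =
  fixes n m :: nat and a :: "nat \<Rightarrow> nat \<Rightarrow> complex" and u :: "nat \<Rightarrow> complex" and W :: "(nat \<Rightarrow> complex) set" and e :: real
  assumes m: "m > 0" and u: "nrm n u = 1" and e: "0 < e" "e \<le> 1 / 10 ^ 30"
    and gap: "trunc4 (9 * (1 + e)) - trunc4 (9 * (1 - e)) \<le> 1 / 10 ^ 20"
    and netball: "\<And>w. w \<in> W \<Longrightarrow> nrm n w \<le> 1"
    and net: "\<And>v. nrm n v \<le> 1 \<Longrightarrow> \<exists>w\<in>W. nrm n (\<lambda>j. v j - w j) \<le> e"
    and good: "good_rows n m u W e a"
begin

abbreviation A :: "(nat \<Rightarrow> complex) \<Rightarrow> nat \<Rightarrow> complex" where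
  "A v i \<equiv> dotc n (a i) v"

text \<open>One weighted seminorm serves three purposes: the weight 1 for the whole map, an
  indicator for a set of rows, and the truncated moduli of \<open>A u\<close> for the form of the
  initialisation matrix.\<close>

definition SN :: "(nat \<Rightarrow> real) \<Rightarrow> (nat \<Rightarrow> complex) \<Rightarrow> real" where
  "SN \<rho> v = L2_set (\<lambda>i. \<rho> i * cmod (A v i)) {..<m}"

lemma SN_nonneg [simp]: "SN \<rho> v \<ge> 0"
  by (simp add: SN_def L2_set_nonneg)

lemma SN_power2: "(SN \<rho> v)\<^sup>2 = (\<Sum>i<m. (\<rho> i)\<^sup>2 * (cmod (A v i))\<^sup>2)"
  by (simp add: SN_def L2_set_def sum_nonneg power_mult_distrib)

lemma SN_add:
  assumes "\<And>i. \<rho> i \<ge> 0" shows "SN \<rho> (\<lambda>j. x j + y j) \<le> SN \<rho> x + SN \<rho> y"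
  unfolding SN_def
proof (rule order_trans[OF L2_set_mono L2_set_triangle_ineq])
  show "\<rho> i * cmod (A (\<lambda>j. x j + y j) i) \<le> \<rho> i * cmod (A x i) + \<rho> i * cmod (A y i)" for i
    unfolding dotc_add distrib_left[symmetric] by (rule mult_left_mono[OF norm_triangle_ineq assms])
qed (use assms in auto)

lemma SN_triangle:
  assumes "\<And>i. \<rho> i \<ge> 0" shows "SN \<rho> x \<le> SN \<rho> y + SN \<rho> (\<lambda>j. x j - y j)"
  using SN_add[OF assms, where x=y and y="\<lambda>j. x j - y j"] by simp

lemma SN_scale: "SN \<rho> (\<lambda>j. c * v j) = cmod c * SN \<rho> v"
  unfolding SN_def L2_set_right_distrib[OF norm_ge_zero]
  by (simp add: dotc_scale norm_mult mult_ac)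

lemma SN_le:
  assumes "\<And>i. \<rho> i \<ge> 0" "\<And>i. \<rho> i \<le> K" shows "SN \<rho> v \<le> K * SN (\<lambda>_. 1) v"
proof -
  have "K \<ge> 0" using assms[of 0] by linarith
  then have "K * SN (\<lambda>_. 1) v = L2_set (\<lambda>i. K * (1 * cmod (A v i))) {..<m}"
    by (simp add: SN_def L2_set_right_distrib)
  moreover have "SN \<rho> v \<le> L2_set (\<lambda>i. K * (1 * cmod (A v i))) {..<m}"
    unfolding SN_def by (rule L2_set_mono) (use assms in \<open>auto intro: mult_right_mono\<close>)
  ultimately show ?thesis by simp
qed

lemma sqrt_m: "sqrt (real m) > 0" "(sqrt (real m))\<^sup>2 = real m"
  using m by auto

lemma le_sqrt_m:
  assumes "x\<^sup>2 \<le> real m * c\<^sup>2" "c \<ge> 0" shows "x \<le> c * sqrt (real m)"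
proof -
  have "x\<^sup>2 \<le> (c * sqrt (real m))\<^sup>2" using assms by (simp add: power_mult_distrib mult.commute)
  then show ?thesis by (rule power2_le_imp_le) (simp add: assms(2))
qed

lemma goodD:
  assumes "w \<in> insert u W"
  shows "(\<Sum>i<m. (cmod (A w i))\<^sup>2) < real m * ((nrm n w)\<^sup>2 + e)"
     "real m * ((nrm n w)\<^sup>2 - e) < (\<Sum>i<m. (cmod (A w i))\<^sup>2)"
     "(\<Sum>i<m. (Im (cnj (phase (A u i)) * A w i))\<^sup>2) < real m * ((Im (dotc n u w))\<^sup>2 + (nrm n w)\<^sup>2 / 2 + e)"
     "(\<Sum>i<m. max 0 ((cmod (A w i))\<^sup>2 - 40)) < real m * (1 / 200000 + e)"
     "(\<Sum>i<m. if cmod (A u i) < 1 / 10000 then 1 else 0) < real m * (3 / 10 ^ 8 + e)"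
     "(\<Sum>i<m. if (cmod (A u i))\<^sup>2 \<le> 9 * (1 + e) then (cmod (A u i))\<^sup>2 * (cmod (A w i))\<^sup>2 else 0)
       < real m * ((cmod (dotc n u w))\<^sup>2 * trunc4 (9 * (1 + e)) + ((nrm n w)\<^sup>2 - (cmod (dotc n u w))\<^sup>2) * trunc2 (9 * (1 + e)) + e)"
     "real m * (trunc4 (9 * (1 - e)) - e) < (\<Sum>i<m. if (cmod (A u i))\<^sup>2 \<le> 9 * (1 - e) then (cmod (A u i)) ^ 4 else 0)"
  using good assms unfolding good_rows_def good_sums_def by blast+

text \<open>Bootstrap over the net: the supremum \<open>s\<close> over the unit ball satisfies
  \<open>s \<le> 3/2 * sqrt m + s / 4\<close>, the last term coming from the distance to the net.
  Solving for \<open>s\<close> requires a finite supremum, which the crude Cauchy-Schwarz constant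
  \<open>C\<close> provides.\<close>

lemma SN_upper: "SN (\<lambda>_. 1) v \<le> 2 * sqrt (real m) * nrm n v"
proof -
  let ?N = "SN (\<lambda>_. 1)"
  define C where "C = L2_set (\<lambda>i. nrm n (a i)) {..<m}"
  have C: "?N v \<le> nrm n v * C" for v
  proof -
    have "?N v \<le> L2_set (\<lambda>i. nrm n v * nrm n (a i)) {..<m}"
      unfolding SN_def
    proof (rule L2_set_mono)
      show "1 * cmod (A v i) \<le> nrm n v * nrm n (a i)" for i
        using cmod_dotc_le_nrm[of n "a i" v] by (simp add: mult.commute)
    qed simp
    then show ?thesis by (simp add: C_def L2_set_right_distrib)
  qed
  have C0: "C \<ge> 0" by (simp add: C_def L2_set_nonneg)
  have homog: "?N x \<le> B * nrm n x" if "\<And>v. nrm n v \<le> 1 \<Longrightarrow> ?N v \<le> B" for B x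
  proof (cases "nrm n x = 0")
    case True
    then show ?thesis using C[of x] by simp
  next
    case False
    then obtain y where y: "nrm n y = 1" "x = (\<lambda>j. of_real (nrm n x) * y j)" by (rule nrm_normalize)
    have "?N x = nrm n x * ?N y" by (subst y(2)) (simp add: SN_scale)
    also have "\<dots> \<le> nrm n x * B" by (rule mult_left_mono) (use that[of y] y in auto)
    finally show ?thesis by (simp add: mult.commute)
  qed
  define s where "s = (SUP v\<in>{v. nrm n v \<le> 1}. ?N v)"
  have bdd: "bdd_above (?N ` {v. nrm n v \<le> 1})"
  proof (rule bdd_aboveI2)
    fix v assume "v \<in> {v. nrm n v \<le> 1}"
    then have "nrm n v * C \<le> 1 * C" by (intro mult_right_mono C0) auto
    then show "?N v \<le> C" using C[of v] by simp
  qed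
  have s: "?N v \<le> s" if "nrm n v \<le> 1" for v
    unfolding s_def by (rule cSUP_upper[OF _ bdd]) (use that in auto)
  have s0: "s \<ge> 0" using order_trans[OF SN_nonneg s[of u]] u by simp
  have "s \<le> 3 / 2 * sqrt (real m) + s / 4"
    unfolding s_def
  proof (rule cSUP_least)
    show "{v. nrm n v \<le> 1} \<noteq> {}" using u by (auto intro: exI[of _ u])
    fix v assume "v \<in> {v. nrm n v \<le> 1}"
    then obtain w where w: "w \<in> W" "nrm n (\<lambda>j. v j - w j) \<le> e" using net by blast
    have "(?N w)\<^sup>2 \<le> real m * ((nrm n w)\<^sup>2 + e)"
      using goodD(1)[of w] w by (simp add: SN_power2)
    also have "\<dots> \<le> real m * (3/2)\<^sup>2"
    proof (rule mult_left_mono)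
      have "(nrm n w)\<^sup>2 \<le> 1\<^sup>2" using netball[OF w(1)] by (intro power_mono) auto
      then show "(nrm n w)\<^sup>2 + e \<le> (3/2)\<^sup>2" using e by (simp add: power_divide)
    qed simp
    finally have "?N w \<le> 3/2 * sqrt (real m)" by (rule le_sqrt_m) simp
    moreover have "?N (\<lambda>j. v j - w j) \<le> s / 4"
    proof -
      have "?N (\<lambda>j. v j - w j) \<le> s * nrm n (\<lambda>j. v j - w j)" by (rule homog) (rule s)
      also have "\<dots> \<le> s * (1/4)" by (rule mult_left_mono) (use w e s0 in auto)
      finally show ?thesis by simp
    qed
    ultimately show "?N v \<le> 3 / 2 * sqrt (real m) + (SUP v\<in>{v. nrm n v \<le> 1}. ?N v) / 4"
      using SN_triangle[of "\<lambda>_. 1" v w] unfolding s_def[symmetric] by simp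
  qed
  then have s2: "s \<le> 2 * sqrt (real m)" by simp
  show ?thesis
  proof (rule homog)
    show "?N v \<le> 2 * sqrt (real m)" if "nrm n v \<le> 1" for v using s[OF that] s2 by simp
  qed
qed

lemma SN_net:
  assumes "nrm n (\<lambda>j. v j - w j) \<le> e"
  shows "SN (\<lambda>_. 1) (\<lambda>j. v j - w j) \<le> 2 * e * sqrt (real m)"
proof -
  have "2 * sqrt (real m) * nrm n (\<lambda>j. v j - w j) \<le> 2 * sqrt (real m) * e"
    by (rule mult_left_mono) (use assms in auto)
  then show ?thesis using SN_upper[of "\<lambda>j. v j - w j"] by (simp add: mult_ac)
qed

text \<open>At a net point the lower bound on the sum of squares gives \<open>995/1000\<close>. By
  the upper frame bound, moving from there to the normalised \<open>v\<close> costs at most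
  \<open>2 * e\<close>, less than the remaining \<open>5/1000\<close>.\<close>

lemma SN_lower: "SN (\<lambda>_. 1) v \<ge> 99 / 100 * sqrt (real m) * nrm n v"
proof (cases "nrm n v = 0")
  case False
  let ?N = "SN (\<lambda>_. 1)"
  obtain y where y: "nrm n y = 1" "v = (\<lambda>j. of_real (nrm n v) * y j)" by (rule nrm_normalize[OF False])
  obtain w where w: "w \<in> W" "nrm n (\<lambda>j. y j - w j) \<le> e" using net[of y] y by auto
  have nw: "1 - e \<le> nrm n w" using nrm_diff_lower[of n y w] w y by simp
  have "(995 / 1000 * sqrt (real m))\<^sup>2 \<le> (?N w)\<^sup>2"
  proof -
    have "(1 - e)\<^sup>2 \<le> (nrm n w)\<^sup>2" using nw e by (intro power_mono) auto
    moreover have "(1 - e)\<^sup>2 \<ge> 1 - 2 * e" by (simp add: power2_eq_square algebra_simps)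
    ultimately have "1 - 2 * e \<le> (nrm n w)\<^sup>2" by linarith
    then have "(995 / 1000)\<^sup>2 \<le> (nrm n w)\<^sup>2 - e" using e by (simp add: power_divide)
    then have "real m * (995 / 1000)\<^sup>2 \<le> real m * ((nrm n w)\<^sup>2 - e)" by (rule mult_left_mono) simp
    also have "\<dots> \<le> (?N w)\<^sup>2" using goodD(2)[of w] w by (simp add: SN_power2)
    finally show ?thesis unfolding power_mult_distrib sqrt_m(2) by (simp only: mult.commute)
  qed
  then have "995 / 1000 * sqrt (real m) \<le> ?N w" by (rule power2_le_imp_le) simp
  moreover have "?N w \<le> ?N y + ?N (\<lambda>j. w j - y j)" by (rule SN_triangle) simp
  moreover have "?N (\<lambda>j. w j - y j) = ?N (\<lambda>j. y j - w j)"
    by (simp add: SN_def dotc_diff norm_minus_commute)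
  moreover have "2 * e * sqrt (real m) \<le> 5 / 1000 * sqrt (real m)"
    by (rule mult_right_mono) (use e in auto)
  ultimately have "99 / 100 * sqrt (real m) \<le> ?N y" using SN_net[OF w(2)] by linarith
  then have "nrm n v * (99 / 100 * sqrt (real m)) \<le> nrm n v * ?N y" by (rule mult_left_mono) simp
  also have "\<dots> = ?N v" by (subst (2) y(2)) (simp add: SN_scale)
  finally show ?thesis by (simp add: mult_ac)
qed simp

text \<open>The mean of the squared sum has a term \<open>(Im <u, w>)^2\<close>, which the alignment
  hypothesis eliminates; so the constant only has to exceed \<open>1 / sqrt 2 = 0.70710...\<close>.
  The hypothesis passes to the net point approximately, with an error of at most
  \<open>e\<close>.\<close>

lemma Im_upper:
  assumes im: "Im (dotc n u h) = 0"
  shows "L2_set (\<lambda>i. Im (cnj (phase (A u i)) * A h i)) {..<m} \<le> 7081 / 10000 * sqrt (real m) * nrm n h"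
proof (cases "nrm n h = 0")
  case True
  then show ?thesis by (simp add: nrm_zero_dotc L2_set_def)
next
  case False
  let ?I = "\<lambda>h. L2_set (\<lambda>i. Im (cnj (phase (A u i)) * A h i)) {..<m}"
  obtain y where y: "nrm n y = 1" "h = (\<lambda>j. of_real (nrm n h) * y j)" by (rule nrm_normalize[OF False])
  have "dotc n u h = of_real (nrm n h) * dotc n u y" by (subst y(2)) (simp add: dotc_scale)
  then have imy: "Im (dotc n u y) = 0" using im False by simp
  obtain w where w: "w \<in> W" "nrm n (\<lambda>j. y j - w j) \<le> e" using net[of y] y by auto
  have "\<bar>Im (dotc n u w)\<bar> \<le> e"
  proof -
    have "Im (dotc n u w) = - Im (dotc n u (\<lambda>j. y j - w j))" using imy by (simp add: dotc_diff)
    then have "\<bar>Im (dotc n u w)\<bar> \<le> cmod (dotc n u (\<lambda>j. y j - w j))" using abs_Im_le_cmod by simp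
    also have "\<dots> \<le> e" using cmod_dotc_le_nrm[of n u "\<lambda>j. y j - w j"] u w by simp
    finally show ?thesis .
  qed
  then have "\<bar>Im (dotc n u w)\<bar>\<^sup>2 \<le> e\<^sup>2" by (rule power_mono) simp
  moreover have "e\<^sup>2 \<le> e" using e mult_left_mono[of e 1 e] by (simp add: power2_eq_square)
  ultimately have ime: "(Im (dotc n u w))\<^sup>2 \<le> e" by simp
  have "(nrm n w)\<^sup>2 \<le> 1\<^sup>2" using netball[OF w(1)] by (intro power_mono) auto
  then have "(Im (dotc n u w))\<^sup>2 + (nrm n w)\<^sup>2 / 2 + e \<le> (708 / 1000)\<^sup>2" using ime e by (simp add: power_divide)
  then have "real m * ((Im (dotc n u w))\<^sup>2 + (nrm n w)\<^sup>2 / 2 + e) \<le> real m * (708 / 1000)\<^sup>2"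
    by (rule mult_left_mono) simp
  moreover have "(?I w)\<^sup>2 = (\<Sum>i<m. (Im (cnj (phase (A u i)) * A w i))\<^sup>2)"
    by (simp only: L2_set_def real_sqrt_pow2 sum_nonneg zero_le_power2)
  ultimately have "(?I w)\<^sup>2 \<le> real m * (708 / 1000)\<^sup>2" using goodD(3)[of w] w by simp
  then have Iw: "?I w \<le> 708 / 1000 * sqrt (real m)" by (rule le_sqrt_m) simp
  have "?I y \<le> L2_set (\<lambda>i. \<bar>Im (cnj (phase (A u i)) * A w i)\<bar> + 1 * cmod (A (\<lambda>j. y j - w j) i)) {..<m}"
  proof -
    have "?I y = L2_set (\<lambda>i. \<bar>Im (cnj (phase (A u i)) * A y i)\<bar>) {..<m}" by (simp only: L2_set_def power2_abs)
    also have "\<dots> \<le> L2_set (\<lambda>i. \<bar>Im (cnj (phase (A u i)) * A w i)\<bar> + 1 * cmod (A (\<lambda>j. y j - w j) i)) {..<m}"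
    proof (rule L2_set_mono)
      fix i
      have "cnj (phase (A u i)) * A y i = cnj (phase (A u i)) * A w i + cnj (phase (A u i)) * A (\<lambda>j. y j - w j) i"
        by (simp only: dotc_diff distrib_left[symmetric]) simp
      then have "\<bar>Im (cnj (phase (A u i)) * A y i)\<bar> \<le> \<bar>Im (cnj (phase (A u i)) * A w i)\<bar> + \<bar>Im (cnj (phase (A u i)) * A (\<lambda>j. y j - w j) i)\<bar>"
        by (simp only: plus_complex.simps abs_triangle_ineq)
      also have "\<bar>Im (cnj (phase (A u i)) * A (\<lambda>j. y j - w j) i)\<bar> \<le> cmod (A (\<lambda>j. y j - w j) i)"
        using abs_Im_le_cmod[of "cnj (phase (A u i)) * A (\<lambda>j. y j - w j) i"]
        by (simp only: norm_mult complex_mod_cnj cmod_phase mult_1)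
      finally show "\<bar>Im (cnj (phase (A u i)) * A y i)\<bar> \<le> \<bar>Im (cnj (phase (A u i)) * A w i)\<bar> + 1 * cmod (A (\<lambda>j. y j - w j) i)"
        by simp
    qed simp
    finally show ?thesis .
  qed
  also have "\<dots> \<le> L2_set (\<lambda>i. \<bar>Im (cnj (phase (A u i)) * A w i)\<bar>) {..<m} + SN (\<lambda>_. 1) (\<lambda>j. y j - w j)"
    unfolding SN_def by (rule L2_set_triangle_ineq)
  also have "L2_set (\<lambda>i. \<bar>Im (cnj (phase (A u i)) * A w i)\<bar>) {..<m} = ?I w"
    by (simp only: L2_set_def power2_abs)
  also have "?I w + SN (\<lambda>_. 1) (\<lambda>j. y j - w j) \<le> 708 / 1000 * sqrt (real m) + 2 * e * sqrt (real m)"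
    using Iw SN_net[OF w(2)] by linarith
  also have "\<dots> \<le> 7081 / 10000 * sqrt (real m)"
  proof -
    have "2 * e * sqrt (real m) \<le> 1 / 10000 * sqrt (real m)" by (rule mult_right_mono) (use e in auto)
    then show ?thesis by linarith
  qed
  finally have "nrm n h * ?I y \<le> nrm n h * (7081 / 10000 * sqrt (real m))" by (rule mult_left_mono) simp
  moreover have "?I h = nrm n h * ?I y"
  proof -
    have "A h i = of_real (nrm n h) * A y i" for i by (subst y(2)) (simp add: dotc_scale)
    then have "Im (cnj (phase (A u i)) * A h i) = nrm n h * Im (cnj (phase (A u i)) * A y i)" for i
      by (simp add: algebra_simps)
    then show ?thesis by (simp only: L2_set_right_distrib nrm_nonneg)
  qed
  ultimately show ?thesis by (simp add: mult_ac)
qed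

text \<open>The set \<open>S\<close> will depend on \<open>h\<close>, so all small sets are treated
  at once, and without a union bound over sets: a row in \<open>S\<close> contributes at most 40
  plus its excess over 40, and the sum of all excesses is small at every net point. Numerically,
  \<open>40 / 10^7 + 1/200000 + e\<close> is below \<open>(32/10000)^2\<close>.\<close>

lemma subset_upper:
  assumes S: "S \<subseteq> {..<m}" "real (card S) \<le> real m / 10 ^ 7"
  shows "SN (indicator S) h \<le> 33 / 10000 * sqrt (real m) * nrm n h"
proof (cases "nrm n h = 0")
  case True
  then show ?thesis by (simp add: nrm_zero_dotc L2_set_def SN_def)
next
  case False
  obtain y where y: "nrm n y = 1" "h = (\<lambda>j. of_real (nrm n h) * y j)" by (rule nrm_normalize[OF False])
  obtain w where w: "w \<in> W" "nrm n (\<lambda>j. y j - w j) \<le> e" using net[of y] y by auto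
  have finS: "finite S" using S finite_subset by blast
  have "(SN (indicator S) w)\<^sup>2 = (\<Sum>i<m. (indicator S i)\<^sup>2 * (cmod (A w i))\<^sup>2)" by (rule SN_power2)
  also have "\<dots> \<le> (\<Sum>i<m. 40 * indicator S i + max 0 ((cmod (A w i))\<^sup>2 - 40))"
    by (rule sum_mono) (auto simp: indicator_def)
  also have "\<dots> = 40 * real (card S) + (\<Sum>i<m. max 0 ((cmod (A w i))\<^sup>2 - 40))"
    using S by (simp add: sum.distrib sum_distrib_left[symmetric] sum.If_cases indicator_def Int_absorb1 Int_absorb2)
  also have "\<dots> \<le> 40 * (real m / 10 ^ 7) + real m * (1 / 200000 + e)"
    using S(2) goodD(4)[of w] w by (intro add_mono mult_left_mono) auto
  also have "\<dots> = real m * (40 / 10 ^ 7 + 1 / 200000 + e)" by (simp add: algebra_simps)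
  also have "\<dots> \<le> real m * (32 / 10000)\<^sup>2"
    by (rule mult_left_mono) (use e in \<open>auto simp: power_divide\<close>)
  finally have Sw: "SN (indicator S) w \<le> 32 / 10000 * sqrt (real m)" by (rule le_sqrt_m) simp
  have "SN (indicator S) y \<le> SN (indicator S) w + SN (indicator S) (\<lambda>j. y j - w j)" by (rule SN_triangle) simp
  moreover have "SN (indicator S) (\<lambda>j. y j - w j) \<le> 1 * SN (\<lambda>_. 1) (\<lambda>j. y j - w j)"
    by (rule SN_le) (auto simp: indicator_def)
  moreover have "2 * e * sqrt (real m) \<le> 1 / 10000 * sqrt (real m)" by (rule mult_right_mono) (use e in auto)
  ultimately have "SN (indicator S) y \<le> 33 / 10000 * sqrt (real m)"
    using Sw SN_net[OF w(2)] by linarith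
  then have "nrm n h * SN (indicator S) y \<le> nrm n h * (33 / 10000 * sqrt (real m))" by (rule mult_left_mono) simp
  moreover have "SN (indicator S) h = nrm n h * SN (indicator S) y" by (subst y(2)) (simp add: SN_scale)
  ultimately show ?thesis by (simp add: mult_ac)
qed

end

text \<open>The distance from \<open>x\<close> to the circle of multiples \<open>c * u\<close> is
  smallest when \<open>Re (cnj c * <u, x>)\<close> is largest, that is, when \<open>c\<close> is the
  phase of \<open><u, x>\<close>.\<close>

lemma nrm_diff_unit_power2:
  assumes "cmod c = 1"
  shows "(nrm n (\<lambda>j. x j - c * u j))\<^sup>2 = (nrm n x)\<^sup>2 + (nrm n u)\<^sup>2 - 2 * Re (cnj c * dotc n u x)"
proof -
  have "(cmod (x j - c * u j))\<^sup>2 = (cmod (x j))\<^sup>2 + (cmod (u j))\<^sup>2 - 2 * Re (cnj c * (cnj (u j) * x j))" for j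
  proof -
    have "(cmod (x j - c * u j))\<^sup>2 = (cmod (x j))\<^sup>2 + (cmod (c * u j))\<^sup>2 - 2 * Re (cnj c * (cnj (u j) * x j))"
      unfolding cmod_power2 by (simp add: power2_eq_square algebra_simps)
    then show ?thesis using assms by (simp add: norm_mult)
  qed
  then show ?thesis
    by (simp add: nrm_power2 dotc_def sum.distrib sum_subtractf sum_distrib_left)
qed

section \<open>Local contraction and accuracy of the initial vector on the good event\<close>

context good_frame
begin

text \<open>On \<open>S\<close>, the rows where \<open>A h\<close> is not small against
  \<open>A u\<close>, the trivial bound \<open>2 * cmod (A u i)\<close> is already at most
  \<open>12 * cmod (A h i)\<close>, and \<open>S\<close> is small enough for the estimate on sets of
  rows. The remaining rows are governed by the phase perturbation and hence by the imaginary part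
  alone.\<close>

lemma contraction:
  assumes h: "nrm n h \<le> 1 / 10 ^ 9" and im: "Im (dotc n u h) = 0" and k: "cmod k = 1"
    and y: "\<And>i. y i = of_real (cmod (A u i)) * phase (k * (A u i + A h i))"
  shows "L2_set (\<lambda>i. cmod (y i - k * A u i)) {..<m} \<le> 9 / 10 * sqrt (real m) * nrm n h"
proof -
  define S where "S = {i \<in> {..<m}. cmod (A u i) < 6 * cmod (A h i)}"
  let ?im = "\<lambda>i. Im (cnj (phase (A u i)) * A h i)"
  have pt: "cmod (y i - k * A u i) \<le> 12 * (indicator S i * cmod (A h i)) + 6 / 5 * \<bar>?im i\<bar>" if "i < m" for i
  proof (cases "i \<in> S")
    case True
    have "cmod (y i - k * A u i) \<le> cmod (y i) + cmod (k * A u i)" by (rule norm_triangle_ineq4)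
    also have "\<dots> = 2 * cmod (A u i)" using k by (simp add: y norm_mult)
    also have "\<dots> \<le> 12 * (indicator S i * cmod (A h i))" using True by (simp add: S_def)
    finally show ?thesis using abs_ge_zero[of "?im i"] by linarith
  next
    case False
    then have le: "6 * cmod (A h i) \<le> cmod (A u i)" using that by (simp add: S_def)
    show ?thesis
    proof (cases "A u i = 0")
      case True
      then show ?thesis by (simp add: y)
    next
      case ne: False
      \<comment> \<open>The factor \<open>k\<close> can be pulled out of \<open>phase\<close> only
        at nonzero arguments; at 0 the default value 1 is not equivariant.\<close>
      have "A u i + A h i \<noteq> 0"
      proof
        assume "A u i + A h i = 0"
        then have "cmod (A u i) = cmod (A h i)" by (metis add_eq_0_iff norm_minus_cancel)
        then show False using le ne by simp
      qed
      then have "y i = k * (of_real (cmod (A u i)) * phase (A u i + A h i))"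
        by (simp add: y phase_mult_unit[OF k])
      moreover have "k * A u i = k * (of_real (cmod (A u i)) * phase (A u i))"
        using phase_mult_cmod[of "A u i"] by (simp only: mult.commute)
      ultimately have "y i - k * A u i = k * (of_real (cmod (A u i)) * (phase (A u i + A h i) - phase (A u i)))"
        by (simp only: right_diff_distrib)
      then have "cmod (y i - k * A u i) = cmod (A u i) * cmod (phase (A u i + A h i) - phase (A u i))"
        using k by (simp only: norm_mult norm_of_real abs_norm_cancel mult_1)
      also have "\<dots> \<le> 6 / 5 * \<bar>?im i\<bar>" by (rule phase_perturbation[OF le])
      finally show ?thesis using False by simp
    qed
  qed
  have cardS: "real (card S) \<le> real m / 10 ^ 7"
  proof -
    \<comment> \<open>A row lies in \<open>S\<close> only if \<open>A u i\<close> is below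
      \<open>1/10000\<close>, which is rare on the good event, or \<open>A h i\<close> is at least a
      sixth of that, which is rare by Markov's inequality:
      \<open>4 * 10^(-18) * 60000^2 = 144 / 10^10\<close>. Here the smallness of \<open>h\<close>
      enters.\<close>
    define S1 where "S1 = {i \<in> {..<m}. cmod (A u i) < 1 / 10000}"
    define S2 where "S2 = {i \<in> {..<m}. 1 / 60000 \<le> cmod (A h i)}"
    have "S \<subseteq> S1 \<union> S2" by (auto simp: S_def S1_def S2_def)
    then have "card S \<le> card S1 + card S2"
      by (rule order_trans[OF card_mono card_Un_le, rotated]) (auto simp: S1_def S2_def)
    moreover have "real (card S1) \<le> real m * (3 / 10 ^ 8 + e)"
    proof -
      have "(\<Sum>i<m. if cmod (A u i) < 1 / 10000 then 1 else 0) = real (card S1)"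
        by (simp add: sum.If_cases S1_def Collect_conj_eq lessThan_def)
      then show ?thesis using goodD(5)[of u] by simp
    qed
    moreover have "real (card S2) \<le> real m * (144 / 10 ^ 10)"
    proof -
      have "real (card S2) * (1 / 60000)\<^sup>2 = (\<Sum>i\<in>S2. (1 / 60000)\<^sup>2)" by simp
      also have "\<dots> \<le> (\<Sum>i\<in>S2. (cmod (A h i))\<^sup>2)"
        by (rule sum_mono, rule power_mono) (auto simp: S2_def)
      also have "\<dots> \<le> (\<Sum>i<m. (cmod (A h i))\<^sup>2)"
        by (rule sum_mono2) (auto simp: S2_def)
      also have "\<dots> = (SN (\<lambda>_. 1) h)\<^sup>2" by (simp add: SN_power2)
      also have "\<dots> \<le> (2 * sqrt (real m) * nrm n h)\<^sup>2" by (rule power_mono[OF SN_upper]) simp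
      also have "\<dots> = 4 * real m * (nrm n h)\<^sup>2" by (simp add: power_mult_distrib)
      also have "\<dots> \<le> 4 * real m * (1 / 10 ^ 9)\<^sup>2"
        by (rule mult_left_mono[OF power_mono[OF h]]) auto
      finally show ?thesis by (simp add: power_divide field_simps)
    qed
    ultimately have "real (card S) \<le> real m * (3 / 10 ^ 8 + e) + real m * (144 / 10 ^ 10)" by linarith
    also have "\<dots> = real m * (3 / 10 ^ 8 + e + 144 / 10 ^ 10)" by (simp add: distrib_left)
    also have "\<dots> \<le> real m * (1 / 10 ^ 7)"
      by (rule mult_left_mono) (use e in auto)
    finally show ?thesis by simp
  qed
  have "L2_set (\<lambda>i. cmod (y i - k * A u i)) {..<m} \<le> L2_set (\<lambda>i. 12 * (indicator S i * cmod (A h i)) + 6 / 5 * \<bar>?im i\<bar>) {..<m}"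
    by (rule L2_set_mono) (use pt in auto)
  also have "\<dots> \<le> L2_set (\<lambda>i. 12 * (indicator S i * cmod (A h i))) {..<m} + L2_set (\<lambda>i. 6 / 5 * \<bar>?im i\<bar>) {..<m}"
    by (rule L2_set_triangle_ineq)
  also have "L2_set (\<lambda>i. 12 * (indicator S i * cmod (A h i))) {..<m} = 12 * SN (indicator S) h"
    unfolding SN_def by (rule L2_set_right_distrib[symmetric]) simp
  also have "L2_set (\<lambda>i. 6 / 5 * \<bar>?im i\<bar>) {..<m} = 6 / 5 * L2_set (\<lambda>i. \<bar>?im i\<bar>) {..<m}"
    by (rule L2_set_right_distrib[symmetric]) simp
  also have "L2_set (\<lambda>i. \<bar>?im i\<bar>) {..<m} = L2_set ?im {..<m}"
    by (simp only: L2_set_def power2_abs)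
  also have "12 * SN (indicator S) h + 6 / 5 * L2_set ?im {..<m} \<le>
     12 * (33 / 10000 * sqrt (real m) * nrm n h) + 6 / 5 * (7081 / 10000 * sqrt (real m) * nrm n h)"
    by (intro add_mono mult_left_mono subset_upper Im_upper cardS im) (auto simp: S_def)
  also have "\<dots> \<le> 9 / 10 * sqrt (real m) * nrm n h"
  proof -
    have "0 \<le> sqrt (real m) * nrm n h" by simp
    then show ?thesis by (simp add: mult.assoc)
  qed
  finally show ?thesis .
qed

text \<open>The new phase \<open>k\<close> is that of \<open><u, x>\<close>: it makes
  \<open><u, h>\<close> real and cannot increase the distance. By the least-squares hypothesis
  \<open>A x'\<close> is no farther from \<open>k * A u\<close> than the data with the phases of
  \<open>A x\<close>; the lower frame bound then turns \<open>9/10\<close> into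
  \<open>10/11 < 19/20\<close>. The phase may change from step to step, since only the distance to
  the whole circle matters.\<close>

lemma step:
  assumes near: "nrm n (\<lambda>j. x j - cis \<phi> * u j) \<le> 1 / 10 ^ 9"
    and ls: "\<And>v. L2_set (\<lambda>i. cmod (A x' i - A v i)) {..<m} \<le> 
       L2_set (\<lambda>i. cmod (of_real (cmod (A u i)) * phase (A x i) - A v i)) {..<m}"
  obtains \<phi>' where "nrm n (\<lambda>j. x' j - cis \<phi>' * u j) \<le> 19 / 20 * nrm n (\<lambda>j. x j - cis \<phi> * u j)"
proof -
  define d where "d = dotc n u x"
  define \<phi>' where "\<phi>' = Arg d"
  define k where "k = cis \<phi>'"
  have k: "cmod k = 1" "cnj k * k = 1" "k * cnj k = 1" by (simp_all add: k_def cis_cnj cis_mult)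
  have dk: "d = of_real (cmod d) * k" unfolding k_def \<phi>'_def by (simp add: rcis_cmod_Arg flip: rcis_def)
  have kd: "cnj k * d = of_real (cmod d)"
    by (subst dk) (simp add: mult.left_commute[of "cnj k"] k)
  define h where "h = (\<lambda>j. cnj k * x j - u j)"
  have h_eq: "h = (\<lambda>j. cnj k * (x j - k * u j))"
    using k by (simp add: h_def right_diff_distrib mult.assoc[symmetric])
  have nh: "nrm n h = nrm n (\<lambda>j. x j - k * u j)"
    unfolding h_eq nrm_scale using k by simp
  have "(nrm n h)\<^sup>2 \<le> (nrm n (\<lambda>j. x j - cis \<phi> * u j))\<^sup>2"
  proof -
    have "Re (cnj (cis \<phi>) * d) \<le> cmod (cnj (cis \<phi>) * d)" by (rule complex_Re_le_cmod)
    also have "\<dots> = Re (cnj k * d)" by (simp add: kd norm_mult)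
    finally show ?thesis
      unfolding nh nrm_diff_unit_power2[OF k(1)] nrm_diff_unit_power2[OF norm_cis] by (simp add: d_def)
  qed
  then have hle: "nrm n h \<le> nrm n (\<lambda>j. x j - cis \<phi> * u j)" by (rule power2_le_imp_le) simp
  have "dotc n u h = cnj k * d - of_real 1"
    unfolding h_def dotc_diff dotc_scale d_def[symmetric] dotc_self u by simp
  then have im: "Im (dotc n u h) = 0" by (simp add: kd)
  have Ax: "k * (A u i + A h i) = A x i" for i
    using k by (simp add: h_def dotc_diff dotc_scale mult.assoc[symmetric])
  have "99 / 100 * sqrt (real m) * nrm n (\<lambda>j. x' j - k * u j) \<le> SN (\<lambda>_. 1) (\<lambda>j. x' j - k * u j)"
    by (rule SN_lower)
  also have "\<dots> = L2_set (\<lambda>i. cmod (A x' i - A (\<lambda>j. k * u j) i)) {..<m}"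
    by (simp add: SN_def dotc_diff)
  also have "\<dots> \<le> L2_set (\<lambda>i. cmod (of_real (cmod (A u i)) * phase (A x i) - A (\<lambda>j. k * u j) i)) {..<m}"
    by (rule ls)
  also have "\<dots> = L2_set (\<lambda>i. cmod (of_real (cmod (A u i)) * phase (k * (A u i + A h i)) - k * A u i)) {..<m}"
    by (simp only: Ax dotc_scale)
  also have "\<dots> \<le> 9 / 10 * sqrt (real m) * nrm n h"
    by (rule contraction[OF order_trans[OF hle near] im k(1) refl])
  finally have "sqrt (real m) * (99 / 100 * nrm n (\<lambda>j. x' j - k * u j)) \<le> sqrt (real m) * (9 / 10 * nrm n h)"
    by (simp only: mult_ac)
  then have "99 / 100 * nrm n (\<lambda>j. x' j - k * u j) \<le> 9 / 10 * nrm n h"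
    by (rule mult_left_le_imp_le) (rule sqrt_m(1))
  then have "nrm n (\<lambda>j. x' j - cis \<phi>' * u j) \<le> 19 / 20 * nrm n (\<lambda>j. x j - cis \<phi> * u j)"
    using hle nrm_nonneg[of n h] unfolding k_def by linarith
  then show ?thesis by (rule that)
qed

text \<open>Only the comparison \<open>top\<close> of the form at \<open>u\<close> and at
  \<open>z\<close> is used, not closeness of the whole matrix to its mean. The form at
  \<open>u\<close> is bounded below with the smaller level and the form at \<open>z\<close> above
  with the larger one. This bounds \<open>(1 - B^2) * (P - Q)\<close> by \<open>P - P'\<close> up to
  a multiple of \<open>e\<close>, and the gap \<open>P - Q \<ge> 1/4\<close> forces \<open>B\<close>
  close to 1.\<close>

lemma spectral_init:
  fixes z :: "nat \<Rightarrow> complex"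
  defines "thr \<equiv> 9 / real m * (\<Sum>l<m. (cmod (A u l))\<^sup>2)"
  assumes z: "nrm n z = 1"
    and top: "(\<Sum>i<m. if (cmod (A u i))\<^sup>2 \<le> thr then (cmod (A u i))\<^sup>2 * (cmod (A u i))\<^sup>2 else 0) \<le>
       (\<Sum>i<m. if (cmod (A u i))\<^sup>2 \<le> thr then (cmod (A u i))\<^sup>2 * (cmod (A z i))\<^sup>2 else 0)"
  obtains \<phi> where "nrm n (\<lambda>j. z j - cis \<phi> * u j) \<le> 1 / 10 ^ 9"
proof -
  let ?t = "\<lambda>i. (cmod (A u i))\<^sup>2"
  let ?P = "trunc4 (9 * (1 + e))" and ?Q = "trunc2 (9 * (1 + e))" and ?P' = "trunc4 (9 * (1 - e))"
  define \<rho> where "\<rho> = (\<lambda>i. if ?t i \<le> 9 * (1 + e) then cmod (A u i) else 0)"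
  have thr: "thr \<le> 9 * (1 + e)" "9 * (1 - e) \<le> thr"
  proof -
    have "(\<Sum>l<m. ?t l) \<le> real m * (1 + e)" "real m * (1 - e) \<le> (\<Sum>l<m. ?t l)"
      using goodD(1,2)[of u] u by simp_all
    then have "9 / real m * (\<Sum>l<m. ?t l) \<le> 9 / real m * (real m * (1 + e))"
      "9 / real m * (real m * (1 - e)) \<le> 9 / real m * (\<Sum>l<m. ?t l)"
      by (intro mult_left_mono; simp)+
    then show "thr \<le> 9 * (1 + e)" "9 * (1 - e) \<le> thr" using m by (simp_all add: thr_def)
  qed
  have \<rho>2: "(\<rho> i)\<^sup>2 * c = (if ?t i \<le> 9 * (1 + e) then ?t i * c else 0)" for i c
    by (simp add: \<rho>_def)
  have \<rho>0: "\<rho> i \<ge> 0" for i by (simp add: \<rho>_def)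
  have \<rho>4: "\<rho> i \<le> 4" for i
  proof (cases "?t i \<le> 9 * (1 + e)")
    case True
    moreover have "9 * (1 + e) \<le> 4\<^sup>2" using e by simp
    ultimately have "?t i \<le> 4\<^sup>2" by linarith
    then have "cmod (A u i) \<le> 4" by (rule power2_le_imp_le) simp
    then show ?thesis by (simp add: \<rho>_def)
  qed (simp add: \<rho>_def)
  have "real m * (?P' - e) < (\<Sum>i<m. if ?t i \<le> 9 * (1 - e) then (cmod (A u i)) ^ 4 else 0)"
    using goodD(7)[of u] by simp
  also have "\<dots> \<le> (\<Sum>i<m. if ?t i \<le> thr then ?t i * ?t i else 0)"
    by (rule sum_mono) (use thr(2) in \<open>auto simp flip: power_add\<close>)
  also note top
  also have "(\<Sum>i<m. if ?t i \<le> thr then ?t i * (cmod (A z i))\<^sup>2 else 0) \<le> (\<Sum>i<m. (\<rho> i)\<^sup>2 * (cmod (A z i))\<^sup>2)"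
    unfolding \<rho>2 by (rule sum_mono) (use thr(1) in auto)
  also have "\<dots> = (SN \<rho> z)\<^sup>2" by (rule SN_power2[symmetric])
  finally have low: "real m * (?P' - e) < (SN \<rho> z)\<^sup>2" .
  obtain w where w: "w \<in> W" "nrm n (\<lambda>j. z j - w j) \<le> e" using net[of z] z by auto
  define B where "B = cmod (dotc n u z)"
  \<comment> \<open>\<open>X\<close> bounds the form at the net point \<open>w\<close>, divided by
    \<open>m\<close>: passing from \<open>B\<close> to \<open>cmod <u, w>\<close> costs
    \<open>3 * e * (P - Q)\<close>, hence at most \<open>6 * e\<close>, and the deviation from the
    mean adds another \<open>e\<close>.\<close>
  define X where "X = ?Q + B\<^sup>2 * (?P - ?Q) + 7 * e"
  have gap8: "1 / 4 \<le> ?P - ?Q" by (rule trunc_gap) (use e in simp)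
  have P2: "?P \<le> 2" by (rule trunc4_le)
  have Q0: "?Q \<ge> 0" by (rule trunc_nonneg)
  have B0: "B \<ge> 0" by (simp add: B_def)
  have B1: "B \<le> 1" using cmod_dotc_le_nrm[of n u z] u z by (simp add: B_def)
  have Xle: "X \<le> 4"
  proof -
    have "B\<^sup>2 \<le> 1" using B0 B1 by (simp add: power_le_one)
    then have "B\<^sup>2 * (?P - ?Q) \<le> 1 * (?P - ?Q)" by (rule mult_right_mono) (use gap8 in simp)
    then show ?thesis unfolding X_def using P2 e by simp
  qed
  have X0: "X \<ge> 0" unfolding X_def using Q0 gap8 e by simp
  have "(SN \<rho> w)\<^sup>2 \<le> real m * X"
  proof -
    define b where "b = cmod (dotc n u w)"
    define N where "N = (nrm n w)\<^sup>2"
    have N1: "N \<le> 1" unfolding N_def using netball[OF w(1)] by (simp add: power_le_one)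
    have "b \<le> B + e"
    proof -
      have "dotc n u w = dotc n u z - dotc n u (\<lambda>j. z j - w j)" by (simp add: dotc_diff)
      then have "b \<le> B + cmod (dotc n u (\<lambda>j. z j - w j))"
        unfolding b_def B_def by (metis norm_triangle_ineq4)
      also have "cmod (dotc n u (\<lambda>j. z j - w j)) \<le> e"
        using cmod_dotc_le_nrm[of n u "\<lambda>j. z j - w j"] u w by simp
      finally show ?thesis by simp
    qed
    then have "b\<^sup>2 \<le> (B + e)\<^sup>2" by (rule power_mono) (simp add: b_def)
    also have "\<dots> = B\<^sup>2 + 2 * (B * e) + e * e" by (simp add: power2_eq_square algebra_simps)
    also have "\<dots> \<le> B\<^sup>2 + 2 * e + e"
    proof -
      have "B * e \<le> 1 * e" by (rule mult_right_mono[OF B1]) (use e in simp)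
      moreover have "e * e \<le> 1 * e" by (rule mult_right_mono) (use e in simp_all)
      ultimately show ?thesis by simp
    qed
    finally have b2: "b\<^sup>2 \<le> B\<^sup>2 + 3 * e" by simp
    have "b\<^sup>2 * ?P + (N - b\<^sup>2) * ?Q + e = N * ?Q + b\<^sup>2 * (?P - ?Q) + e" by (simp add: algebra_simps)
    also have "\<dots> \<le> 1 * ?Q + (B\<^sup>2 + 3 * e) * (?P - ?Q) + e"
      by (intro add_mono mult_right_mono N1 b2 Q0 order_refl) (use gap8 in simp)
    also have "\<dots> \<le> X"
    proof -
      have "(3 * e) * (?P - ?Q) \<le> (3 * e) * 2" by (rule mult_left_mono) (use P2 Q0 e in auto)
      then show ?thesis by (simp add: X_def distrib_right)
    qed
    finally have le: "b\<^sup>2 * ?P + (N - b\<^sup>2) * ?Q + e \<le> X" .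
    have "(SN \<rho> w)\<^sup>2 \<le> real m * (b\<^sup>2 * ?P + (N - b\<^sup>2) * ?Q + e)"
      unfolding SN_power2 \<rho>2 b_def N_def using goodD(6)[of w] w by simp
    also have "\<dots> \<le> real m * X" by (rule mult_left_mono[OF le]) simp
    finally show ?thesis .
  qed
  then have Sw: "SN \<rho> w \<le> sqrt X * sqrt (real m)"
    using X0 by (intro le_sqrt_m) simp_all
  have "SN \<rho> (\<lambda>j. z j - w j) \<le> 4 * SN (\<lambda>_. 1) (\<lambda>j. z j - w j)" by (rule SN_le[OF \<rho>0 \<rho>4])
  then have "SN \<rho> z \<le> sqrt X * sqrt (real m) + 8 * e * sqrt (real m)"
    using SN_triangle[of \<rho> z w, OF \<rho>0] Sw SN_net[OF w(2)] by linarith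
  also have "\<dots> = (sqrt X + 8 * e) * sqrt (real m)" by (simp add: distrib_right)
  finally have "(SN \<rho> z)\<^sup>2 \<le> ((sqrt X + 8 * e) * sqrt (real m))\<^sup>2" by (rule power_mono) simp
  also have "\<dots> = real m * (X + 16 * (sqrt X * e) + 64 * (e * e))"
    using X0 by (simp add: power_mult_distrib) (simp add: power2_eq_square algebra_simps)
  \<comment> \<open>\<open>96 = 16 * 2 + 64\<close>, by \<open>sqrt X \<le> 2\<close> and
    \<open>e * e \<le> e\<close>.\<close>
  also have "\<dots> \<le> real m * (X + 96 * e)"
  proof (rule mult_left_mono)
    have "sqrt X \<le> sqrt 4" using Xle by (rule real_sqrt_le_mono)
    then have "sqrt X * e \<le> 2 * e" using e by (intro mult_right_mono) auto
    moreover have "e * e \<le> 1 * e" by (rule mult_right_mono) (use e in simp_all)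
    ultimately show "X + 16 * (sqrt X * e) + 64 * (e * e) \<le> X + 96 * e" by simp
  qed simp
  finally have "real m * (?P' - e) < real m * (X + 96 * e)" using low by linarith
  then have "?P' - e < X + 96 * e" using m by simp
  \<comment> \<open>The errors add up to \<open>1 + 7 + 96 = 104\<close> times \<open>e\<close>. The
    right-hand side is then only slightly above \<open>1 / 10^20\<close>, and the final squared
    distance \<open>2 - 2 * B\<close> is below \<open>1 / 10^18\<close>, as needed.\<close>
  then have "(1 - B\<^sup>2) * (?P - ?Q) < ?P - ?P' + 104 * e"
    by (simp add: X_def algebra_simps)
  also have "\<dots> \<le> 11 / 10 ^ 21" using gap e by simp
  finally have "(1 - B\<^sup>2) * (?P - ?Q) < 11 / 10 ^ 21" .
  moreover have "(1 - B\<^sup>2) * (1 / 4) \<le> (1 - B\<^sup>2) * (?P - ?Q)"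
    by (rule mult_left_mono[OF gap8]) (use B0 B1 in \<open>simp add: power_le_one\<close>)
  ultimately have B2: "1 - B\<^sup>2 < 44 / 10 ^ 21" by simp
  have "B * B \<le> 1 * B" by (rule mult_right_mono[OF B1 B0])
  then have "B\<^sup>2 \<le> B" by (simp add: power2_eq_square)
  then have B3: "1 - B < 44 / 10 ^ 21" using B2 by linarith
  define \<phi> where "\<phi> = Arg (dotc n u z)"
  have dz: "dotc n u z = of_real B * cis \<phi>" unfolding \<phi>_def B_def by (simp add: rcis_cmod_Arg flip: rcis_def)
  have "cnj (cis \<phi>) * dotc n u z = of_real B * (cnj (cis \<phi>) * cis \<phi>)" unfolding dz by (simp only: mult_ac)
  also have "cnj (cis \<phi>) * cis \<phi> = 1" by (simp add: cis_cnj cis_mult)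
  finally have "Re (cnj (cis \<phi>) * dotc n u z) = B" by simp
  then have "(nrm n (\<lambda>j. z j - cis \<phi> * u j))\<^sup>2 = 2 - 2 * B"
    unfolding nrm_diff_unit_power2[OF norm_cis] z u by simp
  also have "\<dots> \<le> (1 / 10 ^ 9)\<^sup>2" using B3 by (simp add: power_divide)
  finally have "nrm n (\<lambda>j. z j - cis \<phi> * u j) \<le> 1 / 10 ^ 9" by (rule power2_le_imp_le) simp
  then show ?thesis by (rule that)
qed

end

section \<open>Pseudo-inverse and Rayleigh quotient\<close>

lemma mult_mat_vec_index:
  assumes "A \<in> carrier_mat r c" "x \<in> carrier_vec c" "i < r"
  shows "(A *\<^sub>v x) $ i = (\<Sum>j<c. A $$ (i, j) * x $ j)"
  using assms by (auto simp: scalar_prod_def lessThan_atLeast0)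

lemma mat_adjoint_carrier:
  "A \<in> carrier_mat r c \<Longrightarrow> mat_adjoint A \<in> carrier_mat c r"
  by (auto simp: mat_adjoint_def)

lemma mat_adjoint_index:
  "A \<in> carrier_mat r c \<Longrightarrow> i < c \<Longrightarrow> j < r \<Longrightarrow> mat_adjoint A $$ (i, j) = conjugate (A $$ (j, i))"
  by (auto simp: mat_adjoint_def mat_of_rows_index)

lemma mat_adjoint_mult:
  fixes A B :: "complex mat"
  assumes A: "A \<in> carrier_mat r c" and B: "B \<in> carrier_mat c d"
  shows "mat_adjoint (A * B) = mat_adjoint B * mat_adjoint A"
proof (rule eq_matI)
  note a = mat_adjoint_carrier[OF A] mat_adjoint_carrier[OF B] mat_adjoint_carrier[OF mult_carrier_mat[OF A B]]
  show "dim_row (mat_adjoint (A * B)) = dim_row (mat_adjoint B * mat_adjoint A)"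
    "dim_col (mat_adjoint (A * B)) = dim_col (mat_adjoint B * mat_adjoint A)" using a by auto
  fix i j assume "i < dim_row (mat_adjoint B * mat_adjoint A)" "j < dim_col (mat_adjoint B * mat_adjoint A)"
  then have ij: "i < d" "j < r" using a by auto
  have "mat_adjoint (A * B) $$ (i, j) = cnj ((A * B) $$ (j, i))"
    using mat_adjoint_index[OF mult_carrier_mat[OF A B] ij] by simp
  also have "(A * B) $$ (j, i) = (\<Sum>k<c. A $$ (j, k) * B $$ (k, i))"
    using A B ij by (auto simp: scalar_prod_def lessThan_atLeast0)
  also have "cnj \<dots> = (\<Sum>k<c. mat_adjoint B $$ (i, k) * mat_adjoint A $$ (k, j))"
    using ij by (simp add: mat_adjoint_index[OF A] mat_adjoint_index[OF B] mult.commute)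
  also have "\<dots> = (mat_adjoint B * mat_adjoint A) $$ (i, j)"
    using a ij by (auto simp: scalar_prod_def lessThan_atLeast0)
  finally show "mat_adjoint (A * B) $$ (i, j) = (mat_adjoint B * mat_adjoint A) $$ (i, j)" .
qed

lemma mat_adjoint_adjoint:
  fixes A :: "complex mat"
  shows "mat_adjoint (mat_adjoint A) = A"
proof (rule eq_matI)
  have A: "A \<in> carrier_mat (dim_row A) (dim_col A)" by simp
  note a = mat_adjoint_carrier[OF A] mat_adjoint_carrier[OF mat_adjoint_carrier[OF A]]
  show "dim_row (mat_adjoint (mat_adjoint A)) = dim_row A" "dim_col (mat_adjoint (mat_adjoint A)) = dim_col A"
    using a by auto
  fix i j assume "i < dim_row A" "j < dim_col A"
  then show "mat_adjoint (mat_adjoint A) $$ (i, j) = A $$ (i, j)"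
    using mat_adjoint_index[OF mat_adjoint_carrier[OF A], of i j] mat_adjoint_index[OF A, of j i] by simp
qed

lemma mat_adjoint_one: "mat_adjoint (1\<^sub>m n :: complex mat) = 1\<^sub>m n"
proof (rule eq_matI)
  note a = mat_adjoint_carrier[OF one_carrier_mat[of n, where 'a=complex]]
  show "dim_row (mat_adjoint (1\<^sub>m n :: complex mat)) = dim_row (1\<^sub>m n :: complex mat)"
    "dim_col (mat_adjoint (1\<^sub>m n :: complex mat)) = dim_col (1\<^sub>m n :: complex mat)" using a by auto
  fix i j assume "i < dim_row (1\<^sub>m n :: complex mat)" "j < dim_col (1\<^sub>m n :: complex mat)"
  then show "mat_adjoint (1\<^sub>m n :: complex mat) $$ (i, j) = 1\<^sub>m n $$ (i, j)"
    using mat_adjoint_index[OF one_carrier_mat[of n, where 'a=complex], of i j] by auto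
qed

lemma dotc_mat_adjoint:
  assumes A: "A \<in> carrier_mat r c" and x: "x \<in> carrier_vec c" and y: "y \<in> carrier_vec r"
  shows "dotc r (\<lambda>i. y $ i) (\<lambda>i. (A *\<^sub>v x) $ i) = dotc c (\<lambda>j. (mat_adjoint A *\<^sub>v y) $ j) (\<lambda>j. x $ j)"
proof -
  have "dotc r (\<lambda>i. y $ i) (\<lambda>i. (A *\<^sub>v x) $ i) = (\<Sum>i<r. \<Sum>j<c. cnj (y $ i) * (A $$ (i, j) * x $ j))"
    unfolding dotc_def by (intro sum.cong refl) (simp add: mult_mat_vec_index[OF A x] sum_distrib_left)
  also have "\<dots> = (\<Sum>j<c. \<Sum>i<r. cnj (y $ i) * (A $$ (i, j) * x $ j))" by (rule sum.swap)
  also have "\<dots> = (\<Sum>j<c. cnj ((mat_adjoint A *\<^sub>v y) $ j) * x $ j)"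
    by (intro sum.cong refl)
       (simp add: mult_mat_vec_index[OF mat_adjoint_carrier[OF A] y] mat_adjoint_index[OF A] sum_distrib_left sum_distrib_right mult_ac)
  finally show ?thesis by (simp add: dotc_def)
qed

lemma invertible_of_trivial_kernel:
  fixes G :: "complex mat"
  assumes G: "G \<in> carrier_mat n n" and ker: "\<And>x. x \<in> carrier_vec n \<Longrightarrow> G *\<^sub>v x = 0\<^sub>v n \<Longrightarrow> x = 0\<^sub>v n"
  obtains B where "B \<in> carrier_mat n n" "B * G = 1\<^sub>m n" "G * B = 1\<^sub>m n"
proof -
  have "Determinant.det G \<noteq> 0" using det_0_iff_vec_prod_zero[OF G] ker by blast
  from det_non_zero_imp_unit[OF G this, of "()"] show ?thesis
    using that by (auto simp: Units_def ring_mat_def)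
qed

lemma nrm_eq_0_vec:
  assumes "x \<in> carrier_vec n" "nrm n (\<lambda>j. x $ j) = 0"
  shows "x = 0\<^sub>v n"
proof (rule eq_vecI)
  show "dim_vec x = dim_vec (0\<^sub>v n)" using assms by simp
  fix j assume "j < dim_vec (0\<^sub>v n)"
  moreover have "(\<Sum>j<n. (cmod (x $ j))\<^sup>2) = 0" using nrm_power2[of n "\<lambda>j. x $ j"] assms(2) by simp
  ultimately show "x $ j = 0\<^sub>v n $ j" by (simp add: sum_nonneg_eq_0_iff)
qed

text \<open>Injectivity makes \<open>G = A^* A\<close> invertible, and \<open>X = B * A^*\<close>
  with \<open>B\<close> inverse to \<open>G\<close> satisfies the four identities. As
  \<open>pinv\<close> is a definite description, uniqueness is shown too: any candidate
  \<open>Y\<close> is a left inverse of \<open>A\<close>, and the self-adjoint matrices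
  \<open>A * X\<close> and \<open>A * Y\<close> absorb each other in products, hence
  coincide.\<close>

lemma pinv_moore_penrose:
  assumes A: "A \<in> carrier_mat m n"
    and inj: "\<And>x. x \<in> carrier_vec n \<Longrightarrow> A *\<^sub>v x = 0\<^sub>v m \<Longrightarrow> x = 0\<^sub>v n"
  shows "is_moore_penrose A (pinv A)"
proof -
  let ?As = "mat_adjoint A"
  have As: "?As \<in> carrier_mat n m" by (rule mat_adjoint_carrier[OF A])
  define G where "G = ?As * A"
  have G: "G \<in> carrier_mat n n" unfolding G_def using As A by simp
  have Gadj: "mat_adjoint G = G" unfolding G_def by (simp add: mat_adjoint_mult[OF As A] mat_adjoint_adjoint)
  obtain B where B: "B \<in> carrier_mat n n" "B * G = 1\<^sub>m n" "G * B = 1\<^sub>m n"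
  proof (rule invertible_of_trivial_kernel[OF G])
    fix x assume x: "x \<in> carrier_vec n" and Gx: "G *\<^sub>v x = 0\<^sub>v n"
    have Ax: "A *\<^sub>v x \<in> carrier_vec m" using A x by simp
    have AAx: "?As *\<^sub>v (A *\<^sub>v x) = 0\<^sub>v n" using Gx unfolding G_def by (simp add: assoc_mult_mat_vec[OF As A x])
    have "dotc m (\<lambda>i. (A *\<^sub>v x) $ i) (\<lambda>i. (A *\<^sub>v x) $ i) = dotc n (\<lambda>j. (?As *\<^sub>v (A *\<^sub>v x)) $ j) (\<lambda>j. x $ j)"
      by (rule dotc_mat_adjoint[OF A x Ax])
    also have "\<dots> = 0" unfolding AAx dotc_def by simp
    finally have "nrm m (\<lambda>i. (A *\<^sub>v x) $ i) = 0" unfolding dotc_self by simp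
    then have "A *\<^sub>v x = 0\<^sub>v m" by (rule nrm_eq_0_vec[OF Ax])
    then show "x = 0\<^sub>v n" by (rule inj[OF x])
  qed
  have Bs: "mat_adjoint B \<in> carrier_mat n n" by (rule mat_adjoint_carrier[OF B(1)])
  have BsG: "mat_adjoint B * G = 1\<^sub>m n"
    using mat_adjoint_mult[OF G B(1)] by (simp add: B(3) mat_adjoint_one Gadj)
  have Badj: "mat_adjoint B = B"
  proof -
    have "mat_adjoint B = mat_adjoint B * (G * B)" using Bs by (simp add: B(3))
    also have "\<dots> = (mat_adjoint B * G) * B" by (rule assoc_mult_mat[OF Bs G B(1), symmetric])
    also have "\<dots> = B" using B(1) by (simp add: BsG)
    finally show ?thesis .
  qed
  define X where "X = B * ?As"
  have X: "X \<in> carrier_mat n m" unfolding X_def using B As by simp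
  have XA: "X * A = 1\<^sub>m n" unfolding X_def by (simp add: assoc_mult_mat[OF B(1) As A] G_def[symmetric] B(2))
  have AX: "A * X \<in> carrier_mat m m" using A X by simp
  have AXadj: "mat_adjoint (A * X) = A * X"
  proof -
    have "mat_adjoint (A * X) = mat_adjoint X * ?As" by (rule mat_adjoint_mult[OF A X])
    also have "mat_adjoint X = A * B" unfolding X_def
      by (simp add: mat_adjoint_mult[OF B(1) As] mat_adjoint_adjoint Badj)
    also have "A * B * ?As = A * X" unfolding X_def by (rule assoc_mult_mat[OF A B(1) As])
    finally show ?thesis .
  qed
  have mpX: "is_moore_penrose A X"
    unfolding is_moore_penrose_def
    using A X XA AXadj by (simp add: assoc_mult_mat[OF A X A] mat_adjoint_one)
  moreover have "Y = X" if Y: "is_moore_penrose A Y" for Y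
  proof -
    have Yc: "Y \<in> carrier_mat n m" and AYA: "A * Y * A = A" and YAY: "Y * A * Y = Y"
      and AYadj: "mat_adjoint (A * Y) = A * Y"
      using Y A unfolding is_moore_penrose_def by auto
    have AY: "A * Y \<in> carrier_mat m m" using A Yc by simp
    have YA: "Y * A = 1\<^sub>m n"
    proof -
      have YAc: "Y * A \<in> carrier_mat n n" using A Yc by simp
      have "Y * A = (X * A) * (Y * A)" unfolding XA left_mult_one_mat[OF YAc] ..
      also have "\<dots> = X * (A * (Y * A))" by (rule assoc_mult_mat[OF X A YAc])
      also have "A * (Y * A) = A" using AYA by (simp add: assoc_mult_mat[OF A Yc A])
      finally show ?thesis by (simp add: XA)
    qed
    have 1: "(A * Y) * (A * X) = A * X"
    proof -
      have "(A * Y) * (A * X) = A * (Y * (A * X))" by (rule assoc_mult_mat[OF A Yc AX])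
      also have "Y * (A * X) = (Y * A) * X" by (rule assoc_mult_mat[OF Yc A X, symmetric])
      finally show ?thesis using X by (simp add: YA)
    qed
    have 2: "(A * X) * (A * Y) = A * Y"
    proof -
      have "(A * X) * (A * Y) = A * (X * (A * Y))" by (rule assoc_mult_mat[OF A X AY])
      also have "X * (A * Y) = (X * A) * Y" by (rule assoc_mult_mat[OF X A Yc, symmetric])
      finally show ?thesis using Yc by (simp add: XA)
    qed
    have "A * X = mat_adjoint ((A * Y) * (A * X))" by (simp add: 1 AXadj)
    also have "\<dots> = (A * X) * (A * Y)" by (simp add: mat_adjoint_mult[OF AY AX] AXadj AYadj)
    also have "\<dots> = A * Y" by (rule 2)
    finally have eq: "A * X = A * Y" .
    have "Y = (Y * A) * Y" using Yc by (simp add: YA)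
    also have "\<dots> = Y * (A * Y)" by (rule assoc_mult_mat[OF Yc A Yc])
    also have "\<dots> = Y * (A * X)" by (simp add: eq)
    also have "\<dots> = (Y * A) * X" by (rule assoc_mult_mat[OF Yc A X, symmetric])
    also have "\<dots> = X" using X by (simp add: YA)
    finally show ?thesis .
  qed
  ultimately show ?thesis unfolding pinv_def by (rule theI)
qed

text \<open>The matrix \<open>P = A * pinv A\<close> is the orthogonal projection onto the range of
  \<open>A\<close>. It fixes \<open>A v\<close>, so the left-hand side is the norm of the projected
  residual \<open>y - A v\<close>.\<close>

lemma pinv_least_squares:
  assumes A: "A \<in> carrier_mat m n"
    and inj: "\<And>x. x \<in> carrier_vec n \<Longrightarrow> A *\<^sub>v x = 0\<^sub>v m \<Longrightarrow> x = 0\<^sub>v n"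
    and y: "y \<in> carrier_vec m" and v: "v \<in> carrier_vec n"
  shows "pinv A *\<^sub>v y \<in> carrier_vec n"
    and "nrm m (\<lambda>i. (A *\<^sub>v (pinv A *\<^sub>v y)) $ i - (A *\<^sub>v v) $ i) \<le> nrm m (\<lambda>i. y $ i - (A *\<^sub>v v) $ i)"
proof -
  define X where "X = pinv A"
  have X: "X \<in> carrier_mat n m" and AXA: "A * X * A = A" and adj: "mat_adjoint (A * X) = A * X"
    using pinv_moore_penrose[OF A inj] A unfolding is_moore_penrose_def X_def by auto
  define P where "P = A * X"
  have P: "P \<in> carrier_mat m m" using A X by (simp add: P_def)
  have PP: "P * P = P" unfolding P_def
    using assoc_mult_mat[of "A * X" m m A n X m] A X by (simp add: AXA)
  show "pinv A *\<^sub>v y \<in> carrier_vec n" using X y by (simp add: X_def)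
  have Av: "A *\<^sub>v v \<in> carrier_vec m" using A v by simp
  define d where "d = y - A *\<^sub>v v"
  have d: "d \<in> carrier_vec m" using y Av by (simp add: d_def)
  have Pd: "P *\<^sub>v d \<in> carrier_vec m" using P d by simp
  have "P *\<^sub>v (A *\<^sub>v v) = A *\<^sub>v v"
    using assoc_mult_mat_vec[OF P A v] by (simp add: P_def AXA)
  moreover have "P *\<^sub>v y = A *\<^sub>v (X *\<^sub>v y)" unfolding P_def by (rule assoc_mult_mat_vec[OF A X y])
  ultimately have Pd_eq: "P *\<^sub>v d = A *\<^sub>v (X *\<^sub>v y) - A *\<^sub>v v"
    unfolding d_def using mult_minus_distrib_mat_vec[OF P y Av] by simp
  have "dotc m (\<lambda>i. (P *\<^sub>v d) $ i) (\<lambda>i. (P *\<^sub>v d) $ i) = dotc m (\<lambda>i. (mat_adjoint P *\<^sub>v (P *\<^sub>v d)) $ i) (\<lambda>i. d $ i)"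
    by (rule dotc_mat_adjoint[OF P d Pd])
  also have "mat_adjoint P *\<^sub>v (P *\<^sub>v d) = P *\<^sub>v d"
    using adj assoc_mult_mat_vec[OF P P d] by (simp add: PP flip: P_def)
  finally have eq: "of_real ((nrm m (\<lambda>i. (P *\<^sub>v d) $ i))\<^sup>2) = dotc m (\<lambda>i. (P *\<^sub>v d) $ i) (\<lambda>i. d $ i)"
    by (simp only: dotc_self)
  have "(nrm m (\<lambda>i. (P *\<^sub>v d) $ i))\<^sup>2 = cmod (of_real ((nrm m (\<lambda>i. (P *\<^sub>v d) $ i))\<^sup>2))"
    by (simp only: norm_of_real abs_of_nonneg zero_le_power2)
  also have "\<dots> \<le> nrm m (\<lambda>i. (P *\<^sub>v d) $ i) * nrm m (\<lambda>i. d $ i)"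
    unfolding eq by (rule cmod_dotc_le_nrm)
  finally have "nrm m (\<lambda>i. (P *\<^sub>v d) $ i) \<le> nrm m (\<lambda>i. d $ i)"
    unfolding power2_eq_square by (metis mult_left_le_imp_le nrm_nonneg order_le_less)
  moreover have "nrm m (\<lambda>i. (P *\<^sub>v d) $ i) = nrm m (\<lambda>i. (A *\<^sub>v (X *\<^sub>v y)) $ i - (A *\<^sub>v v) $ i)"
    unfolding nrm_def Pd_eq using A X y v by (intro L2_set_cong) auto
  moreover have "nrm m (\<lambda>i. d $ i) = nrm m (\<lambda>i. y $ i - (A *\<^sub>v v) $ i)"
    unfolding nrm_def d_def using A y v by (intro L2_set_cong) auto
  ultimately show "nrm m (\<lambda>i. (A *\<^sub>v (pinv A *\<^sub>v y)) $ i - (A *\<^sub>v v) $ i) \<le> nrm m (\<lambda>i. y $ i - (A *\<^sub>v v) $ i)"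
    by (simp add: X_def)
qed

section \<open>The Rayleigh quotient of a positive form\<close>

lemma nrm_diff_power2: "(nrm n (\<lambda>j. x j - of_real t * y j))\<^sup>2 = (nrm n x)\<^sup>2 - 2 * t * Re (dotc n y x) + t\<^sup>2 * (nrm n y)\<^sup>2"
proof -
  have "(cmod (x j - of_real t * y j))\<^sup>2 = (cmod (x j))\<^sup>2 - 2 * t * Re (cnj (y j) * x j) + t\<^sup>2 * (cmod (y j))\<^sup>2" for j
    unfolding cmod_power2 by (simp add: power2_eq_square algebra_simps)
  then show ?thesis
    unfolding nrm_power2 dotc_def by (simp only: sum.distrib sum_subtractf sum_distrib_left Re_sum)
qed

text \<open>The supremum \<open>s\<close> of the Rayleigh quotient is an eigenvalue: otherwise \<open>s 1 - S\<close> would be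
  invertible, while positivity of its form gives \<open>\<parallel>(s 1 - S) x\<parallel>\<^sup>2 \<le> s (s - \<langle>x, S x\<rangle>)\<close> on the unit sphere.\<close>

lemma main_eigenvector_Rayleigh:
  fixes a :: "nat \<Rightarrow> nat \<Rightarrow> complex" and \<rho> :: "nat \<Rightarrow> real" and n m :: nat
  defines "S \<equiv> mat n n (\<lambda>(j, k). \<Sum>i<m. of_real (\<rho> i) * (a i j * cnj (a i k)))"
  assumes \<rho>: "\<And>i. \<rho> i \<ge> 0" and main: "main_eigenvector S z"
  shows "(\<Sum>i<m. \<rho> i * (cmod (dotc n (a i) x))\<^sup>2) * (nrm n (\<lambda>j. z $ j))\<^sup>2 \<le>
     (\<Sum>i<m. \<rho> i * (cmod (dotc n (a i) (\<lambda>j. z $ j)))\<^sup>2) * (nrm n x)\<^sup>2"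
proof -
  have Sc: "S \<in> carrier_mat n n" by (simp add: S_def)
  define q where "q = (\<lambda>x. \<Sum>i<m. \<rho> i * (cmod (dotc n (a i) x))\<^sup>2)"
  define T where "T = (\<lambda>x j. \<Sum>i<m. of_real (\<rho> i) * a i j * dotc n (a i) x)"
  have T: "(S *\<^sub>v vec n x) $ j = T x j" if "j < n" for x j
  proof -
    have "(S *\<^sub>v vec n x) $ j = (\<Sum>k<n. \<Sum>i<m. of_real (\<rho> i) * (a i j * cnj (a i k)) * x k)"
      using that by (subst mult_mat_vec_index[OF Sc]) (auto simp: S_def sum_distrib_right)
    also have "\<dots> = (\<Sum>i<m. \<Sum>k<n. of_real (\<rho> i) * (a i j * cnj (a i k)) * x k)" by (rule sum.swap)
    also have "\<dots> = T x j" by (simp add: T_def dotc_def sum_distrib_left mult_ac)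
    finally show ?thesis .
  qed
  have form: "dotc n y (T x) = (\<Sum>i<m. of_real (\<rho> i) * cnj (dotc n (a i) y) * dotc n (a i) x)" for x y
  proof -
    have "dotc n y (T x) = (\<Sum>j<n. \<Sum>i<m. cnj (y j) * (of_real (\<rho> i) * a i j * dotc n (a i) x))"
      by (simp add: dotc_def[of n y] T_def sum_distrib_left)
    also have "\<dots> = (\<Sum>i<m. \<Sum>j<n. cnj (y j) * (of_real (\<rho> i) * a i j * dotc n (a i) x))" by (rule sum.swap)
    also have "\<dots> = (\<Sum>i<m. of_real (\<rho> i) * cnj (dotc n (a i) y) * dotc n (a i) x)"
      by (intro sum.cong refl) (simp add: dotc_def[of n "a _" y] sum_distrib_left sum_distrib_right mult_ac)
    finally show ?thesis .
  qed
  have qform: "dotc n x (T x) = of_real (q x)" for x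
  proof -
    have e: "of_real (\<rho> i) * cnj (dotc n (a i) x) * dotc n (a i) x = of_real (\<rho> i * (cmod (dotc n (a i) x))\<^sup>2)" for i
      using complex_norm_square[of "dotc n (a i) x"] by (simp add: mult_ac)
    show ?thesis unfolding form q_def of_real_sum by (rule sum.cong[OF refl e])
  qed
  have q0: "q x \<ge> 0" for x unfolding q_def by (intro sum_nonneg mult_nonneg_nonneg \<rho>) simp
  have qscale: "q (\<lambda>j. c * x j) = (cmod c)\<^sup>2 * q x" for c x
    by (simp add: q_def dotc_scale norm_mult power_mult_distrib sum_distrib_left mult_ac)
  have qdiff: "q (\<lambda>j. x j - of_real t * y j) = q x - 2 * t * Re (dotc n y (T x)) + t\<^sup>2 * q y" for x y t
  proof -
    have e: "(cmod (p - of_real t * r))\<^sup>2 = (cmod p)\<^sup>2 - 2 * t * Re (cnj r * p) + t\<^sup>2 * (cmod r)\<^sup>2" for p r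
      unfolding cmod_power2 by (simp add: power2_eq_square algebra_simps)
    have "\<rho> i * (cmod (dotc n (a i) (\<lambda>j. x j - of_real t * y j)))\<^sup>2 =
       \<rho> i * (cmod (dotc n (a i) x))\<^sup>2 - 2 * t * Re (of_real (\<rho> i) * cnj (dotc n (a i) y) * dotc n (a i) x) + t\<^sup>2 * (\<rho> i * (cmod (dotc n (a i) y))\<^sup>2)" for i
      unfolding dotc_diff dotc_scale e by (simp add: algebra_simps)
    then show ?thesis
      unfolding form q_def by (simp only: sum.distrib sum_subtractf sum_distrib_left Re_sum)
  qed
  obtain k :: real where ev: "eigenvector S z (complex_of_real k)"
    and top: "\<And>l::real. eigenvalue S (complex_of_real l) \<Longrightarrow> l \<le> k"
    using main unfolding main_eigenvector_def by blast
  have zc: "z \<in> carrier_vec n" and z0: "z \<noteq> 0\<^sub>v n" and Sz: "S *\<^sub>v z = of_real k \<cdot>\<^sub>v z"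
    using ev Sc unfolding eigenvector_def by auto
  define Z where "Z = (\<lambda>j. z $ j)"
  have zZ: "z = vec n Z" using zc by (auto simp: Z_def)
  have nz: "nrm n Z \<noteq> 0" using nrm_eq_0_vec[OF zc] z0 unfolding Z_def by blast
  have "T Z j = of_real k * Z j" if "j < n" for j
  proof -
    have "T Z j = (S *\<^sub>v z) $ j" using T[OF that, of Z] by (simp flip: zZ)
    then show ?thesis using that zc by (simp add: Sz Z_def)
  qed
  then have "dotc n Z (T Z) = dotc n Z (\<lambda>j. of_real k * Z j)" by (simp add: dotc_def)
  also have "\<dots> = of_real (k * (nrm n Z)\<^sup>2)" by (simp only: dotc_scale dotc_self of_real_mult)
  finally have qz: "q Z = k * (nrm n Z)\<^sup>2" unfolding qform by (simp only: of_real_eq_iff)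

  define U where "U = {x. nrm n x = 1}"
  obtain x1 where x1: "nrm n x1 = 1" using nrm_normalize[OF nz] by metis
  \<comment> \<open>A crude Cauchy-Schwarz bound by which the supremum of the quotient
    exists.\<close>
  define C where "C = (\<Sum>i<m. \<rho> i * (nrm n (a i))\<^sup>2)"
  have bdd: "bdd_above (q ` U)"
  proof (rule bdd_aboveI2)
    fix x assume "x \<in> U"
    then have "cmod (dotc n (a i) x) \<le> nrm n (a i)" for i
      using cmod_dotc_le_nrm[of n "a i" x] by (simp add: U_def)
    then show "q x \<le> C" unfolding q_def C_def by (intro sum_mono mult_left_mono power_mono \<rho>) auto
  qed
  define s where "s = (SUP x\<in>U. q x)"
  have s: "q x \<le> s" if "nrm n x = 1" for x
    unfolding s_def by (rule cSUP_upper[OF _ bdd]) (use that in \<open>simp add: U_def\<close>)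
  have s0: "s \<ge> 0" using order_trans[OF q0 s[OF x1]] .
  have shom: "q x \<le> s * (nrm n x)\<^sup>2" for x
  proof (cases "nrm n x = 0")
    case True
    then show ?thesis by (simp add: q_def nrm_zero_dotc)
  next
    case False
    then obtain y where y: "nrm n y = 1" "x = (\<lambda>j. of_real (nrm n x) * y j)" by (rule nrm_normalize)
    have "q x = (nrm n x)\<^sup>2 * q y" by (subst y(2)) (simp add: qscale)
    also have "\<dots> \<le> (nrm n x)\<^sup>2 * s" by (rule mult_left_mono[OF s[OF y(1)]]) simp
    finally show ?thesis by (simp add: mult.commute)
  qed
  have "s \<le> k"
  proof (rule ccontr)
    assume sk: "\<not> s \<le> k"
    have spos: "s > 0"
    proof -
      have "k * (nrm n Z)\<^sup>2 \<ge> 0" using q0[of Z] qz by simp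
      then have "k \<ge> 0" using nz by (simp add: zero_le_mult_iff)
      then show ?thesis using sk by simp
    qed
    define D where "D = (\<lambda>x j. of_real s * x j - T x j)"
    \<comment> \<open>The matrix of \<open>s 1 - S\<close>. Its kernel is trivial, because
      \<open>s > k\<close> excludes \<open>s\<close> as an eigenvalue; its left inverse
      \<open>N\<close> bounds \<open>nrm n (D x)\<close> away from 0 on the unit sphere.\<close>
    define M where "M = mat n n (\<lambda>(j, k). (if j = k then of_real s else 0) - S $$ (j, k))"
    have Mc: "M \<in> carrier_mat n n" by (simp add: M_def)
    have MD: "(M *\<^sub>v vec n x) $ j = D x j" if "j < n" for x j
    proof -
      have "(M *\<^sub>v vec n x) $ j = (\<Sum>k<n. (if j = k then of_real s * x k else 0) - S $$ (j, k) * x k)"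
        using that by (subst mult_mat_vec_index[OF Mc]) (auto simp: M_def left_diff_distrib intro!: sum.cong)
      also have "\<dots> = of_real s * x j - (\<Sum>k<n. S $$ (j, k) * x k)"
        using that by (simp add: sum_subtractf)
      also have "(\<Sum>k<n. S $$ (j, k) * x k) = T x j"
        using T[OF that, of x] that by (subst (asm) mult_mat_vec_index[OF Sc]) auto
      finally show ?thesis by (simp add: D_def)
    qed
    obtain N where N: "N \<in> carrier_mat n n" "N * M = 1\<^sub>m n"
    proof (rule invertible_of_trivial_kernel[OF Mc])
      fix x assume x: "x \<in> carrier_vec n" and Mx: "M *\<^sub>v x = 0\<^sub>v n"
      show "x = 0\<^sub>v n"
      proof (rule ccontr)
        assume nx: "x \<noteq> 0\<^sub>v n"
        have xv: "x = vec n (\<lambda>j. x $ j)" using x by auto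
        have "S *\<^sub>v x = of_real s \<cdot>\<^sub>v x"
        proof (rule eq_vecI)
          show "dim_vec (S *\<^sub>v x) = dim_vec (of_real s \<cdot>\<^sub>v x)" using Sc x by simp
          fix j assume "j < dim_vec (of_real s \<cdot>\<^sub>v x)"
          then have j: "j < n" using x by simp
          have "D (\<lambda>j. x $ j) j = 0" using MD[OF j, of "\<lambda>j. x $ j"] Mx j by (simp flip: xv)
          moreover have "(S *\<^sub>v x) $ j = T (\<lambda>j. x $ j) j" using T[OF j, of "\<lambda>j. x $ j"] by (simp flip: xv)
          ultimately show "(S *\<^sub>v x) $ j = (of_real s \<cdot>\<^sub>v x) $ j" using x j by (simp add: D_def)
        qed
        then have "eigenvalue S (of_real s)"
          unfolding eigenvalue_def eigenvector_def using x nx Sc by auto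
        then show False using top sk by blast
      qed
    qed
    define c where "c = L2_set (\<lambda>i. nrm n (\<lambda>j. cnj (N $$ (i, j)))) {..<n}"
    have Nbound: "nrm n x \<le> c * nrm n (D x)" for x
    proof -
      have Nx: "N *\<^sub>v (M *\<^sub>v vec n x) = vec n x"
        using assoc_mult_mat_vec[OF N(1) Mc, of "vec n x"] by (simp add: N(2))
      have Mxv: "M *\<^sub>v vec n x \<in> carrier_vec n" using Mc by simp
      have xi: "x i = dotc n (\<lambda>j. cnj (N $$ (i, j))) (D x)" if "i < n" for i
      proof -
        have "x i = (N *\<^sub>v (M *\<^sub>v vec n x)) $ i" using that by (simp add: Nx)
        also have "\<dots> = (\<Sum>j<n. N $$ (i, j) * (M *\<^sub>v vec n x) $ j)" by (rule mult_mat_vec_index[OF N(1) Mxv that])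
        also have "\<dots> = (\<Sum>j<n. N $$ (i, j) * D x j)" by (intro sum.cong refl) (simp only: MD lessThan_iff)
        finally show ?thesis by (simp add: dotc_def)
      qed
      have "nrm n x \<le> L2_set (\<lambda>i. nrm n (D x) * nrm n (\<lambda>j. cnj (N $$ (i, j)))) {..<n}"
        unfolding nrm_def[of n x]
      proof (rule L2_set_mono)
        fix i assume "i \<in> {..<n}"
        then have "x i = dotc n (\<lambda>j. cnj (N $$ (i, j))) (D x)" by (intro xi) simp
        then show "cmod (x i) \<le> nrm n (D x) * nrm n (\<lambda>j. cnj (N $$ (i, j)))"
          using cmod_dotc_le_nrm[of n "\<lambda>j. cnj (N $$ (i, j))" "D x"] by (simp add: mult.commute)
      qed simp
      also have "\<dots> = nrm n (D x) * c" by (simp add: c_def L2_set_right_distrib)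
      finally show ?thesis by (simp add: mult.commute)
    qed
    have c0: "c \<ge> 0" by (simp add: c_def L2_set_nonneg)
    have gapD: "(nrm n (D x))\<^sup>2 \<le> s * (s - q x)" if "nrm n x = 1" for x
    proof -
      \<comment> \<open>Nonnegativity of the form \<open>s * |x|^2 - q x\<close> is applied at
        \<open>x - t * D x\<close>; the choice \<open>t = 1/s\<close> maximises the gain
        \<open>2 * t - s * t^2\<close>.\<close>
      define t where "t = 1 / s"
      have Dx: "dotc n (D x) (D x) = of_real s * dotc n (D x) x - dotc n (D x) (T x)"
      proof -
        have "dotc n (D x) (D x) = dotc n (D x) (\<lambda>j. of_real s * x j - T x j)" by (simp add: D_def)
        then show ?thesis by (simp only: dotc_diff dotc_scale)
      qed
      have nD: "(nrm n (D x))\<^sup>2 = s * Re (dotc n (D x) x) - Re (dotc n (D x) (T x))"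
        using arg_cong[OF Dx, of Re] unfolding dotc_self by simp
      have "q (\<lambda>j. x j - of_real t * D x j) \<le> s * (nrm n (\<lambda>j. x j - of_real t * D x j))\<^sup>2" by (rule shom)
      then have "q x - 2 * t * Re (dotc n (D x) (T x)) + t\<^sup>2 * q (D x) \<le>
        s * (1 - 2 * t * Re (dotc n (D x) x) + t\<^sup>2 * (nrm n (D x))\<^sup>2)"
        unfolding qdiff nrm_diff_power2 using that by simp
      then have "2 * t * (s * Re (dotc n (D x) x) - Re (dotc n (D x) (T x))) \<le> s - q x + s * t\<^sup>2 * (nrm n (D x))\<^sup>2 - t\<^sup>2 * q (D x)"
        by (simp add: algebra_simps)
      moreover have "t\<^sup>2 * q (D x) \<ge> 0" using q0 by simp
      ultimately have "2 * t * (nrm n (D x))\<^sup>2 \<le> s - q x + s * t\<^sup>2 * (nrm n (D x))\<^sup>2"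
        unfolding nD[symmetric] by linarith
      moreover have "s * t\<^sup>2 = t" using spos by (simp add: t_def power2_eq_square)
      ultimately have "t * (nrm n (D x))\<^sup>2 \<le> s - q x" by simp
      then show ?thesis using spos by (simp add: t_def field_simps)
    qed
    have "1 \<le> c\<^sup>2 * (s * (s - q x))" if "nrm n x = 1" for x
    proof -
      have "1 \<le> c * nrm n (D x)" using Nbound[of x] that by simp
      then have "1\<^sup>2 \<le> (c * nrm n (D x))\<^sup>2" by (rule power_mono) simp
      also have "\<dots> = c\<^sup>2 * (nrm n (D x))\<^sup>2" by (rule power_mult_distrib)
      also have "\<dots> \<le> c\<^sup>2 * (s * (s - q x))" by (rule mult_left_mono[OF gapD[OF that]]) simp
      finally show ?thesis by simp
    qed
    note low = this
    have cs: "c\<^sup>2 * s > 0"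
    proof -
      have "c \<noteq> 0" using low[OF x1] by auto
      then show ?thesis using spos by simp
    qed
    \<comment> \<open>The quotient stays below its supremum by a fixed amount on the whole sphere,
      which is the contradiction.\<close>
    have "q x \<le> s - 1 / (c\<^sup>2 * s)" if "nrm n x = 1" for x
    proof -
      have "1 \<le> (s - q x) * (c\<^sup>2 * s)" using low[OF that] by (simp only: mult_ac)
      then have "1 / (c\<^sup>2 * s) \<le> s - q x" unfolding pos_divide_le_eq[OF cs] .
      then show ?thesis by simp
    qed
    then have "(SUP x\<in>U. q x) \<le> s - 1 / (c\<^sup>2 * s)"
      by (intro cSUP_least) (use x1 in \<open>auto simp: U_def\<close>)
    then have "s \<le> s - 1 / (c\<^sup>2 * s)" unfolding s_def[symmetric] .
    then show False using cs by simp
  qed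
  have "q x * (nrm n Z)\<^sup>2 \<le> (k * (nrm n x)\<^sup>2) * (nrm n Z)\<^sup>2"
  proof (rule mult_right_mono)
    show "q x \<le> k * (nrm n x)\<^sup>2"
      using shom[of x] mult_right_mono[OF \<open>s \<le> k\<close>, of "(nrm n x)\<^sup>2"] by simp
  qed simp
  also have "\<dots> = q Z * (nrm n x)\<^sup>2" by (simp add: qz)
  finally show ?thesis by (simp add: q_def Z_def)
qed

section \<open>Convergence of alternating projections\<close>

lemma sensing_mat_carrier: "sensing_mat m n \<omega> \<in> carrier_mat m n"
  by (auto simp: sensing_mat_def)

lemma sensing_mat_mult_index:
  assumes "x \<in> carrier_vec n" "i < m"
  shows "(sensing_mat m n \<omega> *\<^sub>v x) $ i = rdot n \<omega> i (\<lambda>j. x $ j)"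
proof -
  have "row (sensing_mat m n \<omega>) i = conjugate (sensing_vec n \<omega> i)"
    unfolding sensing_mat_def using assms by (subst mat_of_rows_row) (auto simp: sensing_vec_def)
  then show ?thesis
    using assms sensing_mat_carrier[of m n \<omega>]
    by (auto simp: scalar_prod_def lessThan_atLeast0 dotc_def sensing_vec_def)
qed

lemma vnorm_eq_nrm: "v \<in> carrier_vec n \<Longrightarrow> vnorm v = nrm n (\<lambda>j. v $ j)"
  by (auto simp: vnorm_def nrm_def)

lemma scalar_prod_sensing_vec:
  assumes "x \<in> carrier_vec n"
  shows "x \<bullet>c sensing_vec n \<omega> i = rdot n \<omega> i (\<lambda>j. x $ j)"
  using assms by (simp add: scalar_prod_def lessThan_atLeast0 dotc_def sensing_vec_def mult.commute)

text \<open>The shape required by the Rayleigh comparison: nonnegative weights, with cutoff and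
  factor \<open>1/m\<close> included, times rank-one matrices.\<close>

lemma init_mat_eq:
  fixes \<omega> :: "nat \<times> nat \<Rightarrow> complex"
  assumes "x0 \<in> carrier_vec n"
  defines "t \<equiv> \<lambda>i. (cmod (rdot n \<omega> i (\<lambda>j. x0 $ j)))\<^sup>2"
  shows "init_mat m n (sensing_vec n \<omega>) x0 =
    mat n n (\<lambda>(j, k). \<Sum>i<m. of_real (if t i \<le> 9 / real m * (\<Sum>l<m. t l) then t i / real m else 0) * (\<omega> (i, j) * cnj (\<omega> (i, k))))"
  unfolding init_mat_def scalar_prod_sensing_vec[OF assms(1)] t_def
  by (rule cong_mat) (auto simp: sensing_vec_def sum_distrib_left intro!: sum.cong)

lemma phase_scale_pos: "c > 0 \<Longrightarrow> phase (of_real c * z) = phase z"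
  by (auto simp: phase_def norm_mult)

text \<open>The reals are only conditionally complete; nonnegativity supplies the lower bound under
  which \<open>INF\<close> can be compared with a value.\<close>

lemma INF_le_of_witness:
  fixes f :: "real \<Rightarrow> real"
  assumes "\<And>x. f x \<ge> 0" "f x \<le> c"
  shows "(INF x. f x) \<le> c"
proof -
  have "(INF x. f x) \<le> f x" by (rule cINF_lower) (use bdd_belowI2[of UNIV 0 f] assms(1) in auto)
  then show ?thesis using assms(2) by simp
qed

lemma (in good_frame) nrm_eq_0_of_SN:
  assumes "SN (\<lambda>_. 1) v \<le> 0" shows "nrm n v = 0"
proof (rule ccontr)
  assume "nrm n v \<noteq> 0"
  then have "0 < nrm n v" using nrm_nonneg[of n v] by linarith
  then have "0 < 99 / 100 * sqrt (real m) * nrm n v" using sqrt_m(1) by simp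
  then show False using SN_lower[of v] assms by linarith
qed

text \<open>With \<open>x0 = r * u\<close> everything is scaled to the unit vector \<open>u\<close>.
  The case \<open>r = 0\<close> is separate, since the scaling divides by \<open>r\<close>. The
  bound starts at \<open>t = 1\<close> because an eigenvector has arbitrary length, so
  \<open>z 0\<close> itself need not be near the orbit of \<open>x0\<close>.\<close>

lemma (in good_frame) alternating_projections_converge:
  assumes a: "a = (\<lambda>i j. \<omega> (i, j))"
    and x0: "x0 \<in> carrier_vec n" "\<And>j. j < n \<Longrightarrow> x0 $ j = of_real r * u j" and r: "r \<ge> 0"
    and main: "main_eigenvector (init_mat m n (sensing_vec n \<omega>) x0) (z 0)"
    and seq: "alt_proj_seq (sensing_mat m n \<omega>) (map_vec cmod (sensing_mat m n \<omega> *\<^sub>v x0)) z"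
    and t: "t \<ge> 1"
  shows "(INF \<phi>::real. vnorm (cis \<phi> \<cdot>\<^sub>v x0 - z t)) \<le> (19 / 20) ^ t * vnorm x0"
proof -
  let ?A = "sensing_mat m n \<omega>"
  define Z where "Z = (\<lambda>t j. z t $ j)"
  have Ac: "?A \<in> carrier_mat m n" by (rule sensing_mat_carrier)
  have Ai: "(?A *\<^sub>v x) $ i = A (\<lambda>j. x $ j) i" if "x \<in> carrier_vec n" "i < m" for x i
    using sensing_mat_mult_index[OF that, of \<omega>] by (simp add: a)
  have inj: "x = 0\<^sub>v n" if x: "x \<in> carrier_vec n" and Ax: "?A *\<^sub>v x = 0\<^sub>v m" for x
  proof -
    have "A (\<lambda>j. x $ j) i = 0" if "i < m" for i using Ai[OF x that] Ax that by simp
    then have "SN (\<lambda>_. 1) (\<lambda>j. x $ j) = 0" by (simp add: SN_def L2_set_def)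
    then have "nrm n (\<lambda>j. x $ j) = 0" by (intro nrm_eq_0_of_SN) simp
    then show ?thesis by (rule nrm_eq_0_vec[OF x])
  qed
  have x0A: "dotc n v (\<lambda>j. x0 $ j) = of_real r * dotc n v u" for v
    using x0(2) by (simp add: dotc_def sum_distrib_left mult_ac)
  define y where "y = (\<lambda>t. entrywise_prod (map_vec complex_of_real (map_vec cmod (?A *\<^sub>v x0))) (map_vec phase (?A *\<^sub>v z t)))"
  have zS: "z (Suc t) = pinv ?A *\<^sub>v y t" for t
    using seq unfolding alt_proj_seq_def y_def by force
  have yc: "y t \<in> carrier_vec m" for t using Ac by (simp add: y_def entrywise_prod_def)
  have zSc: "z (Suc t) \<in> carrier_vec n" for t
    unfolding zS by (rule pinv_least_squares(1)[OF Ac inj yc zero_carrier_vec])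
  have z0: "z 0 \<in> carrier_vec n" "z 0 \<noteq> 0\<^sub>v n"
    using main unfolding main_eigenvector_def eigenvector_def init_mat_def by auto
  have zc: "z t \<in> carrier_vec n" for t using z0 zSc by (cases t) auto
  have yi: "y t $ i = of_real (r * cmod (A u i)) * phase (A (Z t) i)" if "i < m" for t i
  proof -
    have "y t $ i = of_real (cmod ((?A *\<^sub>v x0) $ i)) * phase ((?A *\<^sub>v z t) $ i)"
      using that Ac by (simp add: y_def entrywise_prod_def del: index_mult_mat_vec)
    then show ?thesis
      unfolding Ai[OF x0(1) that] Ai[OF zc that] x0A Z_def using r by (simp add: norm_mult)
  qed
  have ls: "L2_set (\<lambda>i. cmod (A (Z (Suc t)) i - A v i)) {..<m} \<le>
       L2_set (\<lambda>i. cmod (of_real (r * cmod (A u i)) * phase (A (Z t) i) - A v i)) {..<m}" for t v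
  proof -
    have vc: "vec n v \<in> carrier_vec n" by simp
    have Av: "(?A *\<^sub>v vec n v) $ i = A v i" if "i < m" for i
      using Ai[OF vc that] by (simp add: dotc_def)
    have "nrm m (\<lambda>i. (?A *\<^sub>v z (Suc t)) $ i - (?A *\<^sub>v vec n v) $ i) \<le> nrm m (\<lambda>i. y t $ i - (?A *\<^sub>v vec n v) $ i)"
      unfolding zS by (rule pinv_least_squares(2)[OF Ac inj yc vc])
    then show ?thesis unfolding nrm_def
      by (simp add: Av Ai[OF zc] yi Z_def cong: L2_set_cong_simp)
  qed
  have vn: "vnorm (cis \<phi> \<cdot>\<^sub>v x0 - z t) = nrm n (\<lambda>j. Z t j - cis \<phi> * (of_real r * u j))" for \<phi> t
    unfolding vnorm_def nrm_def using zc[of t] x0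
    by (intro L2_set_cong) (auto simp: Z_def norm_minus_commute)
  have vx0: "vnorm x0 = r"
  proof -
    have "vnorm x0 = nrm n (\<lambda>j. of_real r * u j)"
      unfolding vnorm_eq_nrm[OF x0(1)] nrm_def by (rule L2_set_cong) (use x0(2) in auto)
    then show ?thesis using u r by (simp add: nrm_scale)
  qed
  obtain s where s: "t = Suc s" using t by (cases t) auto
  show ?thesis
  proof (cases "r = 0")
    case True
    \<comment> \<open>With \<open>r = 0\<close> the data vanish, and the least-squares bound at
      \<open>v = 0\<close> leaves no room for a nonzero \<open>A (Z t)\<close>; the lower frame
      bound then gives \<open>Z t = 0\<close>.\<close>
    have "SN (\<lambda>_. 1) (Z t) \<le> 0"
      using ls[of s "\<lambda>_. 0"] True by (simp add: SN_def s dotc_def[of n _ "\<lambda>_. 0"]) (simp add: L2_set_def)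
    then have "nrm n (Z t) = 0" by (rule nrm_eq_0_of_SN)
    then have "vnorm (cis 0 \<cdot>\<^sub>v x0 - z t) \<le> (19 / 20) ^ t * vnorm x0"
      unfolding vn vx0 True by simp
    then show ?thesis by (rule INF_le_of_witness[rotated]) (simp only: vn nrm_nonneg)
  next
    case False
    then have rpos: "r > 0" using r by simp
    \<comment> \<open>The initial vector is divided by its own norm, all later iterates by
      \<open>r\<close>. Only the phases of \<open>A (Z 0)\<close> enter the first step, so the
      positive factor is harmless.\<close>
    define X where "X = (\<lambda>t j. of_real (1 / (if t = 0 then nrm n (Z 0) else r)) * Z t j)"
    have "nrm n (Z 0) \<noteq> 0" using nrm_eq_0_vec[OF z0(1)] z0(2) unfolding Z_def by blast
    then have nz: "nrm n (Z 0) > 0" using nrm_nonneg[of n "Z 0"] by linarith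
    have phX: "phase (A (X t) i) = phase (A (Z t) i)" for t i
      unfolding X_def dotc_scale by (rule phase_scale_pos) (use nz rpos in auto)
    have Zr: "Z (Suc t) = (\<lambda>j. of_real r * X (Suc t) j)" for t
      using rpos by (simp add: X_def flip: of_real_mult)
    have lsX: "L2_set (\<lambda>i. cmod (A (X (Suc t)) i - A v i)) {..<m} \<le>
       L2_set (\<lambda>i. cmod (of_real (cmod (A u i)) * phase (A (X t) i) - A v i)) {..<m}" for t v
    proof -
      have "L2_set (\<lambda>i. r * cmod (A (X (Suc t)) i - A v i)) {..<m} = L2_set (\<lambda>i. cmod (A (Z (Suc t)) i - A (\<lambda>j. of_real r * v j) i)) {..<m}"
        unfolding Zr dotc_scale right_diff_distrib[symmetric] norm_mult using rpos by simp
      also have "\<dots> \<le> L2_set (\<lambda>i. cmod (of_real (r * cmod (A u i)) * phase (A (Z t) i) - A (\<lambda>j. of_real r * v j) i)) {..<m}"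
        by (rule ls)
      also have "\<dots> = L2_set (\<lambda>i. r * cmod (of_real (cmod (A u i)) * phase (A (X t) i) - A v i)) {..<m}"
        unfolding dotc_scale phX of_real_mult mult.assoc right_diff_distrib[symmetric] norm_mult using rpos by simp
      finally show ?thesis
        using rpos by (simp add: L2_set_right_distrib[symmetric])
    qed
    have top: "(\<Sum>i<m. if (cmod (A u i))\<^sup>2 \<le> 9 / real m * (\<Sum>l<m. (cmod (A u l))\<^sup>2) then (cmod (A u i))\<^sup>2 * (cmod (A u i))\<^sup>2 else 0) \<le>
       (\<Sum>i<m. if (cmod (A u i))\<^sup>2 \<le> 9 / real m * (\<Sum>l<m. (cmod (A u l))\<^sup>2) then (cmod (A u i))\<^sup>2 * (cmod (A (X 0) i))\<^sup>2 else 0)"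
    proof -
      define \<tau> where "\<tau> = (\<lambda>i. (cmod (A u i))\<^sup>2)"
      define \<rho> where "\<rho> = (\<lambda>i. if \<tau> i \<le> 9 / real m * (\<Sum>l<m. \<tau> l) then r\<^sup>2 * \<tau> i / real m else 0)"
      have tr: "(cmod (rdot n \<omega> i (\<lambda>j. x0 $ j)))\<^sup>2 = r\<^sup>2 * \<tau> i" for i
        using r by (simp add: x0A norm_mult power_mult_distrib \<tau>_def a)
      \<comment> \<open>The cutoff is homogeneous: both sides scale by \<open>r^2\<close>, so
        truncation for \<open>x0\<close> and for \<open>u\<close> keeps the same rows.\<close>
      have cond: "r\<^sup>2 * \<tau> i \<le> 9 / real m * (\<Sum>l<m. r\<^sup>2 * \<tau> l) \<longleftrightarrow> \<tau> i \<le> 9 / real m * (\<Sum>l<m. \<tau> l)" for i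
      proof -
        have eq: "9 / real m * (\<Sum>l<m. r\<^sup>2 * \<tau> l) = r\<^sup>2 * (9 / real m * (\<Sum>l<m. \<tau> l))"
          by (simp add: sum_distrib_left[symmetric])
        show ?thesis unfolding eq using rpos by (simp only: mult_le_cancel_left_pos zero_less_power)
      qed
      have im: "init_mat m n (sensing_vec n \<omega>) x0 = mat n n (\<lambda>(j, k). \<Sum>i<m. of_real (\<rho> i) * (a i j * cnj (a i k)))"
        unfolding init_mat_eq[OF x0(1)] tr cond \<rho>_def a ..
      have "(\<Sum>i<m. \<rho> i * (cmod (A u i))\<^sup>2) * (nrm n (\<lambda>j. z 0 $ j))\<^sup>2 \<le> (\<Sum>i<m. \<rho> i * (cmod (A (\<lambda>j. z 0 $ j) i))\<^sup>2) * (nrm n u)\<^sup>2"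
        by (rule main_eigenvector_Rayleigh) (use main in \<open>simp_all add: im, simp add: \<rho>_def \<tau>_def\<close>)
      then have "(\<Sum>i<m. \<rho> i * (cmod (A u i))\<^sup>2) * (nrm n (Z 0))\<^sup>2 \<le> (\<Sum>i<m. \<rho> i * (cmod (A (Z 0) i))\<^sup>2)"
        using u by (simp add: Z_def)
      also have "\<dots> = (\<Sum>i<m. \<rho> i * (cmod (A (X 0) i))\<^sup>2) * (nrm n (Z 0))\<^sup>2"
      proof -
        have "(cmod (A (X 0) i))\<^sup>2 * (nrm n (Z 0))\<^sup>2 = (cmod (A (Z 0) i))\<^sup>2" for i
          unfolding X_def dotc_scale norm_mult power_mult_distrib using nz by (simp add: norm_divide power_divide)
        then show ?thesis by (simp only: sum_distrib_right mult.assoc)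
      qed
      finally have "(\<Sum>i<m. \<rho> i * (cmod (A u i))\<^sup>2) \<le> (\<Sum>i<m. \<rho> i * (cmod (A (X 0) i))\<^sup>2)"
        by (rule mult_right_le_imp_le) (use nz in simp)
      moreover have "(\<Sum>i<m. \<rho> i * c i) = r\<^sup>2 / real m * (\<Sum>i<m. if \<tau> i \<le> 9 / real m * (\<Sum>l<m. \<tau> l) then \<tau> i * c i else 0)" for c
        unfolding sum_distrib_left \<rho>_def by (rule sum.cong) auto
      ultimately have "r\<^sup>2 / real m * (\<Sum>i<m. if \<tau> i \<le> 9 / real m * (\<Sum>l<m. \<tau> l) then \<tau> i * (cmod (A u i))\<^sup>2 else 0)
        \<le> r\<^sup>2 / real m * (\<Sum>i<m. if \<tau> i \<le> 9 / real m * (\<Sum>l<m. \<tau> l) then \<tau> i * (cmod (A (X 0) i))\<^sup>2 else 0)" by (simp only:)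
      then have "(\<Sum>i<m. if \<tau> i \<le> 9 / real m * (\<Sum>l<m. \<tau> l) then \<tau> i * (cmod (A u i))\<^sup>2 else 0)
        \<le> (\<Sum>i<m. if \<tau> i \<le> 9 / real m * (\<Sum>l<m. \<tau> l) then \<tau> i * (cmod (A (X 0) i))\<^sup>2 else 0)"
        by (rule mult_left_le_imp_le) (use rpos m in simp)
      then show ?thesis by (simp only: \<tau>_def)
    qed
    have nX0: "nrm n (X 0) = 1" unfolding X_def nrm_scale using nz by (simp add: norm_divide)
    have conv: "\<exists>\<phi>. nrm n (\<lambda>j. X t j - cis \<phi> * u j) \<le> (19 / 20) ^ t * (1 / 10 ^ 9)" for t
    proof (induction t)
      case 0
      from spectral_init[OF nX0 top] show ?case by (metis mult_1 power_0)
    next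
      case (Suc t)
      then obtain \<phi> where \<phi>: "nrm n (\<lambda>j. X t j - cis \<phi> * u j) \<le> (19 / 20) ^ t * (1 / 10 ^ 9)" by blast
      have "(19 / 20 :: real) ^ t * (1 / 10 ^ 9) \<le> 1 * (1 / 10 ^ 9)"
        by (rule mult_right_mono) (auto simp: power_le_one)
      then have near: "nrm n (\<lambda>j. X t j - cis \<phi> * u j) \<le> 1 / 10 ^ 9" using \<phi> by simp
      obtain \<phi>' where "nrm n (\<lambda>j. X (Suc t) j - cis \<phi>' * u j) \<le> 19 / 20 * nrm n (\<lambda>j. X t j - cis \<phi> * u j)"
        by (rule step[OF near lsX])
      then have "nrm n (\<lambda>j. X (Suc t) j - cis \<phi>' * u j) \<le> (19 / 20) ^ Suc t * (1 / 10 ^ 9)" using \<phi> by simp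
      then show ?case by blast
    qed
    obtain \<phi> where \<phi>: "nrm n (\<lambda>j. X t j - cis \<phi> * u j) \<le> (19 / 20) ^ t * (1 / 10 ^ 9)" using conv by blast
    have "nrm n (\<lambda>j. Z t j - cis \<phi> * (of_real r * u j)) = nrm n (\<lambda>j. of_real r * (X t j - cis \<phi> * u j))"
      unfolding s Zr by (simp add: right_diff_distrib mult_ac)
    also have "\<dots> = r * nrm n (\<lambda>j. X t j - cis \<phi> * u j)" using rpos by (simp add: nrm_scale)
    also have "\<dots> \<le> r * ((19 / 20) ^ t * 1)"
      by (rule mult_left_mono[OF order_trans[OF \<phi>]]) (use r in \<open>auto intro: mult_left_mono\<close>)
    finally show ?thesis
      by (intro INF_le_of_witness[where x=\<phi>]) (simp_all add: vn vx0 mult.commute)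
  qed
qed

theorem corollary3p7:
  shows "\<exists>C1 C2 M \<delta> :: real. C1 > 0 \<and> C2 > 0 \<and> M > 0 \<and> 0 < \<delta> \<and> \<delta> < 1 \<and>
    (\<forall>n m :: nat. n > 0 \<longrightarrow> m > 0 \<longrightarrow> real m \<ge> M * real n \<longrightarrow>
      (\<forall>x0 \<in> carrier_vec n.
        \<exists>E \<in> sets (sensing_space m n).
          measure (sensing_space m n) E \<ge> 1 - C1 * exp (- C2 * real m) \<and>
          (\<forall>w \<in> E. \<forall>z :: nat \<Rightarrow> complex vec.
            main_eigenvector (init_mat m n (sensing_vec n w) x0) (z 0) \<longrightarrow>
            alt_proj_seq (sensing_mat m n w)
              (map_vec cmod (sensing_mat m n w *\<^sub>v x0)) z \<longrightarrow>
            (\<forall>t\<ge>1. (INF \<phi>::real. vnorm (cis \<phi> \<cdot>\<^sub>v x0 - z t)) \<le> \<delta> ^ t * vnorm x0))))"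
proof -
  obtain e0 :: real where e0: "e0 > 0" "\<And>e. 0 < e \<Longrightarrow> e \<le> e0 \<Longrightarrow> trunc4 (9 * (1 + e)) - trunc4 (9 * (1 - e)) \<le> 1 / 10 ^ 20"
    by (rule trunc4_continuous_at_9[of "1 / 10 ^ 20"]) auto
  \<comment> \<open>\<open>e\<close> is fixed from absolute quantities before \<open>c\<close> and
    \<open>M\<close> are obtained from it, so that these do not depend on \<open>n\<close>,
    \<open>m\<close> or \<open>x0\<close>.\<close>
  define e where "e = min e0 (1 / 10 ^ 30)"
  have e: "0 < e" "e \<le> 1 / 10 ^ 30" "e < 1 / 10" and gap: "trunc4 (9 * (1 + e)) - trunc4 (9 * (1 - e)) \<le> 1 / 10 ^ 20"
    using e0 by (auto simp: e_def min_def)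
  show ?thesis
  proof (rule good_rows_probability[OF e(1,3)])
    fix c M :: real
    assume c: "0 < c" "0 < M" and prob: "\<And>n m u. \<lbrakk>real m \<ge> M * real n; nrm n u = 1\<rbrakk> \<Longrightarrow>
       \<exists>W. ball_net n e W \<and>
         (\<exists>E\<in>sets (sensing_space m n). measure (sensing_space m n) E \<ge> 1 - 14 * exp (- c * real m) \<and>
           (\<forall>\<omega>\<in>E. good_rows n m u W e (\<lambda>i j. \<omega> (i, j))))"
    show ?thesis
    proof (rule exI[of _ 14], rule exI[of _ c], rule exI[of _ M], rule exI[of _ "19 / 20"], intro conjI allI impI ballI)
      fix n m :: nat and x0 :: "complex vec"
      assume n: "n > 0" and m: "m > 0" and mM: "real m \<ge> M * real n" and x0: "x0 \<in> carrier_vec n"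
      \<comment> \<open>For \<open>x0 = 0\<close> any unit vector can serve as the direction; the
        first basis vector is available because \<open>n > 0\<close>.\<close>
      obtain u where uu: "nrm n u = 1" "\<And>j. j < n \<Longrightarrow> x0 $ j = of_real (vnorm x0) * u j"
      proof (cases "nrm n (\<lambda>j. x0 $ j) = 0")
        case True
        have "nrm n (\<lambda>j. if j = 0 then 1 else 0) = 1"
        proof -
          have "(\<Sum>j<n. (cmod (if j = 0 then 1 else 0))\<^sup>2) = (\<Sum>j<n. if j = 0 then 1 else 0)"
            by (rule sum.cong) auto
          then show ?thesis using n by (simp add: nrm_def L2_set_def)
        qed
        moreover have "x0 = 0\<^sub>v n" by (rule nrm_eq_0_vec[OF x0 True])
        moreover have "vnorm x0 = 0" using True by (simp add: vnorm_eq_nrm[OF x0])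
        ultimately show ?thesis by (intro that[of "\<lambda>j. if j = 0 then 1 else 0"]) auto
      next
        case False
        then obtain v where v: "nrm n v = 1" "(\<lambda>j. x0 $ j) = (\<lambda>j. of_real (nrm n (\<lambda>j. x0 $ j)) * v j)"
          by (rule nrm_normalize)
        have "x0 $ j = of_real (vnorm x0) * v j" for j
          using fun_cong[OF v(2), of j] unfolding vnorm_eq_nrm[OF x0] .
        then show ?thesis by (rule that[OF v(1)])
      qed
      \<comment> \<open>The event depends on \<open>x0\<close> through \<open>u\<close> but not on
        \<open>z\<close>, so every choice of a main eigenvector is covered at once.\<close>
      from prob[OF mM uu(1)] obtain W E where W: "ball_net n e W"
        and E: "E \<in> sets (sensing_space m n)" "measure (sensing_space m n) E \<ge> 1 - 14 * exp (- c * real m)"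
        and good: "\<forall>\<omega>\<in>E. good_rows n m u W e (\<lambda>i j. \<omega> (i, j))"
        by (elim exE conjE bexE)
      show "\<exists>E \<in> sets (sensing_space m n).
          measure (sensing_space m n) E \<ge> 1 - 14 * exp (- c * real m) \<and>
          (\<forall>w \<in> E. \<forall>z :: nat \<Rightarrow> complex vec.
            main_eigenvector (init_mat m n (sensing_vec n w) x0) (z 0) \<longrightarrow>
            alt_proj_seq (sensing_mat m n w)
              (map_vec cmod (sensing_mat m n w *\<^sub>v x0)) z \<longrightarrow>
            (\<forall>t\<ge>1. (INF \<phi>::real. vnorm (cis \<phi> \<cdot>\<^sub>v x0 - z t)) \<le> (19 / 20) ^ t * vnorm x0))"
      proof (intro bexI[OF _ E(1)] conjI ballI allI impI)
        show "measure (sensing_space m n) E \<ge> 1 - 14 * exp (- c * real m)" by (rule E(2))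
        fix \<omega> z and t :: nat
        assume \<omega>: "\<omega> \<in> E" and main: "main_eigenvector (init_mat m n (sensing_vec n \<omega>) x0) (z 0)"
          and seq: "alt_proj_seq (sensing_mat m n \<omega>) (map_vec cmod (sensing_mat m n \<omega> *\<^sub>v x0)) z" and t: "t \<ge> 1"
        interpret good_frame n m "\<lambda>i j. \<omega> (i, j)" u W e
          using m uu(1) e(1,2) gap W bspec[OF good \<omega>] unfolding ball_net_def by unfold_locales simp_all
        have r: "vnorm x0 \<ge> 0" by (simp add: vnorm_eq_nrm[OF x0])
        show "(INF \<phi>::real. vnorm (cis \<phi> \<cdot>\<^sub>v x0 - z t)) \<le> (19 / 20) ^ t * vnorm x0"
          by (rule alternating_projections_converge[where \<omega>=\<omega> and r="vnorm x0"])
            (rule refl, rule x0, erule uu(2), rule r, rule main, rule seq, rule t)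
      qed
    qed (use c in auto)
  qed
qed

end
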